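(* Let $R$ be a Cohen--Macaulay local ring of dimension $d\ge 0$. Let $I$ be a non-parameter Ulrich ideal of $R$ containing a parameter ideal of $R$ as a reduction. Put $t=\nu(I)-d$, where $\nu(I)$ denotes the minimal number of generators of $I$. Then there is an isomorphism $$\mathbf{R}\mathrm{Hom}_R(R/I,R)\cong\bigoplus_{i\in\mathbb{Z}}(R/I)^{\oplus u_i}[-i]$$ in the derived category of $R$, where $$u_i=\begin{cases}0 & (i<d),\\ t & (i=d),\\ (t^2-1)t^{i-d-1} & (i>d).\end{cases}$$ In particular, one has $\mathrm{Ext}_R^i(R/I,R)\cong(R/I)^{\oplus u_i}$ for each integer $i$.
   Context: Let $R$ be a Cohen--Macaulay local ring with maximal ideal $\mathfrak m$ and dimension $d$. A parameter ideal is an ideal generated by a system of parameters of $R$. An $\mathfrak m$-primary ideal $I$ containing a parameter ideal $Q$ as a reduction is called an Ulrich ideal if $I^2=QI$ and $I/I^2$ is a free $R/I$-module. "Non-parameter" means that $I$ is not a parameter ideal. *)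

theory Defs
  imports "HOL-Algebra.Algebra" "HOL-Library.Extended_Nat"
begin

section \<open>Local rings, dimension, depth\<close>

definition noetherian_local_ring :: "('a, 'r) ring_scheme \<Rightarrow> 'a set \<Rightarrow> bool" where
  "noetherian_local_ring R m \<longleftrightarrow>
     cring R \<and> noetherian_ring R \<and> maximalideal m R \<and> (\<forall>n. maximalideal n R \<longrightarrow> n = m)"

definition krull_dim :: "('a, 'r) ring_scheme \<Rightarrow> enat" where
  "krull_dim R =
     (SUP n \<in> {n. \<exists>P :: nat \<Rightarrow> 'a set.
                     (\<forall>i\<le>n. primeideal (P i) R) \<and> (\<forall>i<n. P i \<subset> P (Suc i))}. enat n)"

text \<open>The middle conjunct says that \<open>xs ! i\<close> is a nonzerodivisor modulo its
  predecessors.\<close>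

definition regular_sequence :: "('a, 'r) ring_scheme \<Rightarrow> 'a list \<Rightarrow> bool" where
  "regular_sequence R xs \<longleftrightarrow>
     set xs \<subseteq> carrier R \<and>
     (\<forall>i<length xs. \<forall>a\<in>carrier R.
        xs ! i \<otimes>\<^bsub>R\<^esub> a \<in> genideal R (set (take i xs)) \<longrightarrow> a \<in> genideal R (set (take i xs))) \<and>
     genideal R (set xs) \<noteq> carrier R"

definition ring_depth :: "('a, 'r) ring_scheme \<Rightarrow> 'a set \<Rightarrow> enat" where
  "ring_depth R m = (SUP xs \<in> {xs. regular_sequence R xs \<and> set xs \<subseteq> m}. enat (length xs))"

definition cohen_macaulay_local_ring :: "('a, 'r) ring_scheme \<Rightarrow> 'a set \<Rightarrow> bool" where
  "cohen_macaulay_local_ring R m \<longleftrightarrow> noetherian_local_ring R m \<and> ring_depth R m = krull_dim R"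


section \<open>Parameter ideals and reductions\<close>

definition radical :: "('a, 'r) ring_scheme \<Rightarrow> 'a set \<Rightarrow> 'a set" where
  "radical R I = {x \<in> carrier R. \<exists>n::nat. x [^]\<^bsub>R\<^esub> n \<in> I}"

definition primary_ideal :: "('a, 'r) ring_scheme \<Rightarrow> 'a set \<Rightarrow> bool" where
  "primary_ideal R I \<longleftrightarrow>
     ideal I R \<and> I \<noteq> carrier R \<and>
     (\<forall>x\<in>carrier R. \<forall>y\<in>carrier R. x \<otimes>\<^bsub>R\<^esub> y \<in> I \<longrightarrow> x \<in> I \<or> y \<in> radical R I)"

definition m_primary :: "('a, 'r) ring_scheme \<Rightarrow> 'a set \<Rightarrow> 'a set \<Rightarrow> bool" where
  "m_primary R m I \<longleftrightarrow> primary_ideal R I \<and> radical R I = m"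

definition system_of_parameters :: "('a, 'r) ring_scheme \<Rightarrow> 'a set \<Rightarrow> 'a list \<Rightarrow> bool" where
  "system_of_parameters R m xs \<longleftrightarrow>
     set xs \<subseteq> m \<and> enat (length xs) = krull_dim R \<and> m_primary R m (genideal R (set xs))"

definition parameter_ideal :: "('a, 'r) ring_scheme \<Rightarrow> 'a set \<Rightarrow> 'a set \<Rightarrow> bool" where
  "parameter_ideal R m Q \<longleftrightarrow> (\<exists>xs. system_of_parameters R m xs \<and> Q = genideal R (set xs))"

primrec ideal_power :: "('a, 'r) ring_scheme \<Rightarrow> 'a set \<Rightarrow> nat \<Rightarrow> 'a set" where
  "ideal_power R I 0 = carrier R"
| "ideal_power R I (Suc n) = ideal_prod R I (ideal_power R I n)"

definition reduction_of :: "('a, 'r) ring_scheme \<Rightarrow> 'a set \<Rightarrow> 'a set \<Rightarrow> bool" where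
  "reduction_of R Q I \<longleftrightarrow>
     ideal Q R \<and> ideal I R \<and> Q \<subseteq> I \<and>
     (\<exists>n. ideal_power R I (Suc n) = ideal_prod R Q (ideal_power R I n))"

definition num_gens :: "('a, 'r) ring_scheme \<Rightarrow> 'a set \<Rightarrow> nat" where
  "num_gens R I = (LEAST n. \<exists>A \<subseteq> carrier R. finite A \<and> card A = n \<and> I = genideal R A)"


section \<open>Modules\<close>

text \<open>The record \<^typ>\<open>('a, 'b) module\<close> inherits the fields \<^const>\<open>monoid.mult\<close> and
  \<^const>\<open>one\<close> from the ring record. They play no role in \<^locale>\<open>module\<close> and are left
  \<^const>\<open>undefined\<close> below.\<close>

definition regular_module :: "('a, 'r) ring_scheme \<Rightarrow> ('a, 'a) module" where
  "regular_module R =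
     \<lparr>carrier = carrier R, monoid.mult = undefined, one = undefined, ring.zero = \<zero>\<^bsub>R\<^esub>,
      ring.add = ring.add R, module.smult = monoid.mult R\<rparr>"

text \<open>For a submodule \<open>N\<close> of \<open>M\<close> the union in the scalar multiplication is a union of equal cosets
  (compare \<^const>\<open>rcoset_mult\<close>).\<close>

definition quot_module :: "('a, 'b) module \<Rightarrow> 'b set \<Rightarrow> ('a, 'b set) module" where
  "quot_module M N =
     \<lparr>carrier = a_rcosets\<^bsub>M\<^esub> N, monoid.mult = undefined, one = undefined, ring.zero = N,
      ring.add = set_add M, module.smult = (\<lambda>r A. \<Union>x\<in>A. N +>\<^bsub>M\<^esub> (r \<odot>\<^bsub>M\<^esub> x))\<rparr>"

definition residue_module :: "('a, 'r) ring_scheme \<Rightarrow> 'a set \<Rightarrow> ('a, 'a set) module" where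
  "residue_module R I = quot_module (regular_module R) I"

text \<open>\<open>I / I\<^sup>2\<close> as a module over \<open>R / I\<close>; scalars are cosets of \<open>I\<close>.\<close>

definition conormal_module :: "('a, 'r) ring_scheme \<Rightarrow> 'a set \<Rightarrow> ('a set, 'a set) module" where
  "conormal_module R I =
     (let I2 = ideal_power R I 2; M = quot_module ((regular_module R)\<lparr>carrier := I\<rparr>) I2 in
      \<lparr>carrier = carrier M, monoid.mult = undefined, one = undefined, ring.zero = ring.zero M,
       ring.add = ring.add M, module.smult = (\<lambda>C A. \<Union>r\<in>C. r \<odot>\<^bsub>M\<^esub> A)\<rparr>)"

definition is_basis :: "('s, 'r) ring_scheme \<Rightarrow> ('s, 'b) module \<Rightarrow> 'b set \<Rightarrow> bool" where
  "is_basis S M B \<longleftrightarrow>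
     B \<subseteq> carrier M \<and>
     (\<forall>x\<in>carrier M. \<exists>!c. c \<in> B \<rightarrow>\<^sub>E carrier S \<and> finite {b \<in> B. c b \<noteq> \<zero>\<^bsub>S\<^esub>} \<and>
        x = finsum M (\<lambda>b. c b \<odot>\<^bsub>M\<^esub> b) {b \<in> B. c b \<noteq> \<zero>\<^bsub>S\<^esub>})"

definition free_module :: "('s, 'r) ring_scheme \<Rightarrow> ('s, 'b) module \<Rightarrow> bool" where
  "free_module S M \<longleftrightarrow> module S M \<and> (\<exists>B. is_basis S M B)"

definition dsum_module :: "'i set \<Rightarrow> ('i \<Rightarrow> ('a, 'b) module) \<Rightarrow> ('a, 'i \<Rightarrow> 'b) module" where
  "dsum_module J M =
     \<lparr>carrier = {f \<in> (\<Pi>\<^sub>E j\<in>J. carrier (M j)). finite {j \<in> J. f j \<noteq> \<zero>\<^bsub>M j\<^esub>}},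
      monoid.mult = undefined, one = undefined,
      ring.zero = (\<lambda>j\<in>J. \<zero>\<^bsub>M j\<^esub>),
      ring.add = (\<lambda>f g. \<lambda>j\<in>J. f j \<oplus>\<^bsub>M j\<^esub> g j),
      module.smult = (\<lambda>r f. \<lambda>j\<in>J. r \<odot>\<^bsub>M j\<^esub> f j)\<rparr>"

definition power_module :: "('a, 'b) module \<Rightarrow> nat \<Rightarrow> ('a, nat \<Rightarrow> 'b) module" where
  "power_module M n = dsum_module {..<n} (\<lambda>_. M)"

definition module_hom ::
    "('a, 'r) ring_scheme \<Rightarrow> ('a, 'b) module \<Rightarrow> ('a, 'c) module \<Rightarrow> ('b \<Rightarrow> 'c) set" where
  "module_hom R M N =
     {f \<in> carrier M \<rightarrow> carrier N.
        (\<forall>x\<in>carrier M. \<forall>y\<in>carrier M. f (x \<oplus>\<^bsub>M\<^esub> y) = f x \<oplus>\<^bsub>N\<^esub> f y) \<and>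
        (\<forall>r\<in>carrier R. \<forall>x\<in>carrier M. f (r \<odot>\<^bsub>M\<^esub> x) = r \<odot>\<^bsub>N\<^esub> f x)}"

definition module_iso :: "('a, 'r) ring_scheme \<Rightarrow> ('a, 'b) module \<Rightarrow> ('a, 'c) module \<Rightarrow> bool" where
  "module_iso R M N \<longleftrightarrow>
     module R M \<and> module R N \<and> (\<exists>f \<in> module_hom R M N. bij_betw f (carrier M) (carrier N))"

definition hom_module ::
    "('a, 'r) ring_scheme \<Rightarrow> ('a, 'b) module \<Rightarrow> ('a, 'c) module \<Rightarrow> ('a, 'b \<Rightarrow> 'c) module" where
  "hom_module R M N =
     \<lparr>carrier = module_hom R M N \<inter> extensional (carrier M),
      monoid.mult = undefined, one = undefined,
      ring.zero = (\<lambda>x\<in>carrier M. \<zero>\<^bsub>N\<^esub>),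
      ring.add = (\<lambda>f g. \<lambda>x\<in>carrier M. f x \<oplus>\<^bsub>N\<^esub> g x),
      module.smult = (\<lambda>r f. \<lambda>x\<in>carrier M. r \<odot>\<^bsub>N\<^esub> f x)\<rparr>"

text \<open>HOL cannot quantify over modules of all types inside a definition, so the test modules
  \<open>A\<close>, \<open>B\<close> are those carried by the element type \<open>'a\<close> of \<open>R\<close>. This loses nothing: these include
  \<open>R\<close> and its ideals, so by Baer's criterion the lifting property follows for modules of every
  other type.\<close>

definition injective_module :: "('a, 'r) ring_scheme \<Rightarrow> ('a, 'e) module \<Rightarrow> bool" where
  "injective_module R E \<longleftrightarrow>
     module R E \<and>
     (\<forall>(A :: ('a, 'a) module) (B :: ('a, 'a) module) j g.
        module R A \<and> module R B \<and> j \<in> module_hom R A B \<and> inj_on j (carrier A) \<and>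
        g \<in> module_hom R A E \<longrightarrow>
        (\<exists>h \<in> module_hom R B E. \<forall>x\<in>carrier A. h (j x) = g x))"


section \<open>Cochain complexes\<close>

record ('a, 'b) cochain =
  obj :: "int \<Rightarrow> ('a, 'b) module"
  diff :: "int \<Rightarrow> 'b \<Rightarrow> 'b"

definition cochain_complex :: "('a, 'r) ring_scheme \<Rightarrow> ('a, 'b) cochain \<Rightarrow> bool" where
  "cochain_complex R C \<longleftrightarrow>
     (\<forall>i. module R (obj C i) \<and> diff C i \<in> module_hom R (obj C i) (obj C (i + 1)) \<and>
          (\<forall>x \<in> carrier (obj C i). diff C (i + 1) (diff C i x) = \<zero>\<^bsub>obj C (i + 2)\<^esub>))"

definition cocycles :: "('a, 'b) cochain \<Rightarrow> int \<Rightarrow> 'b set" where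
  "cocycles C i = {x \<in> carrier (obj C i). diff C i x = \<zero>\<^bsub>obj C (i + 1)\<^esub>}"

definition coboundaries :: "('a, 'b) cochain \<Rightarrow> int \<Rightarrow> 'b set" where
  "coboundaries C i = diff C (i - 1) ` carrier (obj C (i - 1))"

definition cohomology :: "('a, 'b) cochain \<Rightarrow> int \<Rightarrow> ('a, 'b set) module" where
  "cohomology C i = quot_module ((obj C i)\<lparr>carrier := cocycles C i\<rparr>) (coboundaries C i)"

definition chain_map ::
    "('a, 'r) ring_scheme \<Rightarrow> ('a, 'b) cochain \<Rightarrow> ('a, 'c) cochain \<Rightarrow> (int \<Rightarrow> 'b \<Rightarrow> 'c) \<Rightarrow> bool" where
  "chain_map R C D f \<longleftrightarrow>
     (\<forall>i. f i \<in> module_hom R (obj C i) (obj D i) \<and>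
          (\<forall>x \<in> carrier (obj C i). f (i + 1) (diff C i x) = diff D i (f i x)))"

text \<open>The map induced on cohomology sends the coset \<open>A\<close> of a cocycle \<open>z\<close> to the coset of \<open>f i z\<close>.\<close>

definition cohomology_map ::
    "('a, 'c) cochain \<Rightarrow> (int \<Rightarrow> 'b \<Rightarrow> 'c) \<Rightarrow> int \<Rightarrow> 'b set \<Rightarrow> 'c set" where
  "cohomology_map D f i A = (\<Union>z\<in>A. coboundaries D i +>\<^bsub>obj D i\<^esub> f i z)"

definition quasi_iso ::
    "('a, 'r) ring_scheme \<Rightarrow> ('a, 'b) cochain \<Rightarrow> ('a, 'c) cochain \<Rightarrow> (int \<Rightarrow> 'b \<Rightarrow> 'c) \<Rightarrow> bool" where
  "quasi_iso R C D f \<longleftrightarrow>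
     chain_map R C D f \<and>
     (\<forall>i. bij_betw (cohomology_map D f i) (carrier (cohomology C i)) (carrier (cohomology D i)))"

text \<open>Isomorphism of \<open>K\<close> and \<open>L\<close> in the derived category of \<open>R\<close>, that is, a roof of
  quasi-isomorphisms \<open>K \<leftarrow> Z \<rightarrow> L\<close>. The apex \<open>Z\<close> is carried by the element type of \<open>L\<close>. Such a roof
  always gives an isomorphism in the derived category. Conversely, if that type is infinite and has
  at least as many elements as \<open>R\<close>, it carries a K-projective resolution \<open>Z\<close> of \<open>L\<close>, and any
  isomorphism in the derived category is given by a roof with this apex.\<close>

definition derived_iso ::
    "('a, 'r) ring_scheme \<Rightarrow> ('a, 'b) cochain \<Rightarrow> ('a, 'c) cochain \<Rightarrow> bool" where
  "derived_iso R K L \<longleftrightarrow>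
     cochain_complex R K \<and> cochain_complex R L \<and>
     (\<exists>Z :: ('a, 'c) cochain. cochain_complex R Z \<and>
        (\<exists>f. quasi_iso R Z K f) \<and> (\<exists>g. quasi_iso R Z L g))"

definition stalk_complex :: "('a, 'b) module \<Rightarrow> ('a, 'b) cochain" where
  "stalk_complex M =
     \<lparr>obj = (\<lambda>i. if i = 0 then M else M\<lparr>carrier := {\<zero>\<^bsub>M\<^esub>}\<rparr>), diff = (\<lambda>i x. \<zero>\<^bsub>M\<^esub>)\<rparr>"

text \<open>\<open>C[k]\<close>, with \<open>C[k]\<^sup>n = C\<^sup>n\<^sup>+\<^sup>k\<close> and differential multiplied by \<open>(-1)\<^sup>k\<close>.\<close>

definition shift_complex :: "('a, 'b) cochain \<Rightarrow> int \<Rightarrow> ('a, 'b) cochain" where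
  "shift_complex C k =
     \<lparr>obj = (\<lambda>n. obj C (n + k)),
      diff = (\<lambda>n x. if even k then diff C (n + k) x
                    else \<ominus>\<^bsub>obj C (n + k + 1)\<^esub> diff C (n + k) x)\<rparr>"

definition dsum_complex :: "'i set \<Rightarrow> ('i \<Rightarrow> ('a, 'b) cochain) \<Rightarrow> ('a, 'i \<Rightarrow> 'b) cochain" where
  "dsum_complex J C =
     \<lparr>obj = (\<lambda>n. dsum_module J (\<lambda>j. obj (C j) n)),
      diff = (\<lambda>n f. \<lambda>j\<in>J. diff (C j) n (f j))\<rparr>"


section \<open>Derived Hom and Ext\<close>

definition injective_resolution ::
    "('a, 'r) ring_scheme \<Rightarrow> ('a, 'b) module \<Rightarrow> ('a, 'e) cochain \<Rightarrow> bool" where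
  "injective_resolution R N E \<longleftrightarrow>
     cochain_complex R E \<and>
     (\<forall>i<0. carrier (obj E i) = {\<zero>\<^bsub>obj E i\<^esub>}) \<and>
     (\<forall>i. injective_module R (obj E i)) \<and>
     (\<exists>\<epsilon>. quasi_iso R (stalk_complex N) E \<epsilon>)"

text \<open>When \<open>E\<close> is an injective resolution of \<open>N\<close>, \<open>RHom R M E\<close> is the complex \<open>Hom\<^sub>R(M, E)\<close>, which
  represents \<open>\<^bold>RHom\<^sub>R(M, N)\<close> in the derived category, and \<open>Ext R M E i\<close> is \<open>Ext\<^sup>i\<^sub>R(M, N)\<close>. Both
  are independent of \<open>E\<close> up to isomorphism, so statements about them are made for every injective
  resolution \<open>E\<close>.\<close>

definition RHom ::
    "('a, 'r) ring_scheme \<Rightarrow> ('a, 'b) module \<Rightarrow> ('a, 'e) cochain \<Rightarrow> ('a, 'b \<Rightarrow> 'e) cochain" where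
  "RHom R M E =
     \<lparr>obj = (\<lambda>i. hom_module R M (obj E i)),
      diff = (\<lambda>i f. \<lambda>x\<in>carrier M. diff E i (f x))\<rparr>"

definition Ext ::
    "('a, 'r) ring_scheme \<Rightarrow> ('a, 'b) module \<Rightarrow> ('a, 'e) cochain \<Rightarrow> int \<Rightarrow>
     ('a, ('b \<Rightarrow> 'e) set) module" where
  "Ext R M E i = cohomology (RHom R M E) i"


section \<open>Ulrich ideals\<close>

definition ulrich_ideal :: "('a, 'r) ring_scheme \<Rightarrow> 'a set \<Rightarrow> 'a set \<Rightarrow> bool" where
  "ulrich_ideal R m I \<longleftrightarrow>
     m_primary R m I \<and>
     (\<exists>Q. parameter_ideal R m Q \<and> reduction_of R Q I \<and> ideal_power R I 2 = ideal_prod R Q I) \<and>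
     free_module (R Quot I) (conormal_module R I)"

text \<open>The multiplicity \<open>u\<^sub>i\<close>. The subtraction \<open>t\<^sup>2 - 1\<close> on \<^typ>\<open>nat\<close> truncates only for
  \<open>t = 0\<close>. An \<open>m\<close>-primary ideal that is not a parameter ideal needs more than \<open>d\<close> generators, so in
  that situation \<open>t = \<nu>(I) - d\<close> is positive.\<close>

definition ulrich_mult :: "nat \<Rightarrow> nat \<Rightarrow> int \<Rightarrow> nat" where
  "ulrich_mult d t i =
     (if i < int d then 0
      else if i = int d then t
      else (t\<^sup>2 - 1) * t ^ nat (i - int d - 1))"

end

theory Submission
  imports Defs
begin

text \<open>Let \<open>Q\<close> be the given parameter ideal. Since \<open>R\<close> is Cohen--Macaulay, \<open>Q\<close> is generated by a
  regular sequence, so \<open>\<^bold>RHom(R/Q, R) \<cong> R/Q[-d]\<close>. A minimal generator of \<open>Q\<close> is not in \<open>m I\<close>, so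
  generators of \<open>Q\<close> extend to a basis of \<open>I/I\<^sup>2\<close> and \<open>I/Q\<close> is free of rank \<open>t\<close> over \<open>R/I\<close>. The long
  exact sequence of \<open>0 \<rightarrow> (R/I)\<^sup>t \<rightarrow> R/Q \<rightarrow> R/I \<rightarrow> 0\<close> gives \<open>Ext\<^sup>d = I/Q\<close>,
  \<open>Ext\<^sup>d\<^sup>+\<^sup>1 = Mat\<^sub>t(R/I) / (R/I) 1\<close> and \<open>Ext\<^sup>i\<^sup>+\<^sup>1 = (Ext\<^sup>i)\<^sup>t\<close> for \<open>i > d\<close>. As \<open>Hom(R/I, E)\<close> is a
  complex of \<open>R/I\<close>-modules with free cohomology, cocycles lifting the bases define a
  quasi-isomorphism from the direct sum of the shifted cohomology modules.

  For an ideal \<open>J\<close> the complex \<open>Hom(R/J, E)\<close> is represented by the \<open>J\<close>-torsion of \<open>E\<close>.\<close>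

section \<open>Ideals and zero divisors\<close>

text \<open>The definition of Cohen--Macaulay yields one regular sequence of length
  \<open>d\<close>, unrelated to \<open>Q\<close>. What carries over to \<open>Q\<close> is a
  statement on depth: modulo any shorter regular sequence in \<open>m\<close>, no nonzero class is
  killed by \<open>m\<close>. With prime avoidance this permits changing the generators of
  \<open>Q\<close> one at a time into a regular sequence of the same ideal, leaving the last
  generator alone. The argument about \<open>m I\<close> depends on that, since there the generator
  in question has to be regular modulo all the others.

  The resolution \<open>E\<close> is an arbitrary injective one over an arbitrary type, so the long
  exact sequences are replaced by computations with cocycles, coboundaries and explicit lifts. Lifts
  exist by Baer's condition, applied to a finite family of equations \<open>y k x = z k\<close> at
  once. All that is used of the cohomology of \<open>Hom(R/Q, E)\<close> is one cocycle
  \<open>e\<close> of degree \<open>d\<close> whose class generates it.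

  In degree \<open>d + 1\<close> there are \<open>t * t\<close> connecting images, and the class of
  \<open>e\<close> contributes one relation in which a coefficient is 1; hence
  \<open>t * t - 1\<close>. From there on the cohomology of \<open>Hom(R/Q, E)\<close> vanishes on
  both sides of each connecting map, hence the factor \<open>t\<close> per degree.\<close>

context ring
begin

lemma ideal_memD: "ideal J R \<Longrightarrow> x \<in> J \<Longrightarrow> x \<in> carrier R"
  by (rule ideal.Icarr)

lemma ideal_subset_carrier: "ideal J R \<Longrightarrow> J \<subseteq> carrier R"
  using ideal_memD by blast

lemma ideal_zero_mem: "ideal J R \<Longrightarrow> \<zero> \<in> J"
  by (simp add: additive_subgroup.zero_closed ideal.axioms(1))

lemma ideal_add_mem: "ideal J R \<Longrightarrow> x \<in> J \<Longrightarrow> y \<in> J \<Longrightarrow> x \<oplus> y \<in> J"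
  by (simp add: additive_subgroup.a_closed ideal.axioms(1))

lemma ideal_neg_mem: "ideal J R \<Longrightarrow> x \<in> J \<Longrightarrow> \<ominus> x \<in> J"
  by (simp add: additive_subgroup.a_inv_closed ideal.axioms(1))

lemma ideal_diff_mem: "ideal J R \<Longrightarrow> x \<in> J \<Longrightarrow> y \<in> J \<Longrightarrow> x \<ominus> y \<in> J"
  by (simp add: minus_eq ideal_add_mem ideal_neg_mem)

lemma ideal_lmult_mem: "ideal J R \<Longrightarrow> x \<in> J \<Longrightarrow> r \<in> carrier R \<Longrightarrow> r \<otimes> x \<in> J"
  by (rule ideal.I_l_closed)

lemma ideal_rmult_mem: "ideal J R \<Longrightarrow> x \<in> J \<Longrightarrow> r \<in> carrier R \<Longrightarrow> x \<otimes> r \<in> J"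
  by (rule ideal.I_r_closed)

lemmas ideal_mem = ideal_zero_mem ideal_add_mem ideal_neg_mem ideal_diff_mem
  ideal_lmult_mem ideal_rmult_mem

lemma ideal_add_cancel:
  assumes "ideal J R" "x \<in> carrier R" "y \<in> J" "x \<oplus> y \<in> J"
  shows "x \<in> J"
proof -
  have "y \<in> carrier R" using assms ideal_memD by blast
  then have "x = (x \<oplus> y) \<oplus> \<ominus> y" using assms(2) by algebra
  then show ?thesis using assms by (metis ideal_add_mem ideal_neg_mem)
qed

end

section \<open>Adjoining elements to an ideal, colon ideals and prime avoidance\<close>

context cring
begin

lemma idealI_comm:
  assumes "J \<subseteq> carrier R" "\<zero> \<in> J"
    and add: "\<And>x y. x \<in> J \<Longrightarrow> y \<in> J \<Longrightarrow> x \<oplus> y \<in> J"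
    and mult: "\<And>r x. r \<in> carrier R \<Longrightarrow> x \<in> J \<Longrightarrow> r \<otimes> x \<in> J"
  shows "ideal J R"
proof (rule idealI[OF ring_axioms])
  have neg: "\<ominus> x \<in> J" if "x \<in> J" for x
  proof -
    have "x \<in> carrier R" using that assms(1) by blast
    then have "\<ominus> x = \<ominus> \<one> \<otimes> x" by algebra
    then show ?thesis using mult[of "\<ominus> \<one>" x] that by simp
  qed
  show "subgroup J (add_monoid R)"
    by (rule add.subgroupI) (use assms neg in \<open>auto simp flip: a_inv_def\<close>)
  show "a \<otimes> x \<in> J" if "a \<in> J" "x \<in> carrier R" for a x
    using mult[of x a] that m_comm[of a x] assms(1) by auto
qed (use mult in auto)

text \<open>The ideal \<open>J + R x\<close>, with each element displayed together with a
  coefficient of \<open>x\<close>, on which the calculations below operate.\<close>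

definition adjoin :: "'a set \<Rightarrow> 'a \<Rightarrow> 'a set" where
  "adjoin J x = {j \<oplus> r \<otimes> x | j r. j \<in> J \<and> r \<in> carrier R}"

primrec adjoins :: "'a set \<Rightarrow> 'a list \<Rightarrow> 'a set" where
  "adjoins J [] = J"
| "adjoins J (x # xs) = adjoins (adjoin J x) xs"

lemma adjoinI: "j \<in> J \<Longrightarrow> r \<in> carrier R \<Longrightarrow> j \<oplus> r \<otimes> x \<in> adjoin J x"
  by (auto simp: adjoin_def)

lemma adjoinE:
  assumes "a \<in> adjoin J x"
  obtains j r where "j \<in> J" "r \<in> carrier R" "a = j \<oplus> r \<otimes> x"
  using assms by (auto simp: adjoin_def)

lemma subset_adjoin:
  assumes "ideal J R" "x \<in> carrier R"
  shows "J \<subseteq> adjoin J x"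
proof
  fix a assume "a \<in> J"
  then show "a \<in> adjoin J x"
    using adjoinI[of a J \<zero> x] assms ideal_memD by (metis l_null r_zero zero_closed)
qed

lemma mem_adjoin:
  assumes "ideal J R" "x \<in> carrier R"
  shows "x \<in> adjoin J x"
  using adjoinI[OF ideal_zero_mem[OF assms(1)] one_closed, of x] assms(2) by simp

lemma adjoin_ideal:
  assumes J: "ideal J R" and x: "x \<in> carrier R"
  shows "ideal (adjoin J x) R"
proof (rule idealI_comm)
  show "adjoin J x \<subseteq> carrier R"
    using J x by (auto simp: adjoin_def ideal_memD)
  show "\<zero> \<in> adjoin J x"
    using subset_adjoin[OF assms] ideal_zero_mem[OF J] by blast
next
  fix a b assume "a \<in> adjoin J x" "b \<in> adjoin J x"
  then obtain j r k s where *: "j \<in> J" "r \<in> carrier R" "a = j \<oplus> r \<otimes> x"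
    "k \<in> J" "s \<in> carrier R" "b = k \<oplus> s \<otimes> x" by (metis adjoinE)
  then have "j \<in> carrier R" "k \<in> carrier R" using J ideal_memD by auto
  with * x have "a \<oplus> b = (j \<oplus> k) \<oplus> (r \<oplus> s) \<otimes> x" by algebra
  then show "a \<oplus> b \<in> adjoin J x"
    using adjoinI[OF ideal_add_mem[OF J]] * by simp
next
  fix c a assume c: "c \<in> carrier R" and "a \<in> adjoin J x"
  then obtain j r where *: "j \<in> J" "r \<in> carrier R" "a = j \<oplus> r \<otimes> x" by (metis adjoinE)
  then have "j \<in> carrier R" using J ideal_memD by auto
  with * x c have "c \<otimes> a = c \<otimes> j \<oplus> (c \<otimes> r) \<otimes> x" by algebra
  then show "c \<otimes> a \<in> adjoin J x"
    using adjoinI[OF ideal_lmult_mem[OF J]] * c by simp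
qed

lemma adjoin_subset_iff:
  assumes "ideal J R" "x \<in> carrier R" "ideal K R"
  shows "adjoin J x \<subseteq> K \<longleftrightarrow> J \<subseteq> K \<and> x \<in> K"
proof
  assume "adjoin J x \<subseteq> K"
  then show "J \<subseteq> K \<and> x \<in> K" using subset_adjoin mem_adjoin assms by blast
next
  assume "J \<subseteq> K \<and> x \<in> K"
  then show "adjoin J x \<subseteq> K"
    using assms by (auto simp: adjoin_def intro!: ideal_add_mem ideal_lmult_mem)
qed

lemma adjoins_ideal:
  "ideal J R \<Longrightarrow> set xs \<subseteq> carrier R \<Longrightarrow> ideal (adjoins J xs) R"
  by (induction xs arbitrary: J) (auto intro: adjoin_ideal)

lemma adjoins_subset_iff:
  "ideal J R \<Longrightarrow> set xs \<subseteq> carrier R \<Longrightarrow> ideal K R \<Longrightarrow>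
    adjoins J xs \<subseteq> K \<longleftrightarrow> J \<subseteq> K \<and> set xs \<subseteq> K"
  by (induction xs arbitrary: J) (auto simp: adjoin_ideal adjoin_subset_iff)

lemma subset_adjoins: "ideal J R \<Longrightarrow> set xs \<subseteq> carrier R \<Longrightarrow> J \<subseteq> adjoins J xs"
  using adjoins_subset_iff[OF _ _ adjoins_ideal] by blast

lemma set_subset_adjoins: "ideal J R \<Longrightarrow> set xs \<subseteq> carrier R \<Longrightarrow> set xs \<subseteq> adjoins J xs"
  using adjoins_subset_iff[OF _ _ adjoins_ideal] by blast

lemma adjoins_append: "adjoins J (xs @ ys) = adjoins (adjoins J xs) ys"
  by (induction xs arbitrary: J) auto

lemma adjoins_eqI:
  assumes "ideal J R" "set xs \<subseteq> carrier R" "ideal K R" "set ys \<subseteq> carrier R"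
    and "J \<union> set xs \<subseteq> adjoins K ys" "K \<union> set ys \<subseteq> adjoins J xs"
  shows "adjoins J xs = adjoins K ys"
proof
  show "adjoins J xs \<subseteq> adjoins K ys"
    using adjoins_subset_iff[OF assms(1,2) adjoins_ideal[OF assms(3,4)]] assms(5) by blast
  show "adjoins K ys \<subseteq> adjoins J xs"
    using adjoins_subset_iff[OF assms(3,4) adjoins_ideal[OF assms(1,2)]] assms(6) by blast
qed

text \<open>\<open>adjoins\<close> consumes its list from the left, while exchange arguments bring
  in a new element at either end. The ideal does not depend on the order of its generators.\<close>

lemma adjoins_adjoin_swap:
  assumes "ideal J R" "set xs \<subseteq> carrier R" "x \<in> carrier R"
  shows "adjoins (adjoin J x) xs = adjoin (adjoins J xs) x"
proof -
  have "adjoins J (x # xs) = adjoins J (xs @ [x])"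
  proof (rule adjoins_eqI)
    show "J \<union> set (x # xs) \<subseteq> adjoins J (xs @ [x])"
      using subset_adjoins[OF assms(1), of "xs @ [x]"] set_subset_adjoins[OF assms(1), of "xs @ [x]"]
        assms by auto
    show "J \<union> set (xs @ [x]) \<subseteq> adjoins J (x # xs)"
      using subset_adjoins[OF assms(1), of "x # xs"] set_subset_adjoins[OF assms(1), of "x # xs"]
        assms by auto
  qed (use assms in auto)
  then show ?thesis by (simp add: adjoins_append)
qed

lemma adjoins_zero_eq_genideal:
  assumes "set xs \<subseteq> carrier R"
  shows "adjoins {\<zero>} xs = Idl (set xs)"
proof
  show "adjoins {\<zero>} xs \<subseteq> Idl (set xs)"
    using assms by (simp add: adjoins_subset_iff zeroideal genideal_ideal genideal_self ideal_zero_mem)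
  show "Idl (set xs) \<subseteq> adjoins {\<zero>} xs"
    by (rule genideal_minimal) (use assms adjoins_ideal set_subset_adjoins zeroideal in auto)
qed

text \<open>Usually written \<open>(J : a)\<close>: the annihilator of the class of \<open>a\<close>
  in \<open>R/J\<close>. The associated primes of \<open>R/J\<close> are the prime ideals of this
  form.\<close>

definition colon :: "'a set \<Rightarrow> 'a \<Rightarrow> 'a set" where
  "colon J a = {r \<in> carrier R. r \<otimes> a \<in> J}"

definition reg_mod :: "'a set \<Rightarrow> 'a \<Rightarrow> bool" where
  "reg_mod J x \<longleftrightarrow> x \<in> carrier R \<and> (\<forall>a\<in>carrier R. x \<otimes> a \<in> J \<longrightarrow> a \<in> J)"

lemma reg_modD: "reg_mod J x \<Longrightarrow> a \<in> carrier R \<Longrightarrow> x \<otimes> a \<in> J \<Longrightarrow> a \<in> J"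
  by (simp add: reg_mod_def)

lemma reg_mod_carrier: "reg_mod J x \<Longrightarrow> x \<in> carrier R"
  by (simp add: reg_mod_def)

lemma colon_ideal:
  assumes "ideal J R" "a \<in> carrier R"
  shows "ideal (colon J a) R"
  by (rule idealI_comm)
    (use assms in \<open>auto simp: colon_def l_distr m_assoc intro: ideal_mem\<close>)

lemma one_mem_colon_iff: "a \<in> carrier R \<Longrightarrow> \<one> \<in> colon J a \<longleftrightarrow> a \<in> J"
  by (simp add: colon_def)

text \<open>A product of elements of the ideals that avoid \<open>P\<close> works.\<close>

lemma prime_not_contains_Inter:
  assumes P: "primeideal P R" and "finite F"
    and "\<And>K. K \<in> F \<Longrightarrow> ideal K R" "\<And>K. K \<in> F \<Longrightarrow> \<not> K \<subseteq> P"
  shows "\<exists>c \<in> carrier R - P. \<forall>K\<in>F. c \<in> K"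
  using assms(2-)
proof (induction F)
  case empty
  have "\<one> \<notin> P"
    using P ideal.one_imp_carrier primeideal.I_notcarr primeideal.axioms(1) by metis
  then show ?case by auto
next
  case (insert K F)
  then obtain c where c: "c \<in> carrier R - P" "\<forall>K\<in>F. c \<in> K" by auto
  obtain k where k: "k \<in> K" "k \<notin> P" using insert.prems(2)[of K] by auto
  have kc: "k \<in> carrier R" using k insert.prems(1)[of K] ideal_memD by auto
  have "k \<otimes> c \<notin> P" using primeideal.I_prime[OF P kc] c k by auto
  moreover have "k \<otimes> c \<in> K'" if "K' \<in> insert K F" for K'
    using that insert.prems(1) k c kc ideal_lmult_mem[of K' c k] ideal_rmult_mem[of K' k c] by auto
  ultimately show ?case using kc c by auto
qed

text \<open>Induction on the number of primes: a minimal member \<open>P\<close> of \<open>F\<close> is treated last, because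
  it contains no other member.\<close>

lemma prime_avoidance_coset:
  assumes "finite F" "\<And>P. P \<in> F \<Longrightarrow> primeideal P R"
    and N: "ideal N R" and x: "x \<in> carrier R"
    and "\<And>P. P \<in> F \<Longrightarrow> \<not> (x \<in> P \<and> N \<subseteq> P)"
  shows "\<exists>b\<in>N. \<forall>P\<in>F. x \<oplus> b \<notin> P"
  using assms(1,2,5)
proof (induction "card F" arbitrary: F)
  case 0
  then show ?case using ideal_zero_mem[OF N] by auto
next
  case (Suc n)
  then have "F \<noteq> {}" by auto
  then obtain P where P: "P \<in> F" "\<And>P'. P' \<in> F \<Longrightarrow> \<not> P' \<subset> P"
    using finite_has_minimal[OF Suc.prems(1)] by (metis psubsetE psubset_imp_subset)
  let ?F = "F - {P}"
  have "n = card ?F" using Suc.hyps(2) P(1) Suc.prems(1) by simp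
  then obtain b where b: "b \<in> N" "\<forall>P'\<in>?F. x \<oplus> b \<notin> P'"
    using Suc.hyps(1)[of ?F] Suc.prems by auto
  show ?case
  proof (cases "x \<oplus> b \<in> P")
    case False
    then show ?thesis using b by blast
  next
    case True
    have prP: "primeideal P R" and idP: "ideal P R"
      using Suc.prems(2)[OF P(1)] by (auto simp: primeideal.axioms(1))
    have bc: "b \<in> carrier R" using b N ideal_memD by auto
    have NP: "\<not> N \<subseteq> P"
    proof
      assume "N \<subseteq> P"
      then have "x \<in> P" using ideal_add_cancel[OF idP x _ True] b by auto
      then show False using Suc.prems(3)[OF P(1)] \<open>N \<subseteq> P\<close> by auto
    qed
    have idF: "ideal K R" if "K \<in> insert N ?F" for K
      using that N Suc.prems(2) primeideal.axioms(1) by blast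
    have "\<not> K \<subseteq> P" if "K \<in> insert N ?F" for K
      using that NP P(2)[of K] by auto
    \<comment> \<open>Adding \<open>c\<close> keeps the correction inside \<open>N\<close>, does not
      affect membership in the other members of \<open>F\<close>, and moves
      \<open>x \<oplus> b\<close> out of \<open>P\<close>.\<close>
    then obtain c where c: "c \<in> carrier R - P" "\<forall>K\<in>insert N ?F. c \<in> K"
      using prime_not_contains_Inter[OF prP, of "insert N ?F"] idF Suc.prems(1) by blast
    have eq: "x \<oplus> (b \<oplus> c) = (x \<oplus> b) \<oplus> c" using x bc c by (simp add: a_assoc)
    have "x \<oplus> (b \<oplus> c) \<notin> P'" if P': "P' \<in> F" for P'
    proof (cases "P' = P")
      case True
      have "c \<in> P" if "(x \<oplus> b) \<oplus> c \<in> P"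
        using ideal_add_cancel[OF idP, of c "x \<oplus> b"] that c x bc \<open>x \<oplus> b \<in> P\<close> a_comm[of c "x \<oplus> b"] by auto
      then show ?thesis using c eq True by auto
    next
      case False
      then show ?thesis
        using ideal_add_cancel[OF idF[of P'], of "x \<oplus> b" c] c b(2) P' eq x bc by auto
    qed
    then show ?thesis using ideal_add_mem[OF N b(1), of c] c by blast
  qed
qed

end

section \<open>Zero divisors modulo an ideal of a Noetherian ring\<close>

locale noetherian_cring = cring R + noetherian_ring R for R (structure)
begin

text \<open>In a Noetherian ring a nonempty chain of ideals contains its own union, so Zorn's lemma
  applies to any nonempty family of ideals.\<close>

lemma exists_maximal_ideal_in_family:
  assumes "\<F> \<noteq> {}" "\<And>K. K \<in> \<F> \<Longrightarrow> ideal K R"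
  shows "\<exists>M\<in>\<F>. \<forall>K\<in>\<F>. M \<subseteq> K \<longrightarrow> K = M"
proof (rule subset_Zorn_nonempty[OF assms(1)])
  fix C assume C: "C \<noteq> {}" "subset.chain \<F> C"
  then have sub: "C \<subseteq> \<F>" unfolding subset.chain_def by simp
  have "subset.chain {I. ideal I R} C"
    using C(2) sub assms(2) by (simp add: subset_chain_def subset_iff)
  then show "\<Union>C \<in> \<F>"
    using ideal_chain_is_trivial[OF C(1)] sub by auto
qed

text \<open>The generators are found inside \<open>S\<close> itself: an ideal that is maximal among
  those generated by finite subsets of \<open>S\<close> must absorb every element of
  \<open>S\<close>.\<close>

lemma exists_finite_generating_subset:
  assumes "S \<subseteq> carrier R"
  shows "\<exists>S0\<subseteq>S. finite S0 \<and> S \<subseteq> Idl S0"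
proof -
  let ?F = "{Idl Y | Y. finite Y \<and> Y \<subseteq> S}"
  have "Idl {} \<in> ?F" by (rule CollectI) (intro exI[of _ "{}"], simp)
  moreover have "ideal K R" if "K \<in> ?F" for K
  proof -
    obtain Y where "K = Idl Y" "Y \<subseteq> S" using \<open>K \<in> ?F\<close> by auto
    then show ?thesis using genideal_ideal[of Y] assms by simp
  qed
  ultimately obtain M where M: "M \<in> ?F" "\<forall>K\<in>?F. M \<subseteq> K \<longrightarrow> K = M"
    using exists_maximal_ideal_in_family[of ?F] by (metis (no_types, lifting) empty_iff)
  then obtain Y where Y: "finite Y" "Y \<subseteq> S" "M = Idl Y" by auto
  have "x \<in> Idl Y" if "x \<in> S" for x
  proof -
    have "Idl (insert x Y) \<in> ?F"
      by (rule CollectI) (use Y that in \<open>auto intro!: exI[of _ "insert x Y"]\<close>)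
    moreover have "Idl Y \<subseteq> Idl (insert x Y)"
      using subset_Idl_subset[of "insert x Y" Y] Y that assms by auto
    ultimately have "Idl (insert x Y) = Idl Y" using M(2)[rule_format, of "Idl (insert x Y)"] Y(3) by simp
    moreover have "insert x Y \<subseteq> Idl (insert x Y)"
      by (rule genideal_self) (use that Y assms in auto)
    ultimately show ?thesis by simp
  qed
  then show ?thesis using Y by (intro exI[of _ Y]) auto
qed

text \<open>\<open>F\<close> consists of the maximal members of the family \<open>(J : a)\<close>
  with \<open>a\<close> outside \<open>J\<close>. Maximality makes them prime, and every zero
  divisor modulo \<open>J\<close> lies in some \<open>(J : a)\<close>, hence in one of them. This
  gives avoidable primes without primary decomposition.\<close>

lemma finite_primes_cover_zero_divisors:
  assumes J: "ideal J R"
  obtains F where "finite F"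
    "\<And>P. P \<in> F \<Longrightarrow> primeideal P R \<and> (\<exists>a\<in>carrier R - J. P = colon J a)"
    "\<And>r. r \<in> carrier R \<Longrightarrow> r \<notin> \<Union>F \<Longrightarrow> reg_mod J r"
proof -
  define A where "A = colon J ` (carrier R - J)"
  define F where "F = {P \<in> A. \<forall>K\<in>A. P \<subseteq> K \<longrightarrow> K = P}"
  have idA: "ideal K R" if "K \<in> A" for K
    using that colon_ideal[OF J] by (auto simp: A_def)
  have prime: "primeideal P R" if PF: "P \<in> F" for P
  proof -
    obtain a where a: "a \<in> carrier R" "a \<notin> J" "P = colon J a" using PF by (auto simp: F_def A_def)
    show ?thesis
    proof (rule primeidealI[OF _ is_cring])
      show idP: "ideal P R" using colon_ideal[OF J] a by simp
      show "carrier R \<noteq> P" using one_mem_colon_iff[OF a(1), of J] a by auto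
      fix x y assume xy: "x \<in> carrier R" "y \<in> carrier R" "x \<otimes> y \<in> P"
      show "x \<in> P \<or> y \<in> P"
      proof (cases "y \<in> P")
        case False
        then have "y \<otimes> a \<notin> J" using a xy by (auto simp: colon_def)
        then have "colon J (y \<otimes> a) \<in> A" using xy a by (auto simp: A_def)
        \<comment> \<open>By maximality \<open>P\<close> equals \<open>(J : y a)\<close>, and this
          ideal contains \<open>x\<close> because \<open>x y a\<close> lies in
          \<open>J\<close>.\<close>
        moreover have "P \<subseteq> colon J (y \<otimes> a)"
        proof
          fix r assume "r \<in> P"
          then have r: "r \<in> carrier R" "r \<otimes> a \<in> J" using a by (auto simp: colon_def)
          have "r \<otimes> (y \<otimes> a) = y \<otimes> (r \<otimes> a)" using r xy a by algebra
          then show "r \<in> colon J (y \<otimes> a)" using r ideal_lmult_mem[OF J r(2) xy(2)] by (simp add: colon_def)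
        qed
        ultimately have "colon J (y \<otimes> a) = P" using PF by (auto simp: F_def)
        moreover have "x \<otimes> (y \<otimes> a) \<in> J" using xy a by (auto simp: colon_def m_assoc)
        ultimately show ?thesis using xy a by (auto simp: colon_def)
      qed simp
    qed
  qed
  have "\<exists>a\<in>carrier R - J. P = colon J a" if "P \<in> F" for P using that by (auto simp: F_def A_def)
  then obtain f where f: "\<And>P. P \<in> F \<Longrightarrow> f P \<in> carrier R - J \<and> P = colon J (f P)" by metis
  obtain Y where Y: "Y \<subseteq> f ` F" "finite Y" "f ` F \<subseteq> Idl Y"
    using exists_finite_generating_subset[of "f ` F"] f by blast
  then obtain F0 where F0: "F0 \<subseteq> F" "finite F0" "Y = f ` F0"
    by (metis finite_subset_image)
  \<comment> \<open>Finiteness of \<open>F\<close>: finitely many of the elements \<open>f K\<close>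
    generate an ideal containing all of them. If \<open>P\<close> contained no member of
    \<open>F0\<close>, some \<open>c\<close> outside \<open>P\<close> would kill these generators
    modulo \<open>J\<close>, hence also \<open>f P\<close>, and so lie in \<open>P\<close>.\<close>
  have "F \<subseteq> F0"
  proof
    fix P assume PF: "P \<in> F"
    have "\<exists>K\<in>F0. K \<subseteq> P"
    proof (rule ccontr)
      assume no: "\<not> ?thesis"
      then obtain c where c: "c \<in> carrier R - P" "\<forall>K\<in>F0. c \<in> K"
        using prime_not_contains_Inter[OF prime[OF PF] F0(2)] F0(1) prime primeideal.axioms(1) by blast
      have "f K \<in> colon J c" if K: "K \<in> F0" for K
      proof -
        have "c \<in> colon J (f K)" using c K f F0 by blast
        then show ?thesis using f[of K] K F0 c by (auto simp: colon_def m_comm)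
      qed
      then have "Idl Y \<subseteq> colon J c"
        using genideal_minimal[OF colon_ideal[OF J, of c], of Y] F0(3) c by blast
      then have "f P \<in> colon J c" using Y(3) PF by blast
      then have "c \<in> colon J (f P)" using c f[OF PF] by (auto simp: colon_def m_comm)
      then show False using f[OF PF] c by auto
    qed
    then obtain K where K: "K \<in> F0" "K \<subseteq> P" by auto
    then have "K = P" using PF F0(1) by (auto simp: F_def)
    then show "P \<in> F0" using K by simp
  qed
  then have fin: "finite F" using F0 finite_subset by blast
  moreover have "reg_mod J r" if r: "r \<in> carrier R" "r \<notin> \<Union>F" for r
  proof (rule ccontr)
    assume "\<not> reg_mod J r"
    then obtain a where a: "a \<in> carrier R" "r \<otimes> a \<in> J" "a \<notin> J" using r by (auto simp: reg_mod_def)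
    let ?G = "{K \<in> A. colon J a \<subseteq> K}"
    have "?G \<noteq> {}" using a by (auto simp: A_def)
    then obtain M where M: "M \<in> ?G" "\<forall>K\<in>?G. M \<subseteq> K \<longrightarrow> K = M"
      using exists_maximal_ideal_in_family[of ?G] idA by auto
    then have "M \<in> F" by (auto simp: F_def)
    moreover have "r \<in> M" using M(1) r a by (auto simp: colon_def)
    ultimately show False using r by auto
  qed
  ultimately show ?thesis using that prime f by metis
qed

end

section \<open>Regular sequences in Noetherian rings\<close>

context cring
begin

text \<open>The ideal \<open>J\<close> grows along the list, so that the tail of a sequence is again
  a sequence, modulo a larger ideal. Properness of the final ideal is not built in; it comes from
  containment in \<open>m\<close>.\<close>

primrec regseq :: "'a set \<Rightarrow> 'a list \<Rightarrow> bool" where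
  "regseq J [] \<longleftrightarrow> True"
| "regseq J (x # xs) \<longleftrightarrow> reg_mod J x \<and> regseq (adjoin J x) xs"

lemma regseq_append: "regseq J (xs @ ys) \<longleftrightarrow> regseq J xs \<and> regseq (adjoins J xs) ys"
  by (induction xs arbitrary: J) auto

lemma regseq_carrier: "regseq J xs \<Longrightarrow> set xs \<subseteq> carrier R"
  by (induction xs arbitrary: J) (auto simp: reg_mod_def)

text \<open>For a maximal ideal \<open>m\<close> this says \<open>Hom(R/m, R/J) = 0\<close>.\<close>

definition depth_pos :: "'a set \<Rightarrow> 'a set \<Rightarrow> bool" where
  "depth_pos m J \<longleftrightarrow> (\<forall>a\<in>carrier R. (\<forall>q\<in>m. q \<otimes> a \<in> J) \<longrightarrow> a \<in> J)"

lemma depth_posI_reg_mod: "reg_mod J y \<Longrightarrow> y \<in> m \<Longrightarrow> depth_pos m J"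
  by (auto simp: depth_pos_def reg_mod_def)

text \<open>This half of permuting a regular sequence holds in every commutative ring:
  \<open>u a = j + r w\<close> puts \<open>r\<close> into \<open>J + (u)\<close>, say
  \<open>r = k + s u\<close>, and then \<open>u (a - s w)\<close> lies in \<open>J\<close>.\<close>

lemma reg_mod_adjoin_swap:
  assumes J: "ideal J R" and u: "reg_mod J u" and w: "reg_mod (adjoin J u) w"
  shows "reg_mod (adjoin J w) u"
  unfolding reg_mod_def
proof (intro conjI ballI impI)
  show uc: "u \<in> carrier R" using u reg_mod_carrier by blast
  have wc: "w \<in> carrier R" using w reg_mod_carrier by blast
  fix a assume a: "a \<in> carrier R" and ua: "u \<otimes> a \<in> adjoin J w"
  obtain j r where jr: "j \<in> J" "r \<in> carrier R" "u \<otimes> a = j \<oplus> r \<otimes> w" using ua by (rule adjoinE)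
  have jc: "j \<in> carrier R" using J jr ideal_memD by blast
  have "w \<otimes> r = u \<otimes> a \<oplus> \<ominus> j" unfolding jr(3) using jr(2) jc wc by algebra
  also have "\<dots> = \<ominus> j \<oplus> a \<otimes> u" using jc a uc by algebra
  finally have "w \<otimes> r \<in> adjoin J u" using adjoinI[OF ideal_neg_mem[OF J jr(1)] a, of u] by simp
  then have "r \<in> adjoin J u" using w jr(2) reg_modD by blast
  then obtain k s where ks: "k \<in> J" "s \<in> carrier R" "r = k \<oplus> s \<otimes> u" by (rule adjoinE)
  have kc: "k \<in> carrier R" using J ks ideal_memD by blast
  have "u \<otimes> (a \<ominus> s \<otimes> w) = u \<otimes> a \<ominus> s \<otimes> u \<otimes> w" using uc a ks(2) wc by algebra
  also have "\<dots> = j \<oplus> (k \<oplus> s \<otimes> u) \<otimes> w \<ominus> s \<otimes> u \<otimes> w" by (simp only: jr(3) flip: ks(3))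
  also have "\<dots> = j \<oplus> w \<otimes> k" using jc kc wc uc ks(2) by algebra
  also have "\<dots> \<in> J" by (intro ideal_add_mem ideal_lmult_mem J jr ks wc)
  finally have "a \<ominus> s \<otimes> w \<in> J" using u a ks(2) wc by (meson m_closed minus_closed reg_modD)
  moreover have "a = (a \<ominus> s \<otimes> w) \<oplus> s \<otimes> w" using a ks(2) wc by algebra
  ultimately show "a \<in> adjoin J w" using adjoinI[OF _ ks(2), of "a \<ominus> s \<otimes> w" J w] by simp
qed

text \<open>\<open>w\<close> moves to the front past one member of \<open>us\<close> at a time, by
  \<open>reg_mod_adjoin_swap\<close>; for this it must be regular modulo each initial ideal.\<close>

lemma regseq_adjoin:
  assumes "ideal J R" "regseq J us"
    and "\<And>i. i \<le> length us \<Longrightarrow> reg_mod (adjoins J (take i us)) w"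
  shows "regseq (adjoin J w) us"
  using assms
proof (induction us arbitrary: J)
  case (Cons u us)
  have uc: "u \<in> carrier R" and wc: "w \<in> carrier R"
    using Cons.prems(2) reg_mod_carrier[OF Cons.prems(3)[of 0]] reg_mod_carrier[of J u] by simp_all
  have "reg_mod (adjoin J u) w" using Cons.prems(3)[of 1] by simp
  then have "reg_mod (adjoin J w) u" using reg_mod_adjoin_swap Cons.prems by auto
  moreover have "regseq (adjoin (adjoin J u) w) us"
  proof (rule Cons.IH)
    show "ideal (adjoin J u) R" using adjoin_ideal Cons.prems(1) uc by blast
    show "regseq (adjoin J u) us" using Cons.prems(2) by simp
    show "reg_mod (adjoins (adjoin J u) (take i us)) w" if "i \<le> length us" for i
      using Cons.prems(3)[of "Suc i"] that by simp
  qed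
  moreover have "adjoin (adjoin J u) w = adjoin (adjoin J w) u"
    using adjoins_adjoin_swap[OF Cons.prems(1), of "[u]" w] uc wc by simp
  ultimately show ?case by simp
qed simp

text \<open>Northcott and Rees: if \<open>m a \<subseteq> J + (u)\<close> and \<open>w a \<equiv> r u\<close> modulo \<open>J\<close>, then
  \<open>m r \<subseteq> J + (w)\<close>.\<close>

lemma depth_pos_adjoin_exchange:
  assumes J: "ideal J R" and m: "ideal m R"
    and u: "reg_mod J u" and w: "reg_mod J w" and wm: "w \<in> m"
    and dp: "depth_pos m (adjoin J w)"
  shows "depth_pos m (adjoin J u)"
  unfolding depth_pos_def
proof (intro ballI impI)
  have uc: "u \<in> carrier R" and wc: "w \<in> carrier R" using u w reg_mod_carrier by auto
  fix a assume a: "a \<in> carrier R" and ma: "\<forall>q\<in>m. q \<otimes> a \<in> adjoin J u"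
  obtain j r where jr: "j \<in> J" "r \<in> carrier R" "w \<otimes> a = j \<oplus> r \<otimes> u"
    using ma wm adjoinE by metis
  have jc: "j \<in> carrier R" using J jr ideal_memD by blast
  have "q \<otimes> r \<in> adjoin J w" if q: "q \<in> m" for q
  proof -
    have qc: "q \<in> carrier R" using q m ideal_memD by blast
    obtain k c where kc: "k \<in> J" "c \<in> carrier R" "q \<otimes> a = k \<oplus> c \<otimes> u"
      using ma q adjoinE by metis
    have kk: "k \<in> carrier R" using J kc ideal_memD by blast
    have 1: "w \<otimes> (q \<otimes> a) = q \<otimes> (w \<otimes> a)" using a wc qc by algebra
    have "u \<otimes> (q \<otimes> r \<ominus> c \<otimes> w) = q \<otimes> (j \<oplus> r \<otimes> u) \<ominus> w \<otimes> (k \<oplus> c \<otimes> u) \<oplus> (w \<otimes> k \<ominus> q \<otimes> j)"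
      using uc wc qc jr(2) jc kc(2) kk by algebra
    also have "\<dots> = w \<otimes> k \<ominus> q \<otimes> j"
      using 1 jr(2,3) kc(2,3) a wc qc jc kk uc by (simp add: r_neg minus_eq)
    also have "\<dots> \<in> J" by (intro ideal_diff_mem ideal_lmult_mem J jr kc wc qc)
    finally have "q \<otimes> r \<ominus> c \<otimes> w \<in> J"
      using u qc jr(2) kc(2) wc by (meson m_closed minus_closed reg_modD)
    moreover have "q \<otimes> r = (q \<otimes> r \<ominus> c \<otimes> w) \<oplus> c \<otimes> w" using qc jr(2) kc(2) wc by algebra
    ultimately show ?thesis using adjoinI[OF _ kc(2), of "q \<otimes> r \<ominus> c \<otimes> w" J w] by simp
  qed
  then have "r \<in> adjoin J w" using dp jr(2) by (auto simp: depth_pos_def)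
  then obtain k s where ks: "k \<in> J" "s \<in> carrier R" "r = k \<oplus> s \<otimes> w" by (rule adjoinE)
  have kc: "k \<in> carrier R" using J ks ideal_memD by blast
  have "w \<otimes> (a \<ominus> s \<otimes> u) = w \<otimes> a \<ominus> s \<otimes> w \<otimes> u" using uc a ks(2) wc by algebra
  also have "\<dots> = j \<oplus> (k \<oplus> s \<otimes> w) \<otimes> u \<ominus> s \<otimes> w \<otimes> u" by (simp only: jr(3) flip: ks(3))
  also have "\<dots> = j \<oplus> u \<otimes> k" using jc kc wc uc ks(2) by algebra
  also have "\<dots> \<in> J" by (intro ideal_add_mem ideal_lmult_mem J jr ks uc)
  finally have "a \<ominus> s \<otimes> u \<in> J" using w a ks(2) uc by (meson m_closed minus_closed reg_modD)
  moreover have "a = (a \<ominus> s \<otimes> u) \<oplus> s \<otimes> u" using a ks(2) uc by algebra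
  ultimately show "a \<in> adjoin J u" using adjoinI[OF _ ks(2), of "a \<ominus> s \<otimes> u" J u] by simp
qed

text \<open>The next entry \<open>ys ! i\<close> is a nonzerodivisor in \<open>m\<close> modulo the
  preceding ones, so \<open>m\<close> kills no nonzero class there.\<close>

lemma regseq_depth_pos_take:
  assumes "regseq J ys" "set ys \<subseteq> m" "i < length ys"
  shows "depth_pos m (adjoins J (take i ys))"
proof -
  have "ys = take i ys @ ys ! i # drop (Suc i) ys" using assms(3) by (simp add: id_take_nth_drop)
  then have "reg_mod (adjoins J (take i ys)) (ys ! i)"
    using assms(1) regseq_append[of J "take i ys"] by (metis regseq.simps(2))
  then show ?thesis using depth_posI_reg_mod assms by (meson nth_mem subsetD)
qed

end

context noetherian_cring
begin

text \<open>Prime avoidance with base point zero, for the covering primes of all members of the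
  family at once. If \<open>m\<close> were inside a covering prime \<open>(J : a)\<close>, the
  nonzero class of \<open>a\<close> would be killed by \<open>m\<close>.\<close>

lemma exists_reg_mod:
  assumes "finite \<J>" "ideal m R"
    and "\<And>J. J \<in> \<J> \<Longrightarrow> ideal J R \<and> depth_pos m J"
  shows "\<exists>w\<in>m. \<forall>J\<in>\<J>. reg_mod J w"
proof -
  have "\<forall>J. \<exists>F. J \<in> \<J> \<longrightarrow> finite F \<and>
    (\<forall>P\<in>F. primeideal P R \<and> (\<exists>a\<in>carrier R - J. P = colon J a)) \<and>
    (\<forall>r\<in>carrier R. r \<notin> \<Union>F \<longrightarrow> reg_mod J r)" (is "\<forall>J. \<exists>F. ?P J F")
  proof
    fix J
    show "\<exists>F. ?P J F"
    proof (cases "J \<in> \<J>")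
      case True
      then obtain F where "finite F"
        "\<And>P. P \<in> F \<Longrightarrow> primeideal P R \<and> (\<exists>a\<in>carrier R - J. P = colon J a)"
        "\<And>r. r \<in> carrier R \<Longrightarrow> r \<notin> \<Union>F \<Longrightarrow> reg_mod J r"
        using finite_primes_cover_zero_divisors[of J] assms(3) by metis
      then show ?thesis by (intro exI[of _ F]) simp
    qed simp
  qed
  then obtain F where F: "\<And>J. ?P J (F J)" by metis
  let ?G = "\<Union>J\<in>\<J>. F J"
  have "\<exists>b\<in>m. \<forall>P\<in>?G. \<zero> \<oplus> b \<notin> P"
  proof (rule prime_avoidance_coset)
    show "finite ?G" using assms(1) F by blast
    show "primeideal P R" if "P \<in> ?G" for P using that F by blast
    show "\<not> (\<zero> \<in> P \<and> m \<subseteq> P)" if "P \<in> ?G" for P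
    proof -
      obtain J where J: "J \<in> \<J>" "P \<in> F J" using \<open>P \<in> ?G\<close> by blast
      then obtain a where a: "a \<in> carrier R - J" "P = colon J a" using F by blast
      have "depth_pos m J" using assms(3) J by simp
      then show ?thesis using a by (auto simp: depth_pos_def colon_def)
    qed
  qed (use assms in auto)
  then obtain b where b: "b \<in> m" "\<forall>P\<in>?G. \<zero> \<oplus> b \<notin> P" by blast
  have bc: "b \<in> carrier R" using b assms(2) ideal_memD by blast
  have "reg_mod J b" if "J \<in> \<J>" for J
  proof -
    have "b \<notin> \<Union>(F J)" using b(2) that bc by auto
    then show ?thesis using F that bc by blast
  qed
  then show ?thesis using b by blast
qed

text \<open>The substance of the theorem that maximal regular sequences in \<open>m\<close> have
  equal length. An element \<open>w\<close> that is regular modulo the initial ideals of both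
  sequences keeps them regular modulo \<open>w\<close>, each with at least one entry dropped;
  induction applies modulo \<open>J + (w)\<close>, and finally \<open>w\<close> is exchanged for the
  last entry of \<open>us\<close>.\<close>

lemma depth_pos_adjoins:
  assumes "ideal J R" and m: "ideal m R"
    and "regseq J us" "set us \<subseteq> m" "regseq J ys" "set ys \<subseteq> m" "length us < length ys"
  shows "depth_pos m (adjoins J us)"
  using assms
proof (induction "length us" arbitrary: J us ys)
  case 0
  then have "us = []" by simp
  then show ?case using regseq_depth_pos_take[of J ys m 0] 0 by simp
next
  case (Suc n)
  note J = Suc.prems(1)
  obtain vs u where us: "us = vs @ [u]" using Suc.hyps(2) by (metis length_Suc_conv_rev)
  have n: "length vs = n" using us Suc.hyps(2) by simp
  have mc: "m \<subseteq> carrier R" using m ideal_subset_carrier by blast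
  let ?zs = "take (Suc n) ys"
  \<comment> \<open>Both ranges stop before the full list, so each initial segment still has a next
    entry, which provides \<open>depth_pos\<close>. For \<open>ys\<close> the bound
    \<open>Suc n\<close> is allowed because \<open>ys\<close> has at least \<open>n + 2\<close>
    entries.\<close>
  let ?\<J> = "(\<lambda>i. adjoins J (take i us)) ` {..n} \<union> (\<lambda>i. adjoins J (take i ys)) ` {..Suc n}"
  have "\<exists>w\<in>m. \<forall>K\<in>?\<J>. reg_mod K w"
  proof (rule exists_reg_mod[OF _ m])
    fix K assume "K \<in> ?\<J>"
    then consider i where "i \<le> n" "K = adjoins J (take i us)"
      | i where "i \<le> Suc n" "K = adjoins J (take i ys)" by auto
    then show "ideal K R \<and> depth_pos m K"
    proof cases
      case 1
      then show ?thesis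
        using regseq_depth_pos_take[OF Suc.prems(3,4), of i] Suc.hyps(2)
          adjoins_ideal[OF J, of "take i us"] Suc.prems(4) mc set_take_subset[of i us] by auto
    next
      case 2
      then show ?thesis
        using regseq_depth_pos_take[OF Suc.prems(5,6), of i] Suc.hyps(2) Suc.prems(7)
          adjoins_ideal[OF J, of "take i ys"] Suc.prems(6) mc set_take_subset[of i ys] by auto
    qed
  qed simp
  then obtain w where w: "w \<in> m" "\<forall>K\<in>?\<J>. reg_mod K w" by blast
  have wus: "reg_mod (adjoins J (take i us)) w" if "i \<le> n" for i using w(2) that by simp
  have wys: "reg_mod (adjoins J (take i ys)) w" if "i \<le> Suc n" for i using w(2) that by simp
  have wc: "w \<in> carrier R" using w mc by blast
  have vsc: "set vs \<subseteq> carrier R" and uc: "u \<in> carrier R" using us Suc.prems(4) mc by auto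
  have Jv: "ideal (adjoins J vs) R" using adjoins_ideal[OF J vsc] .
  have "regseq J vs" "reg_mod (adjoins J vs) u"
    using Suc.prems(3) us by (auto simp: regseq_append)
  have 1: "regseq (adjoin J w) vs"
  proof (rule regseq_adjoin[OF J \<open>regseq J vs\<close>])
    fix i assume "i \<le> length vs"
    then show "reg_mod (adjoins J (take i vs)) w" using wus[of i] us n by simp
  qed
  have "regseq J ?zs" using Suc.prems(5) regseq_append[of J ?zs "drop (Suc n) ys"] by simp
  then have 2: "regseq (adjoin J w) ?zs"
  proof (rule regseq_adjoin[OF J])
    fix i assume "i \<le> length ?zs"
    then show "reg_mod (adjoins J (take i ?zs)) w" using wys[of i] by (simp add: min_absorb1)
  qed
  have "depth_pos m (adjoins (adjoin J w) vs)"
  proof (rule Suc.hyps(1)[OF _ adjoin_ideal[OF J wc] m 1 _ 2])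
    show "n = length vs" using n by simp
    show "set vs \<subseteq> m" using us Suc.prems(4) by simp
    show "set ?zs \<subseteq> m" using Suc.prems(6) set_take_subset[of "Suc n" ys] by blast
    show "length vs < length ?zs" using n Suc.prems(7) Suc.hyps(2) by simp
  qed
  then have "depth_pos m (adjoin (adjoins J vs) w)"
    using adjoins_adjoin_swap[OF J vsc wc] by simp
  moreover have "reg_mod (adjoins J vs) w" using wus[of n] us n by simp
  ultimately have "depth_pos m (adjoin (adjoins J vs) u)"
    using depth_pos_adjoin_exchange[OF Jv m \<open>reg_mod (adjoins J vs) u\<close> _ w(1)] by blast
  then show ?case using us by (simp add: adjoins_append)
qed

text \<open>The first entry \<open>x\<close> is changed by some \<open>b\<close> from the ideal of
  the later entries, which leaves the total ideal alone, so as to avoid the primes covering the zero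
  divisors modulo \<open>J\<close>. A covering prime containing \<open>x\<close> and all later
  entries would contain \<open>m\<close>, against \<open>depth_pos\<close>.\<close>

lemma exists_regseq_same_ideal:
  assumes "ideal J R" and m: "ideal m R" and "set xs \<subseteq> m"
    and "\<And>us. set us \<subseteq> m \<Longrightarrow> regseq J us \<Longrightarrow> length us < length xs \<Longrightarrow> depth_pos m (adjoins J us)"
    and "\<And>P. primeideal P R \<Longrightarrow> adjoins J xs \<subseteq> P \<Longrightarrow> m \<subseteq> P"
  shows "\<exists>us. regseq J us \<and> set us \<subseteq> m \<and> length us = length xs \<and> adjoins J us = adjoins J xs \<and>
    (xs \<noteq> [] \<longrightarrow> last us = last xs)"
  using assms(1,3-)
proof (induction xs arbitrary: J)
  case Nil
  then show ?case by auto
next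
  case (Cons x xs)
  note J = Cons.prems(1)
  have mc: "m \<subseteq> carrier R" using m ideal_subset_carrier by blast
  have xc: "x \<in> carrier R" and xsc: "set xs \<subseteq> carrier R" using Cons.prems(2) mc by auto
  \<comment> \<open>Built from zero and not from \<open>J\<close>: for the last entry
    \<open>N\<close> is zero, so that entry is not changed.\<close>
  define N where "N = adjoins {\<zero>} xs"
  have N: "ideal N R" unfolding N_def by (rule adjoins_ideal[OF zeroideal xsc])
  have Nm: "N \<subseteq> m" unfolding N_def
    using adjoins_subset_iff[OF zeroideal xsc m] Cons.prems(2) ideal_zero_mem[OF m] by auto
  obtain F where F: "finite F"
    "\<And>P. P \<in> F \<Longrightarrow> primeideal P R \<and> (\<exists>a\<in>carrier R - J. P = colon J a)"
    "\<And>r. r \<in> carrier R \<Longrightarrow> r \<notin> \<Union>F \<Longrightarrow> reg_mod J r"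
    using finite_primes_cover_zero_divisors[OF J] by metis
  have "\<exists>b\<in>N. \<forall>P\<in>F. x \<oplus> b \<notin> P"
  proof (rule prime_avoidance_coset[OF F(1) _ N xc])
    fix P assume P: "P \<in> F"
    then show "primeideal P R" using F by blast
    then have idP: "ideal P R" by (simp add: primeideal.axioms(1))
    obtain a where a: "a \<in> carrier R" "a \<notin> J" "P = colon J a" using F P by blast
    show "\<not> (x \<in> P \<and> N \<subseteq> P)"
    proof
      assume xN: "x \<in> P \<and> N \<subseteq> P"
      have "J \<subseteq> P"
        using a J ideal_rmult_mem[OF J _ a(1)] ideal_memD by (auto simp: colon_def)
      moreover have "set xs \<subseteq> P" using xN set_subset_adjoins[OF zeroideal xsc] N_def by auto
      ultimately have "adjoins J (x # xs) \<subseteq> P"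
        using adjoins_subset_iff[OF J, of "x # xs", OF _ idP] xN xc xsc by simp
      then have "m \<subseteq> P" using Cons.prems(4) \<open>primeideal P R\<close> by blast
      moreover have "depth_pos m J" using Cons.prems(3)[of "[]"] by simp
      ultimately show False using a by (auto simp: depth_pos_def colon_def)
    qed
  qed
  then obtain b where b: "b \<in> N" "\<forall>P\<in>F. x \<oplus> b \<notin> P" by blast
  define u where "u = x \<oplus> b"
  have bc: "b \<in> carrier R" using b N ideal_memD by blast
  have um: "u \<in> m" unfolding u_def using b Nm Cons.prems(2) ideal_add_mem[OF m] by auto
  have uc: "u \<in> carrier R" using um mc by blast
  have u: "reg_mod J u" using F(3)[of u] uc b(2) u_def by blast
  have eq: "adjoins (adjoin J u) xs = adjoins (adjoin J x) xs"
  proof -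
    have Nsub: "N \<subseteq> adjoins J (z # xs)" if "z \<in> carrier R" for z
    proof -
      have zc: "set (z # xs) \<subseteq> carrier R" using that xsc by simp
      show ?thesis unfolding N_def
        using adjoins_subset_iff[OF zeroideal xsc adjoins_ideal[OF J zc]]
          set_subset_adjoins[OF J zc] ideal_zero_mem[OF adjoins_ideal[OF J zc]] by simp
    qed
    have "adjoins J (u # xs) = adjoins J (x # xs)"
    proof (rule adjoins_eqI[OF J _ J])
      have c: "set (u # xs) \<subseteq> carrier R" "set (x # xs) \<subseteq> carrier R" using uc xc xsc by auto
      have "u \<in> adjoins J (x # xs)" unfolding u_def
        by (rule ideal_add_mem[OF adjoins_ideal[OF J c(2)]])
          (use set_subset_adjoins[OF J c(2)] Nsub[OF xc] b in auto)
      then show "J \<union> set (u # xs) \<subseteq> adjoins J (x # xs)"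
        using subset_adjoins[OF J c(2)] set_subset_adjoins[OF J c(2)] by simp
      have "x = u \<ominus> b" unfolding u_def using xc bc by algebra
      then have "x \<in> adjoins J (u # xs)"
        using ideal_diff_mem[OF adjoins_ideal[OF J c(1)], of u b]
          set_subset_adjoins[OF J c(1)] Nsub[OF uc] b by auto
      then show "J \<union> set (x # xs) \<subseteq> adjoins J (u # xs)"
        using subset_adjoins[OF J c(1)] set_subset_adjoins[OF J c(1)] by simp
    qed (use uc xc xsc in auto)
    then show ?thesis by simp
  qed
  have "\<exists>us. regseq (adjoin J u) us \<and> set us \<subseteq> m \<and> length us = length xs \<and>
      adjoins (adjoin J u) us = adjoins (adjoin J u) xs \<and> (xs \<noteq> [] \<longrightarrow> last us = last xs)"
  proof (rule Cons.IH[OF adjoin_ideal[OF J uc]])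
    show "set xs \<subseteq> m" using Cons.prems(2) by simp
    show "depth_pos m (adjoins (adjoin J u) us)"
      if "set us \<subseteq> m" "regseq (adjoin J u) us" "length us < length xs" for us
      using Cons.prems(3)[of "u # us"] that um u by simp
    show "m \<subseteq> P" if "primeideal P R" "adjoins (adjoin J u) xs \<subseteq> P" for P
      using Cons.prems(4)[of P] that eq by simp
  qed
  then obtain us where us: "regseq (adjoin J u) us" "set us \<subseteq> m" "length us = length xs"
    "adjoins (adjoin J u) us = adjoins (adjoin J u) xs" "xs \<noteq> [] \<longrightarrow> last us = last xs" by blast
  have "last (u # us) = last (x # xs)"
  proof (cases "xs = []")
    case True
    then have "b = \<zero>" using b N_def by simp
    then show ?thesis using True us(3) u_def xc by simp
  next
    case False
    then have "us \<noteq> []" using us(3) by auto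
    then show ?thesis using False us(5) by simp
  qed
  then show ?case
    using us u um eq by (intro exI[of _ "u # us"]) simp
qed

end

section \<open>Local rings\<close>

locale noetherian_local = noetherian_cring +
  fixes m
  assumes maximal: "maximalideal m R"
    and unique_maximal: "\<And>n. maximalideal n R \<Longrightarrow> n = m"
begin

lemma m_ideal: "ideal m R"
  using maximal maximalideal.axioms(1) by blast

lemma m_subset: "m \<subseteq> carrier R"
  using m_ideal ideal_subset_carrier by blast

lemma one_not_mem_m: "\<one> \<notin> m"
  using maximal ideal.one_imp_carrier[OF m_ideal] maximalideal.I_notcarr by metis

text \<open>An ideal that is maximal among the proper ideals above \<open>K\<close> is a maximal
  ideal, hence \<open>m\<close>.\<close>

lemma proper_ideal_subset:
  assumes K: "ideal K R" and ne: "K \<noteq> carrier R"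
  shows "K \<subseteq> m"
proof -
  let ?F = "{L. ideal L R \<and> K \<subseteq> L \<and> L \<noteq> carrier R}"
  have "K \<in> ?F" using assms by simp
  then have "\<exists>M\<in>?F. \<forall>L\<in>?F. M \<subseteq> L \<longrightarrow> L = M"
    by (intro exists_maximal_ideal_in_family) auto
  then obtain M where M: "M \<in> ?F" "\<forall>L\<in>?F. M \<subseteq> L \<longrightarrow> L = M" by (rule bexE)
  have "maximalideal M R"
  proof (rule maximalidealI)
    show "ideal M R" "carrier R \<noteq> M" using M(1) by auto
    fix L assume "ideal L R" "M \<subseteq> L" "L \<subseteq> carrier R"
    moreover from this have "K \<subseteq> L" using M(1) by auto
    ultimately show "L = M \<or> L = carrier R" using M(2) by blast
  qed
  then show ?thesis using unique_maximal M(1) by blast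
qed

lemma unit_outside_m:
  assumes a: "a \<in> carrier R" and "a \<notin> m"
  shows "\<exists>b\<in>carrier R. b \<otimes> a = \<one>"
proof -
  have id: "ideal (adjoin {\<zero>} a) R" using adjoin_ideal[OF zeroideal a] .
  have "adjoin {\<zero>} a = carrier R"
    using proper_ideal_subset[OF id] mem_adjoin[OF zeroideal a] assms by blast
  then have "\<one> \<in> adjoin {\<zero>} a" by simp
  then obtain j r where "j \<in> {\<zero>}" "r \<in> carrier R" "\<one> = j \<oplus> r \<otimes> a" by (rule adjoinE)
  then have "r \<otimes> a = \<one>" using a by simp
  then show ?thesis using \<open>r \<in> carrier R\<close> by blast
qed

section \<open>Nakayama's lemma by elimination of generators\<close>

definition m_adjoin :: "'a set \<Rightarrow> 'a \<Rightarrow> 'a set" where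
  "m_adjoin N x = {n \<oplus> c \<otimes> x | n c. n \<in> N \<and> c \<in> m}"

text \<open>The ideal \<open>N + m x_1 + ... + m x_n\<close>, the form of \<open>N + m M\<close> for
  \<open>M\<close> generated by the list.\<close>

primrec m_adjoins :: "'a set \<Rightarrow> 'a list \<Rightarrow> 'a set" where
  "m_adjoins N [] = N"
| "m_adjoins N (x # xs) = m_adjoins (m_adjoin N x) xs"

lemma m_adjoin_ideal:
  assumes N: "ideal N R" and x: "x \<in> carrier R"
  shows "ideal (m_adjoin N x) R"
proof (rule idealI_comm)
  show "m_adjoin N x \<subseteq> carrier R"
    using N x m_subset by (auto simp: m_adjoin_def ideal_memD)
  have "\<zero> = \<zero> \<oplus> \<zero> \<otimes> x" using x by simp
  then show "\<zero> \<in> m_adjoin N x"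
    using ideal_zero_mem[OF N] ideal_zero_mem[OF m_ideal] by (auto simp: m_adjoin_def)
next
  fix a b assume "a \<in> m_adjoin N x" "b \<in> m_adjoin N x"
  then obtain j r k s where *: "j \<in> N" "r \<in> m" "a = j \<oplus> r \<otimes> x"
    "k \<in> N" "s \<in> m" "b = k \<oplus> s \<otimes> x" by (auto simp: m_adjoin_def)
  then have "j \<in> carrier R" "k \<in> carrier R" "r \<in> carrier R" "s \<in> carrier R"
    using N ideal_memD m_subset by auto
  with * x have "a \<oplus> b = (j \<oplus> k) \<oplus> (r \<oplus> s) \<otimes> x" by algebra
  then show "a \<oplus> b \<in> m_adjoin N x"
    using ideal_add_mem[OF N] ideal_add_mem[OF m_ideal] * unfolding m_adjoin_def by blast
next
  fix c a assume c: "c \<in> carrier R" and "a \<in> m_adjoin N x"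
  then obtain j r where *: "j \<in> N" "r \<in> m" "a = j \<oplus> r \<otimes> x" by (auto simp: m_adjoin_def)
  then have "j \<in> carrier R" "r \<in> carrier R" using N ideal_memD m_subset by auto
  with * x c have "c \<otimes> a = c \<otimes> j \<oplus> (c \<otimes> r) \<otimes> x" by algebra
  then show "c \<otimes> a \<in> m_adjoin N x"
    using ideal_lmult_mem[OF N] ideal_lmult_mem[OF m_ideal] * c unfolding m_adjoin_def by blast
qed

lemma subset_m_adjoin:
  assumes "ideal N R" "x \<in> carrier R"
  shows "N \<subseteq> m_adjoin N x"
proof
  fix n assume "n \<in> N"
  moreover from this have "n = n \<oplus> \<zero> \<otimes> x" using assms ideal_memD by simp
  ultimately show "n \<in> m_adjoin N x"
    using ideal_zero_mem[OF m_ideal] unfolding m_adjoin_def by blast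
qed

lemma mult_mem_m_adjoin:
  assumes "ideal N R" "x \<in> carrier R" "c \<in> m"
  shows "c \<otimes> x \<in> m_adjoin N x"
proof -
  have "c \<otimes> x = \<zero> \<oplus> c \<otimes> x" using assms m_subset by auto
  then show ?thesis using ideal_zero_mem[OF assms(1)] assms(3) unfolding m_adjoin_def by blast
qed

lemma m_adjoins_ideal:
  "ideal N R \<Longrightarrow> set xs \<subseteq> carrier R \<Longrightarrow> ideal (m_adjoins N xs) R"
  by (induction xs arbitrary: N) (auto intro: m_adjoin_ideal)

lemma subset_m_adjoins: "ideal N R \<Longrightarrow> set xs \<subseteq> carrier R \<Longrightarrow> N \<subseteq> m_adjoins N xs"
proof (induction xs arbitrary: N)
  case (Cons x xs)
  then show ?case using Cons.IH[OF m_adjoin_ideal] subset_m_adjoin by fastforce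
qed simp

lemma mult_mem_m_adjoins:
  "ideal N R \<Longrightarrow> set xs \<subseteq> carrier R \<Longrightarrow> c \<in> m \<Longrightarrow> x \<in> set xs \<Longrightarrow> c \<otimes> x \<in> m_adjoins N xs"
proof (induction xs arbitrary: N)
  case (Cons y xs)
  have id: "ideal (m_adjoin N y) R" using Cons.prems m_adjoin_ideal by auto
  show ?case
  proof (cases "x = y")
    case True
    then show ?thesis
      using mult_mem_m_adjoin[of N y c] subset_m_adjoins[OF id, of xs] Cons.prems by auto
  next
    case False
    then show ?thesis using Cons.IH[OF id] Cons.prems by simp
  qed
qed simp

lemma m_adjoins_mem_set:
  "ideal N R \<Longrightarrow> set xs \<subseteq> N \<Longrightarrow> m_adjoins N xs = N"
proof (induction xs)
  case (Cons x xs)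
  have xc: "x \<in> carrier R" using Cons.prems ideal_memD by auto
  have "m_adjoin N x \<subseteq> N"
    using Cons.prems m_subset by (auto simp: m_adjoin_def intro!: ideal_add_mem ideal_lmult_mem)
  then have "m_adjoin N x = N" using subset_m_adjoin[OF Cons.prems(1) xc] by blast
  then show ?case using Cons by simp
qed simp

text \<open>Generators are eliminated one by one instead of by a determinant. Induction with
  \<open>N + m x\<close> in place of \<open>N\<close> puts the tail into \<open>N + m x\<close>;
  then \<open>x = n + c x\<close> with \<open>c\<close> in \<open>m\<close>, and
  \<open>\<one> \<ominus> c\<close> is a unit.\<close>

lemma nakayama_list:
  "ideal N R \<Longrightarrow> set xs \<subseteq> carrier R \<Longrightarrow> set xs \<subseteq> m_adjoins N xs \<Longrightarrow> set xs \<subseteq> N"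
proof (induction xs arbitrary: N)
  case (Cons x xs)
  have xc: "x \<in> carrier R" using Cons.prems by simp
  have id: "ideal (m_adjoin N x) R" using Cons.prems m_adjoin_ideal by auto
  have xs: "set xs \<subseteq> m_adjoin N x" using Cons.IH[OF id] Cons.prems by simp
  then have "x \<in> m_adjoin N x" using m_adjoins_mem_set[OF id xs] Cons.prems by simp
  then obtain n c where nc: "n \<in> N" "c \<in> m" "x = n \<oplus> c \<otimes> x" unfolding m_adjoin_def by blast
  have cc: "c \<in> carrier R" and nn: "n \<in> carrier R"
    using nc m_subset ideal_memD Cons.prems(1) by auto
  have "(\<one> \<ominus> c) \<otimes> x = x \<ominus> c \<otimes> x" using cc xc by algebra
  also have "\<dots> = n \<oplus> c \<otimes> x \<ominus> c \<otimes> x" using nc(3) by simp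
  also have "\<dots> = n" using nn cc xc by algebra
  finally have 1: "(\<one> \<ominus> c) \<otimes> x \<in> N" using nc by simp
  have "\<one> \<ominus> c \<notin> m"
  proof
    assume "\<one> \<ominus> c \<in> m"
    then have "(\<one> \<ominus> c) \<oplus> c \<in> m" using nc ideal_add_mem[OF m_ideal] by blast
    moreover have "(\<one> \<ominus> c) \<oplus> c = \<one>" using cc by algebra
    ultimately show False using one_not_mem_m by simp
  qed
  then obtain b where b: "b \<in> carrier R" "b \<otimes> (\<one> \<ominus> c) = \<one>" using unit_outside_m cc by blast
  have "x = b \<otimes> ((\<one> \<ominus> c) \<otimes> x)" using b cc xc by (metis l_one m_assoc minus_closed one_closed)
  then have xN: "x \<in> N" using ideal_lmult_mem[OF Cons.prems(1) 1 b(1)] by simp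
  then have "m_adjoin N x \<subseteq> N"
    using m_adjoins_mem_set[OF Cons.prems(1), of "[x]"] by simp
  then show ?case using xN xs by auto
qed simp

lemma nakayama:
  assumes M: "ideal M R" and N: "ideal N R" and sub: "M \<subseteq> N <+> (m \<cdot> M)"
  shows "M \<subseteq> N"
proof -
  obtain A where A: "A \<subseteq> carrier R" "finite A" "M = Idl A" using finetely_gen[OF M] by blast
  obtain xs where xs: "set xs = A" using A(2) finite_list by blast
  have xsc: "set xs \<subseteq> carrier R" using xs A by simp
  have AM: "A \<subseteq> M" using A genideal_self by blast
  have id: "ideal (m_adjoins N xs) R" using m_adjoins_ideal[OF N xsc] .
  have prod: "c \<otimes> a \<in> m_adjoins N xs" if c: "c \<in> m" and a: "a \<in> M" for c a
  proof -
    have cc: "c \<in> carrier R" using c m_subset by blast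
    \<comment> \<open>A colon ideal that contains the generators contains \<open>M\<close>: this
      extends the bound on \<open>c x\<close> from generators to all elements.\<close>
    have "A \<subseteq> colon (m_adjoins N xs) c"
    proof
      fix x assume x: "x \<in> A"
      then show "x \<in> colon (m_adjoins N xs) c"
        using mult_mem_m_adjoins[OF N xsc c, of x] xs A cc m_comm[of x c] by (auto simp: colon_def)
    qed
    then have "M \<subseteq> colon (m_adjoins N xs) c"
      using genideal_minimal[OF colon_ideal[OF id cc]] A(3) by simp
    then show ?thesis using a cc m_comm[of a c] by (auto simp: colon_def)
  qed
  have mM: "m \<cdot> M \<subseteq> m_adjoins N xs"
  proof
    fix s assume "s \<in> m \<cdot> M"
    then show "s \<in> m_adjoins N xs"
      by induction (use prod ideal_add_mem[OF id] in auto)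
  qed
  have "M \<subseteq> m_adjoins N xs"
  proof
    fix a assume "a \<in> M"
    then obtain n s where "n \<in> N" "s \<in> m \<cdot> M" "a = n \<oplus> s" using sub by (auto simp: set_add_def')
    then show "a \<in> m_adjoins N xs"
      using ideal_add_mem[OF id] mM subset_m_adjoins[OF N xsc] by auto
  qed
  then have "set xs \<subseteq> N" using nakayama_list[OF N xsc] xs AM by blast
  then show ?thesis using genideal_minimal[OF N, of A] xs A(3) by simp
qed

end

section \<open>Bases modulo an ideal\<close>

context cring
begin

definition lincomb :: "'i set \<Rightarrow> ('i \<Rightarrow> 'a) \<Rightarrow> ('i \<Rightarrow> 'a) \<Rightarrow> 'a" where
  "lincomb S r b = (\<Oplus>k\<in>S. r k \<otimes> b k)"

lemma lincomb_closed:
  "r \<in> S \<rightarrow> carrier R \<Longrightarrow> b \<in> S \<rightarrow> carrier R \<Longrightarrow> lincomb S r b \<in> carrier R"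
  unfolding lincomb_def by (rule finsum_closed) auto

lemma lincomb_insert:
  assumes "finite S" "k \<notin> S" "r \<in> insert k S \<rightarrow> carrier R" "b \<in> insert k S \<rightarrow> carrier R"
  shows "lincomb (insert k S) r b = r k \<otimes> b k \<oplus> lincomb S r b"
  unfolding lincomb_def by (rule finsum_insert) (use assms in auto)

lemma lincomb_cong:
  assumes "\<And>k. k \<in> S \<Longrightarrow> r k = r' k" "\<And>k. k \<in> S \<Longrightarrow> b k = b' k"
    "r' \<in> S \<rightarrow> carrier R" "b' \<in> S \<rightarrow> carrier R"
  shows "lincomb S r b = lincomb S r' b'"
  unfolding lincomb_def by (rule finsum_cong') (use assms in auto)

lemma lincomb_add:
  assumes "r \<in> S \<rightarrow> carrier R" "s \<in> S \<rightarrow> carrier R" "b \<in> S \<rightarrow> carrier R"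
  shows "lincomb S (\<lambda>k. r k \<oplus> s k) b = lincomb S r b \<oplus> lincomb S s b"
proof -
  have "lincomb S (\<lambda>k. r k \<oplus> s k) b = (\<Oplus>k\<in>S. r k \<otimes> b k \<oplus> s k \<otimes> b k)"
    unfolding lincomb_def by (rule finsum_cong') (use assms in \<open>auto simp: Pi_def l_distr\<close>)
  also have "\<dots> = lincomb S r b \<oplus> lincomb S s b"
    unfolding lincomb_def by (rule finsum_addf) (use assms in auto)
  finally show ?thesis .
qed

lemma lincomb_scale:
  assumes "finite S" "e \<in> carrier R" "r \<in> S \<rightarrow> carrier R" "b \<in> S \<rightarrow> carrier R"
  shows "lincomb S (\<lambda>k. e \<otimes> r k) b = e \<otimes> lincomb S r b"
proof -
  have "e \<otimes> lincomb S r b = (\<Oplus>k\<in>S. e \<otimes> (r k \<otimes> b k))"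
    unfolding lincomb_def by (rule finsum_rdistr) (use assms in auto)
  also have "\<dots> = lincomb S (\<lambda>k. e \<otimes> r k) b"
    unfolding lincomb_def by (rule finsum_cong') (use assms in \<open>auto simp: Pi_def m_assoc\<close>)
  finally show ?thesis by simp
qed

lemma lincomb_mem:
  assumes J: "ideal J R" and "finite S" "\<And>k. k \<in> S \<Longrightarrow> r k \<otimes> b k \<in> J"
  shows "lincomb S r b \<in> J"
  using assms(2,3) unfolding lincomb_def
proof (induction S)
  case (insert k S)
  then have "(\<Oplus>k\<in>insert k S. r k \<otimes> b k) = r k \<otimes> b k \<oplus> (\<Oplus>k\<in>S. r k \<otimes> b k)"
    using ideal_memD[OF J] by (intro finsum_insert) auto
  then show ?case using insert ideal_add_mem[OF J] by simp
qed (simp add: ideal_zero_mem[OF J])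

lemma lincomb_unit:
  assumes "finite S" "k \<in> S" "b \<in> S \<rightarrow> carrier R"
  shows "lincomb S (\<lambda>l. if l = k then \<one> else \<zero>) b = b k"
proof -
  have "lincomb S (\<lambda>l. if l = k then \<one> else \<zero>) b = (\<Oplus>l\<in>S. if k = l then b l else \<zero>)"
    unfolding lincomb_def by (rule finsum_cong') (use assms in \<open>auto simp: Pi_iff\<close>)
  also have "\<dots> = b k" by (rule finsum_singleton) (use assms in auto)
  finally show ?thesis .
qed

lemma lincomb_ideal:
  assumes S: "finite S" and b: "b \<in> S \<rightarrow> carrier R"
  shows "ideal {lincomb S r b | r. r \<in> S \<rightarrow> carrier R} R" (is "ideal ?L R")
proof (rule idealI_comm)
  show "?L \<subseteq> carrier R" using lincomb_closed b by auto
  have "lincomb S (\<lambda>k. \<zero>) b = \<zero>"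
    using lincomb_mem[OF zeroideal S, of "\<lambda>k. \<zero>" b] b by (auto simp: Pi_def)
  then show "\<zero> \<in> ?L" by (intro CollectI exI[of _ "\<lambda>k. \<zero>"]) auto
  fix x assume "x \<in> ?L"
  then obtain r where r: "r \<in> S \<rightarrow> carrier R" "x = lincomb S r b" by auto
  show "e \<otimes> x \<in> ?L" if "e \<in> carrier R" for e
    using lincomb_scale[OF S that r(1) b] r that
    by (intro CollectI exI[of _ "\<lambda>k. e \<otimes> r k"]) auto
  fix y assume "y \<in> ?L"
  then obtain s where s: "s \<in> S \<rightarrow> carrier R" "y = lincomb S s b" by auto
  show "x \<oplus> y \<in> ?L"
    using lincomb_add[OF r(1) s(1) b] r s by (intro CollectI exI[of _ "\<lambda>k. r k \<oplus> s k"]) auto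
qed

lemma genideal_image_eq_lincomb:
  assumes S: "finite S" and b: "b \<in> S \<rightarrow> carrier R"
  shows "Idl (b ` S) = {lincomb S r b | r. r \<in> S \<rightarrow> carrier R}" (is "_ = ?L")
proof
  show "Idl (b ` S) \<subseteq> ?L"
  proof (rule genideal_minimal[OF lincomb_ideal[OF assms]], rule subsetI)
    fix x assume "x \<in> b ` S"
    then obtain k where "k \<in> S" "x = b k" by auto
    then show "x \<in> ?L"
      using lincomb_unit[OF S _ b] by (intro CollectI exI[of _ "\<lambda>l. if l = k then \<one> else \<zero>"]) auto
  qed
  have bc: "b ` S \<subseteq> carrier R" using b by auto
  show "?L \<subseteq> Idl (b ` S)"
  proof
    fix x assume "x \<in> ?L"
    then obtain r where r: "r \<in> S \<rightarrow> carrier R" "x = lincomb S r b" by auto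
    show "x \<in> Idl (b ` S)" unfolding r(2)
      by (rule lincomb_mem[OF genideal_ideal[OF bc] S])
        (use r genideal_self[OF bc] genideal_ideal[OF bc] in \<open>auto intro!: ideal_lmult_mem\<close>)
  qed
qed

text \<open>\<open>b\<close> is a basis of \<open>I/K\<close> over \<open>R/I\<close>.\<close>

definition quot_basis :: "'a set \<Rightarrow> 'a set \<Rightarrow> 'i set \<Rightarrow> ('i \<Rightarrow> 'a) \<Rightarrow> bool" where
  "quot_basis I K S b \<longleftrightarrow> finite S \<and> b \<in> S \<rightarrow> I \<and>
     (\<forall>a\<in>I. \<exists>r\<in>S \<rightarrow> carrier R. a \<ominus> lincomb S r b \<in> K) \<and>
     (\<forall>r\<in>S \<rightarrow> carrier R. lincomb S r b \<in> K \<longrightarrow> (\<forall>k\<in>S. r k \<in> I))"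

end

context noetherian_local
begin

text \<open>Steinitz exchange over a local ring: \<open>r k\<close> is a unit because it lies
  outside \<open>m\<close>, so \<open>b k\<close> can be expressed through \<open>v\<close> and the
  other members, modulo \<open>K\<close>.\<close>

lemma quot_basis_exchange:
  assumes I: "ideal I R" "I \<subseteq> m" and K: "ideal K R"
    and B: "quot_basis I K S b" and k: "k \<in> S" and v: "v \<in> I"
    and r: "r \<in> S \<rightarrow> carrier R" "v \<ominus> lincomb S r b \<in> K" "r k \<notin> m"
  shows "quot_basis I K S (b(k := v))"
proof -
  define T where "T = S - {k}"
  have S: "S = insert k T" "k \<notin> T" using k T_def by auto
  have finS: "finite S" and bI: "b \<in> S \<rightarrow> I" using B by (auto simp: quot_basis_def)
  then have finT: "finite T" by (simp add: T_def)
  have bc: "b \<in> S \<rightarrow> carrier R" and vc: "v \<in> carrier R"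
    using bI v I ideal_memD by (auto simp: Pi_def)
  have upd: "lincomb S c (b(k := v)) = c k \<otimes> v \<oplus> lincomb T c b" if "c \<in> S \<rightarrow> carrier R" for c
  proof -
    have "lincomb S c (b(k := v)) = c k \<otimes> (b(k := v)) k \<oplus> lincomb T c (b(k := v))"
      unfolding S(1) by (rule lincomb_insert) (use finT S that bc vc in auto)
    also have "lincomb T c (b(k := v)) = lincomb T c b"
      by (rule lincomb_cong) (use S that bc in auto)
    finally show ?thesis by (simp only: fun_upd_same)
  qed
  have spl: "lincomb S c b = c k \<otimes> b k \<oplus> lincomb T c b" if "c \<in> S \<rightarrow> carrier R" for c
    unfolding S(1) by (rule lincomb_insert) (use finT S that bc in auto)
  have bk: "b k \<in> carrier R" and rk: "r k \<in> carrier R" using bc r k by auto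
  have bT: "b \<in> T \<rightarrow> carrier R" and rT: "r \<in> T \<rightarrow> carrier R" using bc r S by auto
  obtain u where u: "u \<in> carrier R" "u \<otimes> r k = \<one>" using unit_outside_m[OF rk r(3)] by auto
  define s where "s = v \<ominus> lincomb S r b"
  have sK: "s \<in> K" using r s_def by simp
  have sc: "s \<in> carrier R" using sK K ideal_memD by blast
  have LT: "lincomb T r b \<in> carrier R" using lincomb_closed rT bT by blast
  have veq: "v = s \<oplus> (r k \<otimes> b k \<oplus> lincomb T r b)"
  proof -
    have "v = (v \<ominus> (r k \<otimes> b k \<oplus> lincomb T r b)) \<oplus> (r k \<otimes> b k \<oplus> lincomb T r b)"
      using vc rk bk LT by algebra
    then show ?thesis unfolding s_def spl[OF r(1)] .
  qed
  have span: "\<exists>c'\<in>S \<rightarrow> carrier R. a \<ominus> lincomb S c' (b(k := v)) \<in> K" if a: "a \<in> I" for a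
  proof -
    obtain c where c: "c \<in> S \<rightarrow> carrier R" "a \<ominus> lincomb S c b \<in> K"
      using B a by (auto simp: quot_basis_def)
    have ac: "a \<in> carrier R" using a I ideal_memD by blast
    have ck: "c k \<in> carrier R" using c k by auto
    have cT: "c \<in> T \<rightarrow> carrier R" using c S by auto
    define e where "e = \<ominus> (c k \<otimes> u)"
    have ec: "e \<in> carrier R" using e_def ck u by simp
    \<comment> \<open>Coordinates of \<open>a\<close> in the new family:
      \<open>c k \<otimes> u\<close> copies of \<open>v\<close> reproduce the old term at
      \<open>k\<close>, and the correction by \<open>e\<close> removes what they add at the other
      indices.\<close>
    define c' where "c' = (\<lambda>l. if l = k then c k \<otimes> u else c l \<oplus> e \<otimes> r l)"
    have c'S: "c' \<in> S \<rightarrow> carrier R" using c(1) r(1) k u(1) ec by (auto simp: c'_def Pi_iff)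
    have LTc: "lincomb T c b \<in> carrier R" using lincomb_closed cT bT by blast
    have "lincomb T c' b = lincomb T (\<lambda>l. c l \<oplus> e \<otimes> r l) b"
      by (rule lincomb_cong) (use S cT rT ec bT in \<open>auto simp: c'_def\<close>)
    also have "\<dots> = lincomb T c b \<oplus> lincomb T (\<lambda>l. e \<otimes> r l) b"
      by (rule lincomb_add) (use cT rT ec bT in auto)
    also have "lincomb T (\<lambda>l. e \<otimes> r l) b = e \<otimes> lincomb T r b"
      by (rule lincomb_scale) (use finT rT ec bT in auto)
    finally have LTc': "lincomb T c' b = lincomb T c b \<oplus> e \<otimes> lincomb T r b" .
    have "lincomb S c' (b(k := v)) = c k \<otimes> u \<otimes> v \<oplus> (lincomb T c b \<oplus> e \<otimes> lincomb T r b)"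
      using upd[OF c'S] LTc' by (simp add: c'_def)
    also have "\<dots> = c k \<otimes> u \<otimes> s \<oplus> (c k \<otimes> (u \<otimes> r k) \<otimes> b k \<oplus> lincomb T c b)"
      unfolding veq e_def using ck u(1) sc rk bk LT LTc by algebra
    also have "\<dots> = c k \<otimes> u \<otimes> s \<oplus> lincomb S c b"
      unfolding u(2) spl[OF c(1)] using ck by simp
    finally have eq: "lincomb S c' (b(k := v)) = c k \<otimes> u \<otimes> s \<oplus> lincomb S c b" .
    have LSc: "lincomb S c b \<in> carrier R" using lincomb_closed c bc by blast
    have "a \<ominus> lincomb S c' (b(k := v)) = (a \<ominus> lincomb S c b) \<ominus> c k \<otimes> u \<otimes> s"
      unfolding eq using ac LSc ck u(1) sc by algebra
    moreover have "(a \<ominus> lincomb S c b) \<ominus> c k \<otimes> u \<otimes> s \<in> K"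
      by (rule ideal_diff_mem[OF K c(2) ideal_lmult_mem[OF K sK]]) (use ck u in simp)
    ultimately show ?thesis using c'S by (intro bexI[of _ c']) simp_all
  qed
  have indep: "\<forall>l\<in>S. c l \<in> I" if c: "c \<in> S \<rightarrow> carrier R" "lincomb S c (b(k := v)) \<in> K" for c
  proof -
    have ck: "c k \<in> carrier R" using c k by auto
    have cT: "c \<in> T \<rightarrow> carrier R" using c S by auto
    \<comment> \<open>The same combination rewritten in the old family, up to the multiple
      \<open>c k \<otimes> s\<close> that lies in \<open>K\<close>.\<close>
    define c' where "c' = (\<lambda>l. if l = k then c k \<otimes> r k else c l \<oplus> c k \<otimes> r l)"
    have c'S: "c' \<in> S \<rightarrow> carrier R" using c(1) r(1) k by (auto simp: c'_def Pi_iff)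
    have LTc: "lincomb T c b \<in> carrier R" using lincomb_closed cT bT by blast
    have "lincomb T c' b = lincomb T (\<lambda>l. c l \<oplus> c k \<otimes> r l) b"
      by (rule lincomb_cong) (use S cT rT ck bT in \<open>auto simp: c'_def\<close>)
    also have "\<dots> = lincomb T c b \<oplus> lincomb T (\<lambda>l. c k \<otimes> r l) b"
      by (rule lincomb_add) (use cT rT ck bT in auto)
    also have "lincomb T (\<lambda>l. c k \<otimes> r l) b = c k \<otimes> lincomb T r b"
      by (rule lincomb_scale) (use finT rT ck bT in auto)
    finally have LTc': "lincomb T c' b = lincomb T c b \<oplus> c k \<otimes> lincomb T r b" .
    have "lincomb S c' b = c k \<otimes> r k \<otimes> b k \<oplus> (lincomb T c b \<oplus> c k \<otimes> lincomb T r b)"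
      using spl[OF c'S] LTc' by (simp add: c'_def)
    also have "\<dots> = (c k \<otimes> (s \<oplus> (r k \<otimes> b k \<oplus> lincomb T r b)) \<oplus> lincomb T c b) \<ominus> c k \<otimes> s"
      using ck sc rk bk LT LTc by algebra
    also have "\<dots> = lincomb S c (b(k := v)) \<ominus> c k \<otimes> s"
      unfolding upd[OF c(1)] veq[symmetric] ..
    also have "\<dots> \<in> K"
      by (intro ideal_diff_mem ideal_lmult_mem K c sK ck)
    finally have "\<forall>l\<in>S. c' l \<in> I" using B c'S unfolding quot_basis_def by blast
    then have c'I: "c' l \<in> I" if "l \<in> S" for l using that by blast
    have "c k \<otimes> r k \<in> I" using c'I[OF k] by (simp add: c'_def)
    then have "u \<otimes> (c k \<otimes> r k) \<in> I" using ideal_lmult_mem I(1) u(1) by blast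
    moreover have "u \<otimes> (c k \<otimes> r k) = c k"
    proof -
      have "u \<otimes> (c k \<otimes> r k) = c k \<otimes> (u \<otimes> r k)" using u(1) ck rk by algebra
      then show ?thesis using u ck by simp
    qed
    ultimately have ckI: "c k \<in> I" by simp
    have "c l \<in> I" if l: "l \<in> S" "l \<noteq> k" for l
    proof -
      have "c l \<oplus> c k \<otimes> r l \<in> I" using c'I[OF l(1)] l(2) by (simp add: c'_def)
      then show ?thesis
        by (rule ideal_add_cancel[OF I(1), rotated 2])
          (use c(1) r l ckI I(1) in \<open>auto intro: ideal_rmult_mem\<close>)
    qed
    then show ?thesis using ckI by blast
  qed
  show ?thesis unfolding quot_basis_def
    using finS span indep bI v by (auto simp: Pi_def)
qed

text \<open>If the \<open>k\<close>-th coordinate of every generator were in \<open>m\<close>, the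
  elements of \<open>I\<close> with such a coordinate would form an ideal containing all generators,
  hence \<open>b k\<close>, whose own coordinate is 1.\<close>

lemma quot_basis_coeff_unit:
  assumes I: "ideal I R" "I \<subseteq> m" and K: "ideal K R"
    and B: "quot_basis I K S b" and k: "k \<in> S" and A: "A \<subseteq> carrier R" "Idl A = I"
  shows "\<exists>a\<in>A. \<exists>r\<in>S \<rightarrow> carrier R. a \<ominus> lincomb S r b \<in> K \<and> r k \<notin> m"
proof (rule ccontr)
  assume no: "\<not> ?thesis"
  have finS: "finite S" and bI: "b \<in> S \<rightarrow> I" using B by (auto simp: quot_basis_def)
  have bc: "b \<in> S \<rightarrow> carrier R" using bI I ideal_memD by (auto simp: Pi_def)
  let ?W = "{x \<in> I. \<exists>r\<in>S \<rightarrow> carrier R. x \<ominus> lincomb S r b \<in> K \<and> r k \<in> m}"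
  have "ideal ?W R"
  proof (rule idealI_comm)
    show "?W \<subseteq> carrier R" using I ideal_memD by blast
    have "lincomb S (\<lambda>k. \<zero>) b = \<zero>"
      using lincomb_mem[OF zeroideal finS, of "\<lambda>k. \<zero>" b] bc by (auto simp: Pi_def)
    then have "\<zero> \<ominus> lincomb S (\<lambda>k. \<zero>) b \<in> K \<and> \<zero> \<in> m"
      using ideal_zero_mem[OF K] ideal_zero_mem[OF m_ideal] by (simp add: minus_eq)
    then show "\<zero> \<in> ?W" using ideal_zero_mem[OF I(1)] by (auto intro!: bexI[of _ "\<lambda>k. \<zero>"])
    fix x assume "x \<in> ?W"
    then obtain r where x: "x \<in> I" and r: "r \<in> S \<rightarrow> carrier R" "x \<ominus> lincomb S r b \<in> K" "r k \<in> m"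
      by auto
    have xc: "x \<in> carrier R" and Lr: "lincomb S r b \<in> carrier R"
      using x I ideal_memD lincomb_closed r bc by auto
    show "e \<otimes> x \<in> ?W" if e: "e \<in> carrier R" for e
    proof -
      have "e \<otimes> x \<ominus> lincomb S (\<lambda>k. e \<otimes> r k) b = e \<otimes> (x \<ominus> lincomb S r b)"
        unfolding lincomb_scale[OF finS e r(1) bc] using e xc Lr by algebra
      then have "e \<otimes> x \<ominus> lincomb S (\<lambda>k. e \<otimes> r k) b \<in> K"
        using ideal_lmult_mem[OF K r(2) e] by simp
      then show ?thesis
        using e x r ideal_lmult_mem[OF I(1)] ideal_lmult_mem[OF m_ideal]
        by (auto intro!: bexI[of _ "\<lambda>k. e \<otimes> r k"])
    qed
    fix y assume "y \<in> ?W"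
    then obtain s where y: "y \<in> I" and s: "s \<in> S \<rightarrow> carrier R" "y \<ominus> lincomb S s b \<in> K" "s k \<in> m"
      by auto
    have yc: "y \<in> carrier R" and Ls: "lincomb S s b \<in> carrier R"
      using y I ideal_memD lincomb_closed s bc by auto
    have "x \<oplus> y \<ominus> lincomb S (\<lambda>k. r k \<oplus> s k) b = (x \<ominus> lincomb S r b) \<oplus> (y \<ominus> lincomb S s b)"
      unfolding lincomb_add[OF r(1) s(1) bc] using xc yc Lr Ls by algebra
    then have "x \<oplus> y \<ominus> lincomb S (\<lambda>k. r k \<oplus> s k) b \<in> K"
      using ideal_add_mem[OF K r(2) s(2)] by simp
    then show "x \<oplus> y \<in> ?W"
      using x y r s ideal_add_mem[OF I(1)] ideal_add_mem[OF m_ideal]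
      by (auto intro!: bexI[of _ "\<lambda>k. r k \<oplus> s k"])
  qed
  moreover have "A \<subseteq> ?W"
  proof
    fix a assume a: "a \<in> A"
    then have aI: "a \<in> I" using A genideal_self by blast
    then obtain r where r: "r \<in> S \<rightarrow> carrier R" "a \<ominus> lincomb S r b \<in> K"
      using B by (auto simp: quot_basis_def)
    then have "r k \<in> m" using no a by blast
    then show "a \<in> ?W" using aI r by blast
  qed
  ultimately have "I \<subseteq> ?W" using genideal_minimal A by blast
  moreover have bkI: "b k \<in> I" using bI k by auto
  ultimately have "b k \<in> ?W" by blast
  then obtain r where r: "r \<in> S \<rightarrow> carrier R" "b k \<ominus> lincomb S r b \<in> K" "r k \<in> m"
    by blast
  \<comment> \<open>The two expressions of \<open>b k\<close> are subtracted; independence puts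
    \<open>1 - r k\<close> into \<open>I\<close>, hence into \<open>m\<close>, and
    \<open>r k\<close> is in \<open>m\<close> as well.\<close>
  let ?d = "\<lambda>l. if l = k then \<one> else \<zero>"
  let ?r = "\<lambda>l. \<ominus> \<one> \<otimes> r l"
  have dS: "?d \<in> S \<rightarrow> carrier R" by auto
  have rS: "?r \<in> S \<rightarrow> carrier R" using r by auto
  have Lr: "lincomb S r b \<in> carrier R" using lincomb_closed r bc by auto
  have bkc: "b k \<in> carrier R" using bc k by auto
  have "lincomb S (\<lambda>l. ?d l \<oplus> ?r l) b = b k \<oplus> \<ominus> \<one> \<otimes> lincomb S r b"
    unfolding lincomb_add[OF dS rS bc] lincomb_unit[OF finS k bc]
    by (subst lincomb_scale[OF finS _ r(1) bc]) simp_all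
  also have "\<dots> = b k \<ominus> lincomb S r b" using bkc Lr by algebra
  finally have "lincomb S (\<lambda>l. ?d l \<oplus> ?r l) b \<in> K" using r(2) by simp
  moreover have "(\<lambda>l. ?d l \<oplus> ?r l) \<in> S \<rightarrow> carrier R" using r(1) by (auto simp: Pi_iff)
  ultimately have "\<forall>l\<in>S. ?d l \<oplus> ?r l \<in> I" using B unfolding quot_basis_def by blast
  then have "\<one> \<oplus> \<ominus> \<one> \<otimes> r k \<in> I" using k by force
  then have 1: "\<one> \<oplus> \<ominus> \<one> \<otimes> r k \<in> m" using I by blast
  have "\<one> \<in> m"
    by (rule ideal_add_cancel[OF m_ideal one_closed _ 1])
      (use r(3) m_ideal in \<open>auto intro: ideal_lmult_mem\<close>)
  then show False using one_not_mem_m by simp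
qed

text \<open>Each exchange alters the family only at \<open>k\<close>, so the generators inserted
  earlier stay in place.\<close>

lemma quot_basis_from_generators:
  assumes I: "ideal I R" "I \<subseteq> m" and K: "ideal K R"
    and B: "quot_basis I K S b" and A: "A \<subseteq> carrier R" "Idl A = I" and "T \<subseteq> S"
  shows "\<exists>b'. quot_basis I K S b' \<and> b' ` T \<subseteq> A"
proof -
  have "finite T" using B assms(7) finite_subset by (auto simp: quot_basis_def)
  then show ?thesis using assms(7)
  proof (induction T)
    case empty
    then show ?case using B by auto
  next
    case (insert k T)
    then obtain b' where b': "quot_basis I K S b'" "b' ` T \<subseteq> A" by auto
    obtain a r where a: "a \<in> A" "r \<in> S \<rightarrow> carrier R" "a \<ominus> lincomb S r b' \<in> K" "r k \<notin> m"
      using quot_basis_coeff_unit[OF I K b'(1) _ A, of k] insert.prems by blast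
    have "quot_basis I K S (b'(k := a))"
      by (rule quot_basis_exchange[OF I K b'(1) _ _ a(2-4)])
        (use insert.prems a A genideal_self in auto)
    moreover have "(b'(k := a)) ` insert k T \<subseteq> A" using b'(2) a(1) insert.hyps by auto
    ultimately show ?case by blast
  qed
qed

text \<open>By Nakayama a basis of \<open>I/I^2\<close> lifts to generators of \<open>I\<close>.
  Conversely the members of a basis can be exchanged for members of any generating set, and a basis
  has distinct members, since a repetition would put 1 into \<open>I\<close>.\<close>

lemma num_gens_eq_card_quot_basis:
  assumes I: "ideal I R" "I \<subseteq> m" and B: "quot_basis I (I \<cdot> I) S b"
  shows "num_gens R I = card S"
proof -
  have K: "ideal (I \<cdot> I) R" using ideal_prod_is_ideal[OF I(1) I(1)] .
  have finS: "finite S" and bI: "b \<in> S \<rightarrow> I" using B by (auto simp: quot_basis_def)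
  have bc: "b \<in> S \<rightarrow> carrier R" using bI I ideal_memD by (auto simp: Pi_def)
  have bsub: "b ` S \<subseteq> carrier R" using bc by auto
  have gen: "I = Idl (b ` S)"
  proof
    show "Idl (b ` S) \<subseteq> I" by (rule genideal_minimal) (use I bI in auto)
    show "I \<subseteq> Idl (b ` S)"
    proof (rule nakayama[OF I(1) genideal_ideal[OF bsub]], rule subsetI)
      fix a assume a: "a \<in> I"
      then obtain r where r: "r \<in> S \<rightarrow> carrier R" "a \<ominus> lincomb S r b \<in> I \<cdot> I"
        using B by (auto simp: quot_basis_def)
      have "I \<cdot> I \<subseteq> m \<cdot> I"
      proof
        fix s assume "s \<in> I \<cdot> I"
        then show "s \<in> m \<cdot> I" using I(2) by induction (auto intro: ideal_prod.intros)
      qed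
      then have 1: "a \<ominus> lincomb S r b \<in> m \<cdot> I" using r by blast
      have 2: "lincomb S r b \<in> Idl (b ` S)" using genideal_image_eq_lincomb[OF finS bc] r by blast
      have "a = lincomb S r b \<oplus> (a \<ominus> lincomb S r b)"
        using lincomb_closed[OF r(1) bc] a I ideal_memD by algebra
      then show "a \<in> Idl (b ` S) <+>\<^bsub>R\<^esub> (m \<cdot> I)" using 1 2 by (auto simp: set_add_def')
    qed
  qed
  have lower: "card S \<le> card A" if A: "A \<subseteq> carrier R" "finite A" "I = Idl A" for A
  proof -
    obtain c where c: "quot_basis I (I \<cdot> I) S c" "c ` S \<subseteq> A"
      using quot_basis_from_generators[OF I K B A(1) A(3)[symmetric], of S] by blast
    have cc: "c \<in> S \<rightarrow> carrier R" using c A by auto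
    have "inj_on c S"
    proof (rule inj_onI, rule ccontr)
      fix k l assume kl: "k \<in> S" "l \<in> S" "c k = c l" "k \<noteq> l"
      let ?d = "\<lambda>k l. if l = k then \<one> else \<zero>"
      let ?r = "\<lambda>i. ?d k i \<oplus> \<ominus> \<one> \<otimes> ?d l i"
      have ckc: "c l \<in> carrier R" using cc kl by auto
      have "lincomb S ?r c = c k \<oplus> \<ominus> \<one> \<otimes> c l"
        by (subst lincomb_add, auto simp: cc[unfolded Pi_def, simplified] lincomb_unit[OF finS _ cc] kl(1))
          (subst lincomb_scale[OF finS], auto simp: cc lincomb_unit[OF finS _ cc] kl)
      also have "\<dots> = \<zero>" unfolding kl(3) using ckc by algebra
      finally have "lincomb S ?r c \<in> I \<cdot> I" using ideal_zero_mem[OF K] by simp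
      moreover have "?r \<in> S \<rightarrow> carrier R" by auto
      ultimately have "?r k \<in> I" using c(1) kl(1) unfolding quot_basis_def by blast
      then have "\<one> \<in> I" using kl(4) by simp
      then show False using I(2) one_not_mem_m by blast
    qed
    then have "card S = card (c ` S)" by (simp add: card_image)
    also have "\<dots> \<le> card A" using c A card_mono by blast
    finally show ?thesis .
  qed
  let ?P = "\<lambda>n. \<exists>A \<subseteq> carrier R. finite A \<and> card A = n \<and> I = Idl A"
  have P: "?P (card (b ` S))" using bsub gen finS by blast
  \<comment> \<open>The image of \<open>b\<close> could have fewer elements than \<open>S\<close>;
    the lower bound, applied to the image itself, excludes this.\<close>
  then have "card S \<le> card (b ` S)" using lower[of "b ` S"] bsub gen finS by blast
  then have "?P (card S)" using P card_image_le[OF finS, of b] by (metis le_antisym)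
  then show ?thesis
    unfolding num_gens_def using lower by (intro Least_equality) auto
qed

section \<open>The structure of an Ulrich ideal\<close>

context
  fixes I Q :: "'a set" and xs :: "'a list"
  assumes I: "ideal I R" "I \<subseteq> m" and xs: "set xs \<subseteq> m" and Q: "Q = adjoins {\<zero>} xs" "Q \<subseteq> I"
    and II: "I \<cdot> I = Q \<cdot> I"
    and depth: "\<And>us. set us \<subseteq> m \<Longrightarrow> regseq {\<zero>} us \<Longrightarrow> length us < length xs \<Longrightarrow>
      depth_pos m (adjoins {\<zero>} us)"
    and primary: "\<And>P. primeideal P R \<Longrightarrow> Q \<subseteq> P \<Longrightarrow> m \<subseteq> P"
begin

lemma Q_ideal: "ideal Q R"
  unfolding Q(1) by (rule adjoins_ideal[OF zeroideal]) (use xs m_subset in blast)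

text \<open>\<open>depth\<close> is the contribution of the Cohen--Macaulay property and
  \<open>primary\<close> that of \<open>Q\<close> being \<open>m\<close>-primary. The generators
  \<open>zs\<close> may differ from \<open>xs\<close>: the next proof chooses them with a prescribed
  last entry.\<close>

lemma exists_regseq_parameters:
  assumes "set zs \<subseteq> m" "length zs = length xs" "adjoins {\<zero>} zs = Q"
  shows "\<exists>us. regseq {\<zero>} us \<and> set us \<subseteq> m \<and> length us = length xs \<and> adjoins {\<zero>} us = Q \<and>
    (zs \<noteq> [] \<longrightarrow> last us = last zs)"
  using exists_regseq_same_ideal[OF zeroideal m_ideal assms(1)] assms(2,3) depth primary by simp

text \<open>Were a minimal generator \<open>v\<close> of \<open>Q\<close> in \<open>m I\<close>, Nakayama would give \<open>I\<^sup>2 \<subseteq> Q'\<close> for the ideal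
  \<open>Q'\<close> of the other generators, so \<open>v\<^sup>2 \<in> Q'\<close> although \<open>v\<close> is regular modulo \<open>Q'\<close>.\<close>

lemma parameter_not_in_mI:
  assumes j: "j < length xs" and q: "q \<in> Idl (set (take j xs))"
  shows "xs ! j \<ominus> q \<notin> m \<cdot> I"
proof
  define v where "v = xs ! j \<ominus> q"
  assume "xs ! j \<ominus> q \<in> m \<cdot> I"
  then have vmI: "v \<in> m \<cdot> I" by (simp add: v_def)
  have xsc: "set xs \<subseteq> carrier R" using xs m_subset by blast
  have tc: "set (take j xs) \<subseteq> carrier R" using xsc set_take_subset[of j xs] by blast
  have idT: "ideal (Idl (set (take j xs))) R" using genideal_ideal[OF tc] .
  have qc: "q \<in> carrier R" using q idT ideal_memD by blast
  have xjQ: "xs ! j \<in> Q" unfolding Q(1) using set_subset_adjoins[OF zeroideal xsc] j by auto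
  have xjc: "xs ! j \<in> carrier R" using xjQ Q_ideal ideal_memD by blast
  have setQ: "set xs \<subseteq> Q" unfolding Q(1) using set_subset_adjoins[OF zeroideal xsc] .
  have qQ: "q \<in> Q"
    using genideal_minimal[OF Q_ideal, of "set (take j xs)"] setQ set_take_subset[of j xs] q by blast
  have vQ: "v \<in> Q" unfolding v_def by (rule ideal_diff_mem[OF Q_ideal xjQ qQ])
  have vc: "v \<in> carrier R" using vQ Q_ideal ideal_memD by blast
  \<comment> \<open>\<open>v\<close> replaces \<open>xs ! j\<close> and is moved to the end, because
    making the list regular preserves only the last entry.\<close>
  define zs where "zs = take j xs @ drop (Suc j) xs @ [v]"
  have lz: "length zs = length xs" using j by (simp add: zs_def)
  have zm: "set zs \<subseteq> m"
    unfolding zs_def using xs set_take_subset[of j xs] set_drop_subset[of "Suc j" xs] vQ Q(2) I(2) by auto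
  have zc: "set zs \<subseteq> carrier R" using zm m_subset by blast
  have idz: "ideal (adjoins {\<zero>} zs) R" using adjoins_ideal[OF zeroideal zc] .
  have "adjoins {\<zero>} zs = Q" unfolding Q(1)
  proof (rule adjoins_eqI[OF zeroideal zc zeroideal xsc])
    show "{\<zero>} \<union> set zs \<subseteq> adjoins {\<zero>} xs"
      using setQ vQ Q_ideal ideal_zero_mem set_take_subset[of j xs] set_drop_subset[of "Suc j" xs]
      unfolding zs_def Q(1)[symmetric] by auto
    have sz: "set zs \<subseteq> adjoins {\<zero>} zs" using set_subset_adjoins[OF zeroideal zc] .
    then have "set (take j xs) \<subseteq> adjoins {\<zero>} zs" by (auto simp: zs_def)
    then have "q \<in> adjoins {\<zero>} zs" using genideal_minimal[OF idz, of "set (take j xs)"] q by blast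
    moreover have "v \<in> adjoins {\<zero>} zs" using sz by (simp add: zs_def)
    ultimately have "v \<oplus> q \<in> adjoins {\<zero>} zs" using ideal_add_mem[OF idz] by blast
    moreover have "v \<oplus> q = xs ! j" unfolding v_def using xjc qc by algebra
    ultimately have "xs ! j \<in> adjoins {\<zero>} zs" by simp
    moreover have "set xs = insert (xs ! j) (set (take j xs) \<union> set (drop (Suc j) xs))"
      using id_take_nth_drop[OF j] by (metis Un_insert_right list.simps(15) set_append)
    ultimately show "{\<zero>} \<union> set xs \<subseteq> adjoins {\<zero>} zs"
      using sz ideal_zero_mem[OF idz] by (auto simp: zs_def)
  qed
  then obtain us where us: "regseq {\<zero>} us" "set us \<subseteq> m" "length us = length xs"
    "adjoins {\<zero>} us = Q" "zs \<noteq> [] \<longrightarrow> last us = last zs"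
    using exists_regseq_parameters[OF zm lz] by blast
  have "us \<noteq> []" using us(3) j by auto
  moreover have "last us = v" using us(5) by (simp add: zs_def)
  ultimately obtain vs where vs: "us = vs @ [v]" by (metis append_butlast_last_id)
  define Q' where "Q' = adjoins {\<zero>} vs"
  have vsm: "set vs \<subseteq> m" using us(2) vs by simp
  have Q': "ideal Q' R" unfolding Q'_def
    by (rule adjoins_ideal[OF zeroideal]) (use vsm m_subset in blast)
  have Q'm: "Q' \<subseteq> m" unfolding Q'_def
    using adjoins_subset_iff[OF zeroideal _ m_ideal] vsm m_subset ideal_zero_mem[OF m_ideal] by auto
  have regv: "reg_mod Q' v" using us(1) vs by (simp add: regseq_append Q'_def)
  have QQ': "Q = adjoin Q' v" using us(4) vs by (simp add: adjoins_append Q'_def)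
  have II': "ideal (I \<cdot> I) R" using ideal_prod_is_ideal[OF I(1) I(1)] .
  \<comment> \<open>As \<open>Q = Q' + (v)\<close> with \<open>v\<close> in \<open>m I\<close>, the
    equality \<open>I I = Q I\<close> puts \<open>I I\<close> into \<open>Q' + m I I\<close>, the
    situation of Nakayama's lemma.\<close>
  let ?N = "Q' <+>\<^bsub>R\<^esub> (m \<cdot> (I \<cdot> I))"
  have N: "ideal ?N R" by (rule add_ideals[OF Q' ideal_prod_is_ideal[OF m_ideal II']])
  have gen: "i \<otimes> a \<in> ?N" if i: "i \<in> Q" and a: "a \<in> I" for i a
  proof -
    obtain q' r where qr: "q' \<in> Q'" "r \<in> carrier R" "i = q' \<oplus> r \<otimes> v"
      using i QQ' adjoinE by metis
    have ac: "a \<in> carrier R" and q'c: "q' \<in> carrier R" using a I qr Q' ideal_memD by auto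
    have "v \<otimes> (r \<otimes> a) \<in> (m \<cdot> I) \<cdot> I"
      using ideal_prod.prod[OF vmI] ideal_lmult_mem[OF I(1) a qr(2)] by blast
    then have 1: "v \<otimes> (r \<otimes> a) \<in> m \<cdot> (I \<cdot> I)" using ideal_prod_assoc[OF m_ideal I(1) I(1)] by simp
    have "i \<otimes> a = q' \<otimes> a \<oplus> v \<otimes> (r \<otimes> a)" unfolding qr(3) using q'c qr(2) vc ac by algebra
    moreover have "q' \<otimes> a \<in> Q'" using ideal_rmult_mem[OF Q' qr(1) ac] .
    ultimately show ?thesis using 1 by (auto simp: set_add_def')
  qed
  have "I \<cdot> I \<subseteq> ?N"
  proof
    fix s assume "s \<in> I \<cdot> I"
    then have "s \<in> Q \<cdot> I" using II by simp
    then show "s \<in> ?N"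
    proof induction
      case (prod i a)
      then show ?case using gen by simp
    next
      case (sum s1 s2)
      then show ?case by (intro ideal_add_mem[OF N])
    qed
  qed
  then have "I \<cdot> I \<subseteq> Q'" using nakayama[OF II' Q'] by simp
  moreover have "v \<otimes> v \<in> I \<cdot> I" by (rule ideal_prod.prod) (use vQ Q(2) in auto)
  ultimately have "v \<otimes> v \<in> Q'" by blast
  \<comment> \<open>Regularity of \<open>v\<close> modulo \<open>Q'\<close> is used twice: once to
    cancel a factor of \<open>v v\<close>, once to cancel \<open>v\<close> itself against 1.\<close>
  then have "v \<in> Q'" using reg_modD[OF regv vc] by blast
  then have "\<one> \<in> Q'" using reg_modD[OF regv one_closed] vc by simp
  then show False using Q'm one_not_mem_m by blast
qed

text \<open>The parameters are exchanged into the basis one after another. If all coordinates of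
  \<open>xs ! j\<close> outside \<open>T\<close> were in \<open>m\<close>, then
  \<open>xs ! j\<close> would be in \<open>m I\<close> up to the ideal of the earlier parameters,
  which \<open>parameter_not_in_mI\<close> forbids; so there is an exchangeable index outside
  \<open>T\<close>.\<close>

lemma quot_basis_containing_parameters:
  assumes B: "quot_basis I (I \<cdot> I) S b" and "j \<le> length xs"
  shows "\<exists>b' T. quot_basis I (I \<cdot> I) S b' \<and> T \<subseteq> S \<and> card T = j \<and> b' ` T = set (take j xs)"
  using assms(2)
proof (induction j)
  case 0
  then show ?case using B by (intro exI[of _ b] exI[of _ "{}"]) auto
next
  case (Suc j)
  have K: "ideal (I \<cdot> I) R" using ideal_prod_is_ideal[OF I(1) I(1)] .
  obtain b' T where b': "quot_basis I (I \<cdot> I) S b'" "T \<subseteq> S" "card T = j" "b' ` T = set (take j xs)"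
    using Suc by auto
  have j: "j < length xs" using Suc.prems by simp
  have finS: "finite S" and bI: "b' \<in> S \<rightarrow> I" using b'(1) by (auto simp: quot_basis_def)
  have finT: "finite T" using b'(2) finS finite_subset by blast
  have bc: "b' \<in> S \<rightarrow> carrier R" using bI I ideal_memD by (auto simp: Pi_def)
  have xsc: "set xs \<subseteq> carrier R" using xs m_subset by blast
  have "set xs \<subseteq> Q" unfolding Q(1) using set_subset_adjoins[OF zeroideal xsc] .
  then have xI: "xs ! j \<in> I" using Q(2) nth_mem[OF j] by blast
  have xc: "xs ! j \<in> carrier R" using xI I ideal_memD by blast
  obtain r where r: "r \<in> S \<rightarrow> carrier R" "xs ! j \<ominus> lincomb S r b' \<in> I \<cdot> I"
    using b'(1) xI by (auto simp: quot_basis_def)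
  have "\<exists>k\<in>S - T. r k \<notin> m"
  proof (rule ccontr)
    assume no: "\<not> ?thesis"
    have mI: "ideal (m \<cdot> I) R" using ideal_prod_is_ideal[OF m_ideal I(1)] .
    have bTc: "b' \<in> T \<rightarrow> carrier R" and rTc: "r \<in> T \<rightarrow> carrier R" using bc r b'(2) by auto
    have bSTc: "b' \<in> S - T \<rightarrow> carrier R" and rSTc: "r \<in> S - T \<rightarrow> carrier R" using bc r by auto
    have LT: "lincomb T r b' \<in> Idl (set (take j xs))"
      using genideal_image_eq_lincomb[OF finT bTc] b'(4) rTc by auto
    have LST: "lincomb (S - T) r b' \<in> m \<cdot> I"
      by (rule lincomb_mem[OF mI]) (use finS no bI in \<open>auto intro!: ideal_prod.prod\<close>)
    have ST: "S = T \<union> (S - T)" using b'(2) by auto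
    have "lincomb S r b' = lincomb T r b' \<oplus> lincomb (S - T) r b'"
      unfolding lincomb_def
      by (subst ST, rule finsum_Un_disjoint) (use finS finT bTc rTc bSTc rSTc in auto)
    moreover have c: "lincomb T r b' \<in> carrier R" "lincomb (S - T) r b' \<in> carrier R"
      using lincomb_closed bTc rTc bSTc rSTc by auto
    ultimately have eq: "xs ! j \<ominus> lincomb T r b' =
        (xs ! j \<ominus> lincomb S r b') \<oplus> lincomb (S - T) r b'"
      using xc by algebra
    have "I \<cdot> I \<subseteq> m \<cdot> I"
    proof
      fix s assume "s \<in> I \<cdot> I"
      then show "s \<in> m \<cdot> I" using I(2) by induction (auto intro: ideal_prod.intros)
    qed
    then have "xs ! j \<ominus> lincomb T r b' \<in> m \<cdot> I"
      unfolding eq using r(2) LST ideal_add_mem[OF mI] by blast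
    then show False using parameter_not_in_mI[OF j LT] by simp
  qed
  then obtain k where k: "k \<in> S" "k \<notin> T" "r k \<notin> m" by blast
  have "quot_basis I (I \<cdot> I) S (b'(k := xs ! j))"
    by (rule quot_basis_exchange[OF I K b'(1) k(1) xI r k(3)])
  moreover have "(b'(k := xs ! j)) ` insert k T = set (take (Suc j) xs)"
  proof -
    have "(b'(k := xs ! j)) ` T = b' ` T" using k(2) by (intro image_cong) auto
    then show ?thesis
      using b'(4) j by (simp only: image_insert fun_upd_same) (simp add: take_Suc_conv_app_nth)
  qed
  moreover have "card (insert k T) = Suc j" using finT k(2) b'(3) by simp
  moreover have "insert k T \<subseteq> S" using k(1) b'(2) by simp
  ultimately show ?case by blast
qed

text \<open>The members indexed by \<open>T\<close> generate \<open>Q\<close>, and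
  \<open>I I\<close> lies in \<open>Q\<close>; hence the remaining members form a basis of
  \<open>I/Q\<close>.\<close>

theorem quot_basis_modulo_parameters:
  assumes B: "quot_basis I (I \<cdot> I) (S :: 'i set) b"
  shows "\<exists>(S' :: 'i set) y. quot_basis I Q S' y \<and> card S' = card S - length xs"
proof -
  obtain b' T where b': "quot_basis I (I \<cdot> I) S b'" "T \<subseteq> S" "card T = length xs" "b' ` T = set xs"
    using quot_basis_containing_parameters[OF B, of "length xs"] by auto
  have finS: "finite S" and bI: "b' \<in> S \<rightarrow> I" using b'(1) by (auto simp: quot_basis_def)
  have finT: "finite T" using b'(2) finS finite_subset by blast
  have bc: "b' \<in> S \<rightarrow> carrier R" using bI I ideal_memD by (auto simp: Pi_def)
  have bTc: "b' \<in> T \<rightarrow> carrier R" and bUc: "b' \<in> S - T \<rightarrow> carrier R" using bc b'(2) by auto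
  have xsc: "set xs \<subseteq> carrier R" using xs m_subset by blast
  have QT: "Q = {lincomb T r b' | r. r \<in> T \<rightarrow> carrier R}"
    unfolding Q(1) adjoins_zero_eq_genideal[OF xsc] b'(4)[symmetric]
    by (rule genideal_image_eq_lincomb[OF finT bTc])
  have split: "lincomb S r b' = lincomb T r b' \<oplus> lincomb (S - T) r b'"
    if "r \<in> S \<rightarrow> carrier R" for r
  proof -
    have ST: "S = T \<union> (S - T)" using b'(2) by auto
    show ?thesis unfolding lincomb_def
      by (subst ST, rule finsum_Un_disjoint) (use finS finT bTc bUc that b'(2) in \<open>auto simp: Pi_iff subset_iff\<close>)
  qed
  have "I \<cdot> I \<subseteq> Q" unfolding II using ideal_prod_inter[OF Q_ideal I(1)] by blast
  have "quot_basis I Q (S - T) b'"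
    unfolding quot_basis_def
  proof (intro conjI ballI impI)
    show "finite (S - T)" using finS by simp
    show "b' \<in> S - T \<rightarrow> I" using bI by auto
  next
    fix a assume a: "a \<in> I"
    have ac: "a \<in> carrier R" using a I ideal_memD by blast
    obtain r where r: "r \<in> S \<rightarrow> carrier R" "a \<ominus> lincomb S r b' \<in> I \<cdot> I"
      using b'(1) a by (auto simp: quot_basis_def)
    have rT: "r \<in> T \<rightarrow> carrier R" and rU: "r \<in> S - T \<rightarrow> carrier R" using r b'(2) by auto
    have c: "lincomb T r b' \<in> carrier R" "lincomb (S - T) r b' \<in> carrier R"
      using lincomb_closed bTc rT bUc rU by auto
    have "a \<ominus> lincomb (S - T) r b' = (a \<ominus> lincomb S r b') \<oplus> lincomb T r b'"
      unfolding split[OF r(1)] using ac c by algebra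
    moreover have "lincomb T r b' \<in> Q" using QT rT by blast
    ultimately have "a \<ominus> lincomb (S - T) r b' \<in> Q"
      using r(2) \<open>I \<cdot> I \<subseteq> Q\<close> ideal_add_mem[OF Q_ideal] by auto
    then show "\<exists>r\<in>S - T \<rightarrow> carrier R. a \<ominus> lincomb (S - T) r b' \<in> Q" using rU by blast
  next
    fix r k assume r: "r \<in> S - T \<rightarrow> carrier R" and "lincomb (S - T) r b' \<in> Q" and k: "k \<in> S - T"
    then obtain s where s: "s \<in> T \<rightarrow> carrier R" "lincomb (S - T) r b' = lincomb T s b'"
      using QT by auto
    \<comment> \<open>Moving the \<open>T\<close>-part to the other side gives a combination over
      \<open>S\<close> equal to zero, to which independence modulo \<open>I I\<close>
      applies.\<close>
    define c where "c = (\<lambda>l. if l \<in> T then \<ominus> \<one> \<otimes> s l else r l)"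
    have cS: "c \<in> S \<rightarrow> carrier R" using r s(1) by (auto simp: c_def Pi_iff)
    have 1: "lincomb (S - T) c b' = lincomb (S - T) r b'"
      by (rule lincomb_cong) (use r bUc in \<open>auto simp: c_def\<close>)
    have "lincomb T c b' = lincomb T (\<lambda>l. \<ominus> \<one> \<otimes> s l) b'"
      by (rule lincomb_cong) (use s bTc in \<open>auto simp: c_def\<close>)
    also have "\<dots> = \<ominus> \<one> \<otimes> lincomb T s b'" by (rule lincomb_scale) (use finT s bTc in auto)
    finally have 2: "lincomb T c b' = \<ominus> \<one> \<otimes> lincomb T s b'" .
    have "lincomb S c b' = \<zero>" unfolding split[OF cS] 1 2 s(2)
      using lincomb_closed[OF s(1) bTc] by algebra
    then have "lincomb S c b' \<in> I \<cdot> I"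
      using ideal_zero_mem[OF ideal_prod_is_ideal[OF I(1) I(1)]] by simp
    then have "c k \<in> I" using b'(1) cS k unfolding quot_basis_def by blast
    then show "r k \<in> I" using k by (simp add: c_def)
  qed
  moreover have "card (S - T) = card S - length xs"
    using b'(2,3) finT by (simp add: card_Diff_subset)
  ultimately show ?thesis by blast
qed

end

end

section \<open>Free conormal modules and bases of \<open>I/I^2\<close> in terms of elements\<close>

lemma regular_module_simps [simp]:
  "carrier (regular_module R) = carrier R" "ring.zero (regular_module R) = \<zero>\<^bsub>R\<^esub>"
  "ring.add (regular_module R) = ring.add R" "module.smult (regular_module R) = monoid.mult R"
  by (simp_all add: regular_module_def)

lemma carrier_update_coset [simp]:
  "N +>\<^bsub>M\<lparr>carrier := C\<rparr>\<^esub> x = N +>\<^bsub>M\<^esub> x" "set_add (M\<lparr>carrier := C\<rparr>) = set_add M"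
  by (auto simp: a_r_coset_def' set_add_def' fun_eq_iff)

lemma regular_module_coset [simp]:
  "J +>\<^bsub>regular_module R\<^esub> x = J +>\<^bsub>R\<^esub> x" "set_add (regular_module R) = set_add R"
  by (auto simp: a_r_coset_def' set_add_def' fun_eq_iff)

context cring
begin

lemma rcoset_eq_iff:
  assumes "ideal J R" "a \<in> carrier R" "b \<in> carrier R"
  shows "J +> a = J +> b \<longleftrightarrow> a \<ominus> b \<in> J"
  using quotient_eq_iff_same_a_r_cos[OF assms] by auto

lemma rcoset_eq_self_iff:
  assumes "ideal J R" "a \<in> carrier R"
  shows "J +> a = J \<longleftrightarrow> a \<in> J"
proof -
  have "J +> \<zero> = J" using assms(1) a_coset_add_zero ideal_subset_carrier by blast
  then show ?thesis using rcoset_eq_iff[OF assms zero_closed] assms(2) by (simp add: minus_eq)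
qed

lemma mem_rcosetE:
  assumes "x \<in> J +> a"
  obtains j where "j \<in> J" "x = j \<oplus> a"
  using assms by (auto simp: a_r_coset_def')

lemma ideal_power_2:
  assumes "ideal I R"
  shows "ideal_power R I 2 = I \<cdot> I"
  using ideal_prod_one[OF assms] by (simp add: numeral_2_eq_2)

lemma conormal_module_carrier:
  assumes "ideal I R"
  shows "carrier (conormal_module R I) = {(I \<cdot> I) +> a | a. a \<in> I}"
  unfolding conormal_module_def quot_module_def Let_def ideal_power_2[OF assms]
  by (auto simp: A_RCOSETS_def' a_r_coset_def')

lemma conormal_module_zero:
  assumes "ideal I R"
  shows "\<zero>\<^bsub>conormal_module R I\<^esub> = I \<cdot> I"
  unfolding conormal_module_def quot_module_def Let_def ideal_power_2[OF assms] by simp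

lemma conormal_module_add:
  assumes I: "ideal I R" and a: "a \<in> I" "b \<in> I"
  shows "((I \<cdot> I) +> a) \<oplus>\<^bsub>conormal_module R I\<^esub> ((I \<cdot> I) +> b) = (I \<cdot> I) +> (a \<oplus> b)"
proof -
  interpret K: ideal "I \<cdot> I" R using ideal_prod_is_ideal[OF I I] .
  have "add (conormal_module R I) = set_add R"
    unfolding conormal_module_def quot_module_def Let_def
    by simp
  moreover have "a \<in> carrier R" "b \<in> carrier R" using I a ideal_memD by auto
  ultimately show ?thesis using K.a_rcos_sum by simp
qed

text \<open>For representatives \<open>i + r\<close> and \<open>k + a\<close> the product differs
  from \<open>r a\<close> by \<open>i a + (i + r) k\<close>, which lies in \<open>I I\<close>; so
  the union in the definition is one of equal cosets.\<close>

lemma conormal_module_smult: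
  assumes I: "ideal I R" and r: "r \<in> carrier R" and a: "a \<in> I"
  shows "(I +> r) \<odot>\<^bsub>conormal_module R I\<^esub> ((I \<cdot> I) +> a) = (I \<cdot> I) +> (r \<otimes> a)"
proof -
  let ?K = "I \<cdot> I"
  have K: "ideal ?K R" using ideal_prod_is_ideal[OF I I] .
  have ac: "a \<in> carrier R" using a I ideal_memD by blast
  have eq: "?K +> (s \<otimes> x) = ?K +> (r \<otimes> a)" if s: "s \<in> I +> r" and x: "x \<in> ?K +> a" for s x
  proof -
    obtain i where i: "i \<in> I" "s = i \<oplus> r" using s by (rule mem_rcosetE)
    obtain k where k: "k \<in> ?K" "x = k \<oplus> a" using x by (rule mem_rcosetE)
    have c: "i \<in> carrier R" "k \<in> carrier R" using i k I K ideal_memD by auto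
    have "s \<otimes> x \<ominus> r \<otimes> a = i \<otimes> a \<oplus> (i \<oplus> r) \<otimes> k"
      unfolding i k using c ac r by algebra
    moreover have "i \<otimes> a \<in> ?K" using i(1) a ideal_prod.prod by metis
    moreover have "(i \<oplus> r) \<otimes> k \<in> ?K" using ideal_lmult_mem[OF K k(1)] c r by simp
    ultimately have "s \<otimes> x \<ominus> r \<otimes> a \<in> ?K" using ideal_add_mem[OF K] by simp
    moreover have "s \<otimes> x \<in> carrier R" "r \<otimes> a \<in> carrier R" using c ac r i(2) k(2) by auto
    ultimately show ?thesis by (simp add: rcoset_eq_iff[OF K])
  qed
  have ne: "I +> r \<noteq> {}" "?K +> a \<noteq> {}"
    using ideal_zero_mem[OF I] ideal_zero_mem[OF K] by (auto simp: a_r_coset_def')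
  have "(I +> r) \<odot>\<^bsub>conormal_module R I\<^esub> (?K +> a) = (\<Union>s\<in>I +> r. \<Union>x\<in>?K +> a. ?K +> (s \<otimes> x))"
    unfolding conormal_module_def quot_module_def Let_def ideal_power_2[OF I]
    by simp
  also have "\<dots> = ?K +> (r \<otimes> a)" using eq ne by auto
  finally show ?thesis .
qed

text \<open>The summand is a function \<open>f\<close> with prescribed values, since in use it is
  written with the basis cosets themselves, or with coefficients that have the form
  \<open>I +> r k\<close> only on the index set.\<close>

lemma conormal_module_finsum:
  assumes I: "ideal I R" and M: "abelian_monoid (conormal_module R I)"
    and "finite S" "r \<in> S \<rightarrow> carrier R" "x \<in> S \<rightarrow> I"
    and "\<And>k. k \<in> S \<Longrightarrow> f k = (I +> r k) \<odot>\<^bsub>conormal_module R I\<^esub> ((I \<cdot> I) +> x k)"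
  shows "finsum (conormal_module R I) f S = (I \<cdot> I) +> lincomb S r x"
  using assms(3-)
proof (induction S)
  case empty
  have "(I \<cdot> I) +> \<zero> = I \<cdot> I"
    using rcoset_eq_self_iff[OF ideal_prod_is_ideal[OF I I] zero_closed]
      ideal_zero_mem[OF ideal_prod_is_ideal[OF I I]] by simp
  then show ?case
    by (simp add: abelian_monoid.finsum_empty[OF M] conormal_module_zero[OF I] lincomb_def)
next
  case (insert k S)
  interpret M: abelian_monoid "conormal_module R I" by (rule M)
  have xc: "x \<in> insert k S \<rightarrow> carrier R" using insert.prems I ideal_memD by (auto simp: Pi_iff)
  have f: "f l = (I \<cdot> I) +> (r l \<otimes> x l)" if "l \<in> insert k S" for l
    using insert.prems that conormal_module_smult[OF I, of "r l" "x l"] by (auto simp: Pi_iff)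
  have memI: "r l \<otimes> x l \<in> I" if "l \<in> insert k S" for l
    using insert.prems that ideal_lmult_mem[OF I] by (auto simp: Pi_iff)
  have fc: "f \<in> insert k S \<rightarrow> carrier (conormal_module R I)"
    using f memI conormal_module_carrier[OF I] by auto
  have "finsum (conormal_module R I) f (insert k S) =
      f k \<oplus>\<^bsub>conormal_module R I\<^esub> finsum (conormal_module R I) f S"
    by (rule M.finsum_insert) (use insert.hyps fc in auto)
  also have "finsum (conormal_module R I) f S = (I \<cdot> I) +> lincomb S r x"
    using insert by auto
  also have "f k \<oplus>\<^bsub>conormal_module R I\<^esub> ((I \<cdot> I) +> lincomb S r x) =
      (I \<cdot> I) +> (r k \<otimes> x k \<oplus> lincomb S r x)"
    unfolding f[OF insertI1] using insert.hyps memI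
    by (intro conormal_module_add[OF I]) (auto intro: lincomb_mem[OF I])
  also have "r k \<otimes> x k \<oplus> lincomb S r x = lincomb (insert k S) r x"
    using lincomb_insert[of S k r x] insert xc by auto
  finally show ?case .
qed

lemma carrier_FactRing: "carrier (R Quot J) = {J +> a | a. a \<in> carrier R}"
  by (auto simp: FactRing_def A_RCOSETS_def')

lemma zero_FactRing: "\<zero>\<^bsub>R Quot J\<^esub> = J"
  by (simp add: FactRing_def)

end

context noetherian_local
begin

text \<open>A basis \<open>B\<close> in the sense of \<open>is_basis\<close> may be infinite.
  Finitely many generators of \<open>I\<close> involve only a finite part \<open>B0\<close>, which
  already spans, and independence is inherited from \<open>B\<close>.\<close>

lemma quot_basis_of_free_conormal_module:
  assumes I: "ideal I R" "I \<subseteq> m" and free: "free_module (R Quot I) (conormal_module R I)"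
  shows "\<exists>(B :: 'a set set) x. quot_basis I (I \<cdot> I) B x"
proof -
  let ?M = "conormal_module R I"
  let ?K = "I \<cdot> I"
  have K: "ideal ?K R" using ideal_prod_is_ideal[OF I(1) I(1)] .
  have "module (R Quot I) ?M" using free by (simp add: free_module_def)
  then have M: "abelian_monoid ?M"
    unfolding module_def abelian_group_def by blast
  interpret M: abelian_monoid ?M by (rule M)
  obtain B where B: "is_basis (R Quot I) ?M B" using free by (auto simp: free_module_def)
  have "\<forall>b\<in>B. \<exists>x. x \<in> I \<and> b = ?K +> x"
  proof
    fix b assume "b \<in> B"
    then have "b \<in> carrier ?M" using B by (auto simp: is_basis_def)
    then show "\<exists>x. x \<in> I \<and> b = ?K +> x" unfolding conormal_module_carrier[OF I(1)] by auto
  qed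
  then obtain x where x: "\<And>b. b \<in> B \<Longrightarrow> x b \<in> I \<and> b = ?K +> x b" by metis
  have Bex: "\<exists>!c. c \<in> B \<rightarrow>\<^sub>E carrier (R Quot I) \<and> finite {b \<in> B. c b \<noteq> I} \<and>
      ?K +> a = finsum ?M (\<lambda>b. c b \<odot>\<^bsub>?M\<^esub> b) {b \<in> B. c b \<noteq> I}" if "a \<in> I" for a
  proof -
    have "?K +> a \<in> carrier ?M" using that conormal_module_carrier[OF I(1)] by auto
    then show ?thesis using B unfolding is_basis_def zero_FactRing
      by (elim conjE) (drule (1) bspec, assumption)
  qed
  have fs: "finsum ?M (\<lambda>b. (I +> r b) \<odot>\<^bsub>?M\<^esub> b) T = ?K +> lincomb T r x"
    if "finite T" "T \<subseteq> B" "r \<in> T \<rightarrow> carrier R" for T r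
    by (rule conormal_module_finsum[OF I(1) M]) (use that x in \<open>auto simp: Pi_iff\<close>)
  have span: "\<exists>T r. finite T \<and> T \<subseteq> B \<and> r \<in> T \<rightarrow> carrier R \<and> a \<ominus> lincomb T r x \<in> ?K"
    if a: "a \<in> I" for a
  proof -
    obtain c where c: "c \<in> B \<rightarrow>\<^sub>E carrier (R Quot I)" "finite {b \<in> B. c b \<noteq> I}"
      "?K +> a = finsum ?M (\<lambda>b. c b \<odot>\<^bsub>?M\<^esub> b) {b \<in> B. c b \<noteq> I}"
      using Bex[OF a] by blast
    let ?T = "{b \<in> B. c b \<noteq> I}"
    have "\<forall>b\<in>B. \<exists>s\<in>carrier R. c b = I +> s"
    proof
      fix b assume "b \<in> B"
      then have "c b \<in> carrier (R Quot I)" using c(1) by auto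
      then show "\<exists>s\<in>carrier R. c b = I +> s" unfolding carrier_FactRing by auto
    qed
    then obtain r where r: "\<And>b. b \<in> B \<Longrightarrow> r b \<in> carrier R \<and> c b = I +> r b" by metis
    have xT: "x \<in> ?T \<rightarrow> carrier R" using x I(1) ideal_memD by auto
    have rT: "r \<in> ?T \<rightarrow> carrier R" using r by auto
    have "?K +> a = finsum ?M (\<lambda>b. (I +> r b) \<odot>\<^bsub>?M\<^esub> b) ?T"
      unfolding c(3)
    proof (rule M.finsum_cong')
      show "(\<lambda>b. (I +> r b) \<odot>\<^bsub>?M\<^esub> b) \<in> ?T \<rightarrow> carrier ?M"
      proof
        fix b assume "b \<in> ?T"
        then have b: "r b \<in> carrier R" "x b \<in> I" "b = ?K +> x b" using r x by auto
        have "(I +> r b) \<odot>\<^bsub>?M\<^esub> (?K +> x b) \<in> carrier ?M"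
          unfolding conormal_module_smult[OF I(1) b(1,2)] conormal_module_carrier[OF I(1)]
          using ideal_lmult_mem[OF I(1) b(2,1)] by blast
        then show "(I +> r b) \<odot>\<^bsub>?M\<^esub> b \<in> carrier ?M" using b(3) by simp
      qed
    qed (use r in auto)
    also have "\<dots> = ?K +> lincomb ?T r x" by (rule fs) (use c(2) r in auto)
    finally have "a \<ominus> lincomb ?T r x \<in> ?K"
      using rcoset_eq_iff[OF K] a I(1) ideal_memD lincomb_closed[OF rT xT] by blast
    then show ?thesis using c(2) rT by blast
  qed
  have indep: "\<forall>b\<in>T. r b \<in> I"
    if T: "finite T" "T \<subseteq> B" "r \<in> T \<rightarrow> carrier R" "lincomb T r x \<in> ?K" for T r
  proof -
    \<comment> \<open>The coset \<open>I\<close> is the zero of \<open>R Quot I\<close>, so outside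
      \<open>T\<close> the coefficient is zero. Comparison with the zero function \<open>z\<close>
      will use uniqueness of coefficients for the class of zero.\<close>
    define c where "c = (\<lambda>b\<in>B. if b \<in> T then I +> r b else I)"
    define z where "z = (\<lambda>b\<in>B. I)"
    let ?T = "{b \<in> B. c b \<noteq> I}"
    have I0: "I +> \<zero> = I" using rcoset_eq_self_iff[OF I(1) zero_closed] ideal_zero_mem[OF I(1)] by simp
    then have IF: "I \<in> carrier (R Quot I)" unfolding carrier_FactRing by (metis (mono_tags, lifting) CollectI zero_closed)
    have subT: "?T \<subseteq> T" by (auto simp: c_def)
    have finT: "finite ?T" using subT T(1) finite_subset by blast
    have rT: "r \<in> ?T \<rightarrow> carrier R" using T(3) subT by auto
    have xT: "x \<in> T \<rightarrow> carrier R" using x I(1) T(2) ideal_memD by auto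
    have xT': "x \<in> ?T \<rightarrow> carrier R" using xT subT by auto
    \<comment> \<open>Members of \<open>T\<close> with zero coefficient class drop out of the
      support of \<open>c\<close>; their terms are products of two elements of
      \<open>I\<close>.\<close>
    have rest: "lincomb (T - ?T) r x \<in> ?K"
    proof (rule lincomb_mem[OF K])
      fix b assume b: "b \<in> T - ?T"
      then have "I +> r b = I" using T(2) by (auto simp: c_def split: if_splits)
      then have "r b \<in> I" using rcoset_eq_self_iff[OF I(1), of "r b"] b T(3) by auto
      moreover have "x b \<in> I" using x b T(2) by auto
      ultimately show "r b \<otimes> x b \<in> ?K" using ideal_prod.prod by metis
    qed (use T in auto)
    have cl: "lincomb ?T r x \<in> carrier R" "lincomb (T - ?T) r x \<in> carrier R"
      by (auto intro!: lincomb_closed rT xT' Pi_mem[OF T(3)] Pi_mem[OF xT])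
    have "lincomb T r x = lincomb ?T r x \<oplus> lincomb (T - ?T) r x"
    proof -
      have "T = ?T \<union> (T - ?T)" using subT by blast
      moreover have "lincomb (?T \<union> (T - ?T)) r x = lincomb ?T r x \<oplus> lincomb (T - ?T) r x"
        unfolding lincomb_def
        by (rule finsum_Un_disjoint) (use finT T(1,3) xT subT in \<open>auto simp: Pi_iff subset_iff\<close>)
      ultimately show ?thesis by simp
    qed
    then have "lincomb ?T r x \<in> ?K"
      using ideal_add_cancel[OF K cl(1) rest] T(4) by simp
    then have "?K +> lincomb ?T r x = ?K" using rcoset_eq_self_iff[OF K cl(1)] by simp
    moreover have "finsum ?M (\<lambda>b. c b \<odot>\<^bsub>?M\<^esub> b) ?T = ?K +> lincomb ?T r x"
      by (rule conormal_module_finsum[OF I(1) M finT rT])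
        (use x subT in \<open>auto simp: c_def split: if_splits\<close>)
    moreover have "?K +> \<zero> = ?K"
      using rcoset_eq_self_iff[OF K zero_closed] ideal_zero_mem[OF K] by simp
    ultimately have 1: "?K +> \<zero> = finsum ?M (\<lambda>b. c b \<odot>\<^bsub>?M\<^esub> b) ?T" by simp
    have z0: "{b \<in> B. z b \<noteq> I} = {}" by (auto simp: z_def)
    have 2: "?K +> \<zero> = finsum ?M (\<lambda>b. z b \<odot>\<^bsub>?M\<^esub> b) {b \<in> B. z b \<noteq> I}"
      unfolding z0 using \<open>?K +> \<zero> = ?K\<close> by (simp add: conormal_module_zero[OF I(1)])
    have cP: "c \<in> B \<rightarrow>\<^sub>E carrier (R Quot I)"
      using IF T(3) unfolding c_def carrier_FactRing by (auto simp: Pi_iff)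
    have zP: "z \<in> B \<rightarrow>\<^sub>E carrier (R Quot I)" using IF unfolding z_def by auto
    have "c = z"
      using Bex[OF ideal_zero_mem[OF I(1)]] cP zP 1 2 finT z0 by (metis (no_types, lifting) finite.emptyI)
    have "I +> r b = I" if "b \<in> T" for b
    proof -
      have "b \<in> B" using that T(2) by auto
      then have "c b = I +> r b" "z b = I" using that by (simp_all add: c_def z_def)
      then show ?thesis using \<open>c = z\<close> by simp
    qed
    then show ?thesis using rcoset_eq_self_iff[OF I(1)] T(3) by (auto simp: Pi_iff)
  qed
  \<comment> \<open>The finite index set arises here, as the union of the supports of finitely many
    generators of \<open>I\<close>.\<close>
  obtain A where A: "A \<subseteq> carrier R" "finite A" "I = Idl A" using finetely_gen[OF I(1)] by blast
  have AI: "A \<subseteq> I" using A genideal_self by blast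
  have "\<forall>a\<in>A. \<exists>T. finite T \<and> T \<subseteq> B \<and> (\<exists>r\<in>T \<rightarrow> carrier R. a \<ominus> lincomb T r x \<in> ?K)"
    using span AI by (meson subsetD)
  then obtain T where T: "\<And>a. a \<in> A \<Longrightarrow> finite (T a) \<and> T a \<subseteq> B \<and>
      (\<exists>r\<in>T a \<rightarrow> carrier R. a \<ominus> lincomb (T a) r x \<in> ?K)" by metis
  define B0 where "B0 = (\<Union>a\<in>A. T a)"
  have B0: "finite B0" "B0 \<subseteq> B" using T A(2) by (auto simp: B0_def)
  have x0: "x \<in> B0 \<rightarrow> carrier R" using x I(1) B0(2) ideal_memD by auto
  have x0sub: "x ` B0 \<subseteq> carrier R" using x0 by auto
  let ?L = "Idl (x ` B0) <+>\<^bsub>R\<^esub> ?K"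
  have L: "ideal ?L R" using add_ideals[OF genideal_ideal[OF x0sub] K] .
  have "A \<subseteq> ?L"
  proof
    fix a assume a: "a \<in> A"
    then obtain r where r: "r \<in> T a \<rightarrow> carrier R" "a \<ominus> lincomb (T a) r x \<in> ?K" using T by blast
    have Ta: "finite (T a)" "T a \<subseteq> B0" using T[OF a] a by (auto simp: B0_def)
    have xTa: "x \<in> T a \<rightarrow> carrier R" using x0 Ta by auto
    have mem: "lincomb (T a) r x \<in> Idl (x ` B0)"
      by (rule lincomb_mem[OF genideal_ideal[OF x0sub] Ta(1)])
        (use r Ta genideal_self[OF x0sub] in \<open>auto intro!: ideal_lmult_mem[OF genideal_ideal[OF x0sub]]\<close>)
    have "a = lincomb (T a) r x \<oplus> (a \<ominus> lincomb (T a) r x)"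
      using lincomb_closed[OF r(1) xTa] subsetD[OF A(1) a] by algebra
    then show "a \<in> ?L" using mem r(2) by (auto simp: set_add_def')
  qed
  then have IL: "I \<subseteq> ?L" using genideal_minimal[OF L] A(3) by blast
  have "quot_basis I ?K B0 x"
    unfolding quot_basis_def
  proof (intro conjI ballI impI)
    show "finite B0" by (rule B0)
    show "x \<in> B0 \<rightarrow> I" using x B0 by auto
    show "r k \<in> I" if "r \<in> B0 \<rightarrow> carrier R" "lincomb B0 r x \<in> ?K" "k \<in> B0" for r k
      using indep[OF B0 that(1,2)] that(3) by blast
    fix a assume "a \<in> I"
    then obtain h k where hk: "h \<in> Idl (x ` B0)" "k \<in> ?K" "a = h \<oplus> k"
      using IL by (auto simp: set_add_def')
    then obtain r where r: "r \<in> B0 \<rightarrow> carrier R" "h = lincomb B0 r x"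
      using genideal_image_eq_lincomb[OF B0(1) x0] by auto
    have "h \<in> carrier R" "k \<in> carrier R"
      using r lincomb_closed x0 hk(2) K ideal_memD by auto
    then have "a \<ominus> lincomb B0 r x = k" unfolding hk(3) r(2)[symmetric] by algebra
    then show "\<exists>r\<in>B0 \<rightarrow> carrier R. a \<ominus> lincomb B0 r x \<in> ?K" using hk(2) r(1) by auto
  qed
  then show ?thesis by blast
qed

end

section \<open>The ring-theoretic data of an Ulrich ideal\<close>

context cring
begin

text \<open>\<open>regular_sequence\<close> speaks of the prefixes \<open>take i xs\<close>, so the
  passage to \<open>regseq\<close> is an induction on the length of a prefix.\<close>

lemma regseq_of_regular_sequence:
  assumes "regular_sequence R xs"
  shows "regseq {\<zero>} xs"
proof -
  have c: "set xs \<subseteq> carrier R" using assms by (simp add: regular_sequence_def)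
  have "regseq {\<zero>} (take i xs)" if "i \<le> length xs" for i
    using that
  proof (induction i)
    case (Suc i)
    then have i: "i < length xs" by simp
    have "adjoins {\<zero>} (take i xs) = Idl (set (take i xs))"
      by (rule adjoins_zero_eq_genideal) (use c set_take_subset[of i xs] in blast)
    then have "reg_mod (adjoins {\<zero>} (take i xs)) (xs ! i)"
      using assms i subsetD[OF c nth_mem[OF i]] unfolding regular_sequence_def reg_mod_def by simp
    then show ?case using Suc i by (simp add: take_Suc_conv_app_nth regseq_append)
  qed simp
  from this[of "length xs"] show ?thesis by simp
qed

lemma radical_subset_prime:
  assumes P: "primeideal P R" and "Q \<subseteq> P"
  shows "radical R Q \<subseteq> P"
proof
  fix a assume "a \<in> radical R Q"
  then obtain n :: nat where a: "a \<in> carrier R" "a [^] n \<in> P" using assms(2) by (auto simp: radical_def)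
  have idP: "ideal P R" using P primeideal.axioms(1) by blast
  from a(2) show "a \<in> P"
  proof (induction n)
    case 0
    then have "\<one> \<in> P" by simp
    then show ?case using ideal.one_imp_carrier[OF idP] a by simp
  next
    case (Suc n)
    then show ?case using primeideal.I_prime[OF P, of "a [^] n" a] a by auto
  qed
qed

end

text \<open>A finite supremum forces the set of lengths to be finite, so it is a maximum. This turns
  depth \<open>d\<close> into an actual regular sequence of length \<open>d\<close>.\<close>

lemma SUP_enat_length_attained:
  assumes "(SUP xs\<in>A. enat (length xs)) = enat d" "A \<noteq> {}"
  obtains xs where "xs \<in> A" "length xs = d"
proof -
  let ?B = "(\<lambda>xs. enat (length xs)) ` A"
  have "finite ?B" using assms by (auto simp: Sup_enat_def split: if_splits)
  then have "enat d = Max ?B" using assms by (simp add: Sup_enat_def)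
  then have "enat d \<in> ?B" using \<open>finite ?B\<close> assms(2) by (metis Max_in image_is_empty)
  then show ?thesis using that by auto
qed

lemma noetherian_local_ring_imp_locale:
  "noetherian_local_ring R m \<Longrightarrow> noetherian_local R m"
  unfolding noetherian_local_ring_def
  by (intro noetherian_local.intro noetherian_cring.intro noetherian_local_axioms.intro) auto

text \<open>All that the homological part uses of the ring. The sequence \<open>vs\<close> generates
  the same ideal as the given system of parameters but need not be that system. \<open>S\<close> is
  nonempty because an empty basis would mean \<open>I = Q\<close>, a parameter ideal.\<close>

lemma ulrich_ideal_structure:
  fixes R :: "('a, 'r) ring_scheme" (structure)
  assumes CM: "cohen_macaulay_local_ring R m" and d: "krull_dim R = enat d"
    and U: "ulrich_ideal R m I" and np: "\<not> parameter_ideal R m I"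
  shows "\<exists>Q vs (S :: 'a set set) y.
    cring.regseq R {\<zero>} vs \<and> Q = cring.adjoins R {\<zero>} vs \<and> length vs = d \<and>
    ideal I R \<and> \<one> \<notin> I \<and> Q \<subseteq> I \<and> (\<forall>a\<in>I. \<forall>b\<in>I. a \<otimes> b \<in> Q) \<and>
    cring.quot_basis R I Q S y \<and> card S = num_gens R I - d \<and> S \<noteq> {}"
proof -
  have NL: "noetherian_local_ring R m" and dep: "ring_depth R m = enat d"
    using CM d by (auto simp: cohen_macaulay_local_ring_def)
  interpret noetherian_local R m using NL by (rule noetherian_local_ring_imp_locale)
  have rad: "radical R I = m" and I: "ideal I R" and InR: "I \<noteq> carrier R"
    using U by (auto simp: ulrich_ideal_def m_primary_def primary_ideal_def)
  have Im: "I \<subseteq> m" using proper_ideal_subset[OF I InR] .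
  obtain Q where Q: "parameter_ideal R m Q" "reduction_of R Q I" "ideal_power R I 2 = Q \<cdot> I"
    using U by (auto simp: ulrich_ideal_def)
  obtain xs where xs: "system_of_parameters R m xs" "Q = Idl (set xs)"
    using Q(1) by (auto simp: parameter_ideal_def)
  have xsm: "set xs \<subseteq> m" and lxs: "length xs = d" and radQ: "radical R Q = m"
    using xs d by (auto simp: system_of_parameters_def m_primary_def)
  have xsc: "set xs \<subseteq> carrier R" using xsm m_subset by blast
  have QI: "Q \<subseteq> I" using Q(2) by (simp add: reduction_of_def)
  have Qadj: "Q = adjoins {\<zero>} xs" using adjoins_zero_eq_genideal[OF xsc] xs(2) by simp
  have II: "I \<cdot> I = Q \<cdot> I" using Q(3) ideal_power_2[OF I] by simp
  let ?A = "{xs. regular_sequence R xs \<and> set xs \<subseteq> m}"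
  have "Idl {} \<noteq> carrier R"
    using genideal_minimal[OF m_ideal, of "{}"] one_not_mem_m by auto
  then have "[] \<in> ?A" by (simp add: regular_sequence_def)
  then obtain ys where ys: "regular_sequence R ys" "set ys \<subseteq> m" "length ys = d"
    using SUP_enat_length_attained[of ?A d] dep unfolding ring_depth_def by blast
  have depth: "depth_pos m (adjoins {\<zero>} us)"
    if "set us \<subseteq> m" "regseq {\<zero>} us" "length us < length xs" for us
    by (rule depth_pos_adjoins[OF zeroideal m_ideal that(2,1) regseq_of_regular_sequence[OF ys(1)] ys(2)])
      (use that lxs ys in simp)
  have primary: "m \<subseteq> P" if "primeideal P R" "Q \<subseteq> P" for P
    using radical_subset_prime[OF that] radQ by simp
  obtain B :: "'a set set" and x where B: "quot_basis I (I \<cdot> I) B x"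
    using quot_basis_of_free_conormal_module[OF I Im] U unfolding ulrich_ideal_def by blast
  obtain S :: "'a set set" and y where S: "quot_basis I Q S y" "card S = card B - length xs"
    using quot_basis_modulo_parameters[OF I Im xsm Qadj QI II depth primary B] by blast
  obtain us where us: "regseq {\<zero>} us" "length us = length xs" "adjoins {\<zero>} us = Q"
    using exists_regseq_parameters[OF I Im xsm Qadj QI II depth primary xsm _ Qadj[symmetric]] by blast
  have Qid: "ideal Q R" using Q(2) by (simp add: reduction_of_def)
  have "S \<noteq> {}"
  proof
    assume "S = {}"
    have "a \<in> Q" if "a \<in> I" for a
    proof -
      have "a \<ominus> \<zero> \<in> Q" using S(1) that \<open>S = {}\<close> by (auto simp: quot_basis_def lincomb_def)
      then show ?thesis using that I ideal_memD by (simp add: minus_eq)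
    qed
    then have "I = Q" using QI by blast
    then show False using np Q(1) by simp
  qed
  moreover have "a \<otimes> b \<in> Q" if "a \<in> I" "b \<in> I" for a b
  proof -
    have "a \<otimes> b \<in> I \<cdot> I" using that by (rule ideal_prod.prod)
    then show ?thesis unfolding II using ideal_prod_inter[OF Qid I] by blast
  qed
  moreover have "card S = num_gens R I - d"
    using S(2) num_gens_eq_card_quot_basis[OF I Im B] lxs by simp
  moreover have "\<one> \<notin> I" using Im one_not_mem_m by blast
  ultimately show ?thesis using us I QI S(1) lxs by (intro exI[of _ Q] exI[of _ us] exI[of _ S] exI[of _ y]) auto
qed

section \<open>Linear combinations in modules\<close>

context module
begin

lemma smult_r_diff:
  "a \<in> carrier R \<Longrightarrow> x \<in> carrier M \<Longrightarrow> y \<in> carrier M \<Longrightarrow>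
    a \<odot>\<^bsub>M\<^esub> (x \<ominus>\<^bsub>M\<^esub> y) = a \<odot>\<^bsub>M\<^esub> x \<ominus>\<^bsub>M\<^esub> a \<odot>\<^bsub>M\<^esub> y"
  by (simp add: M.minus_eq smult_r_distr smult_r_minus)

lemma smult_l_diff:
  "a \<in> carrier R \<Longrightarrow> b \<in> carrier R \<Longrightarrow> x \<in> carrier M \<Longrightarrow>
    (a \<ominus> b) \<odot>\<^bsub>M\<^esub> x = a \<odot>\<^bsub>M\<^esub> x \<ominus>\<^bsub>M\<^esub> b \<odot>\<^bsub>M\<^esub> x"
  by (simp add: M.minus_eq R.minus_eq smult_l_distr smult_l_minus)

lemma diff_add_cancel_M:
  "x \<in> carrier M \<Longrightarrow> y \<in> carrier M \<Longrightarrow> (x \<ominus>\<^bsub>M\<^esub> y) \<oplus>\<^bsub>M\<^esub> y = x"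
  by (simp add: M.minus_eq M.a_assoc M.l_neg)

lemma add_diff_cancel_M:
  "x \<in> carrier M \<Longrightarrow> y \<in> carrier M \<Longrightarrow> (x \<oplus>\<^bsub>M\<^esub> y) \<ominus>\<^bsub>M\<^esub> y = x"
  by (simp add: M.minus_eq M.a_assoc M.r_neg)

lemma add_diff_cancel_left_M:
  "x \<in> carrier M \<Longrightarrow> y \<in> carrier M \<Longrightarrow> (x \<oplus>\<^bsub>M\<^esub> y) \<ominus>\<^bsub>M\<^esub> x = y"
  using add_diff_cancel_M[of y x] by (simp add: M.a_comm)

lemma diff_self_M: "x \<in> carrier M \<Longrightarrow> x \<ominus>\<^bsub>M\<^esub> x = \<zero>\<^bsub>M\<^esub>"
  by (simp add: M.minus_eq M.r_neg)

lemma diff_zero_M: "x \<in> carrier M \<Longrightarrow> x \<ominus>\<^bsub>M\<^esub> \<zero>\<^bsub>M\<^esub> = x"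
  by (simp add: M.minus_eq)

lemma submodule_carrier: "submodule N R M \<Longrightarrow> x \<in> N \<Longrightarrow> x \<in> carrier M"
  using submoduleE(1) by blast

lemma submodule_zero: "submodule N R M \<Longrightarrow> \<zero>\<^bsub>M\<^esub> \<in> N"
  using subgroup.one_closed[of N "add_monoid M"] by (simp add: submodule_def)

lemma submodule_diff: "submodule N R M \<Longrightarrow> x \<in> N \<Longrightarrow> y \<in> N \<Longrightarrow> x \<ominus>\<^bsub>M\<^esub> y \<in> N"
  by (simp add: M.minus_eq submoduleE)

lemma submoduleI_add_smult:
  assumes "N \<subseteq> carrier M" "\<zero>\<^bsub>M\<^esub> \<in> N"
    "\<And>x y. x \<in> N \<Longrightarrow> y \<in> N \<Longrightarrow> x \<oplus>\<^bsub>M\<^esub> y \<in> N"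
    "\<And>a x. a \<in> carrier R \<Longrightarrow> x \<in> N \<Longrightarrow> a \<odot>\<^bsub>M\<^esub> x \<in> N"
  shows "submodule N R M"
proof (rule submoduleI)
  fix x assume x: "x \<in> N"
  then have "\<ominus>\<^bsub>M\<^esub> x = (\<ominus> \<one>) \<odot>\<^bsub>M\<^esub> x" using assms(1) by (auto simp: smult_l_minus)
  then show "\<ominus>\<^bsub>M\<^esub> x \<in> N" using assms(4)[of "\<ominus> \<one>" x] x by simp
qed (use assms in auto)

definition mlin :: "'i set \<Rightarrow> ('i \<Rightarrow> 'a) \<Rightarrow> ('i \<Rightarrow> 'c) \<Rightarrow> 'c" where
  "mlin S r b = (\<Oplus>\<^bsub>M\<^esub>k\<in>S. r k \<odot>\<^bsub>M\<^esub> b k)"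

lemma mlin_closed:
  "r \<in> S \<rightarrow> carrier R \<Longrightarrow> b \<in> S \<rightarrow> carrier M \<Longrightarrow> mlin S r b \<in> carrier M"
  unfolding mlin_def by (rule M.finsum_closed) auto

lemma mlin_empty [simp]: "mlin {} r b = \<zero>\<^bsub>M\<^esub>"
  by (simp add: mlin_def)

text \<open>Only the products have to agree, so coefficients may be changed by elements that
  annihilate the vectors. In this way cosets of \<open>I\<close> act on
  \<open>I\<close>-torsion.\<close>

lemma mlin_cong:
  assumes "\<And>k. k \<in> S \<Longrightarrow> r k \<odot>\<^bsub>M\<^esub> b k = r' k \<odot>\<^bsub>M\<^esub> b' k"
    "r' \<in> S \<rightarrow> carrier R" "b' \<in> S \<rightarrow> carrier M"
  shows "mlin S r b = mlin S r' b'"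
  unfolding mlin_def by (rule M.finsum_cong') (use assms in auto)

lemma mlin_add:
  assumes "r \<in> S \<rightarrow> carrier R" "s \<in> S \<rightarrow> carrier R" "b \<in> S \<rightarrow> carrier M"
  shows "mlin S (\<lambda>k. r k \<oplus> s k) b = mlin S r b \<oplus>\<^bsub>M\<^esub> mlin S s b"
proof -
  have "mlin S (\<lambda>k. r k \<oplus> s k) b = (\<Oplus>\<^bsub>M\<^esub>k\<in>S. r k \<odot>\<^bsub>M\<^esub> b k \<oplus>\<^bsub>M\<^esub> s k \<odot>\<^bsub>M\<^esub> b k)"
    unfolding mlin_def by (rule M.finsum_cong') (use assms in \<open>auto simp: Pi_def smult_l_distr\<close>)
  also have "\<dots> = mlin S r b \<oplus>\<^bsub>M\<^esub> mlin S s b"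
    unfolding mlin_def by (rule M.finsum_addf) (use assms in auto)
  finally show ?thesis .
qed

lemma mlin_scale:
  assumes "finite S" "e \<in> carrier R" "r \<in> S \<rightarrow> carrier R" "b \<in> S \<rightarrow> carrier M"
  shows "mlin S (\<lambda>k. e \<otimes> r k) b = e \<odot>\<^bsub>M\<^esub> mlin S r b"
proof -
  have "e \<odot>\<^bsub>M\<^esub> mlin S r b = (\<Oplus>\<^bsub>M\<^esub>k\<in>S. e \<odot>\<^bsub>M\<^esub> (r k \<odot>\<^bsub>M\<^esub> b k))"
    unfolding mlin_def by (rule finsum_smult_ldistr) (use assms in auto)
  also have "\<dots> = mlin S (\<lambda>k. e \<otimes> r k) b"
    unfolding mlin_def by (rule M.finsum_cong') (use assms in \<open>auto simp: Pi_def smult_assoc1\<close>)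
  finally show ?thesis by simp
qed

lemma mlin_diff:
  assumes "finite S" "r \<in> S \<rightarrow> carrier R" "s \<in> S \<rightarrow> carrier R" "b \<in> S \<rightarrow> carrier M"
  shows "mlin S (\<lambda>k. r k \<ominus> s k) b = mlin S r b \<ominus>\<^bsub>M\<^esub> mlin S s b"
proof -
  have "mlin S (\<lambda>k. r k \<ominus> s k) b = mlin S (\<lambda>k. r k \<oplus> \<ominus> \<one> \<otimes> s k) b"
    by (rule mlin_cong) (use assms in \<open>auto simp: Pi_iff R.minus_eq R.l_minus\<close>)
  also have "\<dots> = mlin S r b \<oplus>\<^bsub>M\<^esub> mlin S (\<lambda>k. \<ominus> \<one> \<otimes> s k) b"
    by (rule mlin_add) (use assms in auto)
  also have "mlin S (\<lambda>k. \<ominus> \<one> \<otimes> s k) b = \<ominus> \<one> \<odot>\<^bsub>M\<^esub> mlin S s b"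
    by (rule mlin_scale) (use assms in auto)
  finally show ?thesis using mlin_closed[OF assms(3,4)] by (simp add: M.minus_eq smult_l_minus)
qed

lemma mlin_mem:
  assumes N: "submodule N R M" and "finite S" "\<And>k. k \<in> S \<Longrightarrow> r k \<odot>\<^bsub>M\<^esub> b k \<in> N"
  shows "mlin S r b \<in> N"
  using assms(2,3) unfolding mlin_def
proof (induction S)
  case (insert k S)
  then have "(\<Oplus>\<^bsub>M\<^esub>k\<in>insert k S. r k \<odot>\<^bsub>M\<^esub> b k) = r k \<odot>\<^bsub>M\<^esub> b k \<oplus>\<^bsub>M\<^esub> (\<Oplus>\<^bsub>M\<^esub>k\<in>S. r k \<odot>\<^bsub>M\<^esub> b k)"
    using submodule_carrier[OF N] by (intro M.finsum_insert) auto
  then show ?case using insert submoduleE(5)[OF N] by simp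
qed (simp add: submodule_zero[OF N])

lemma mlin_unit:
  assumes "finite S" "k \<in> S" "b \<in> S \<rightarrow> carrier M"
  shows "mlin S (\<lambda>l. if l = k then \<one> else \<zero>) b = b k"
proof -
  have "mlin S (\<lambda>l. if l = k then \<one> else \<zero>) b = (\<Oplus>\<^bsub>M\<^esub>l\<in>S. if k = l then b l else \<zero>\<^bsub>M\<^esub>)"
    unfolding mlin_def by (rule M.finsum_cong') (use assms in \<open>auto simp: Pi_iff\<close>)
  also have "\<dots> = b k" by (rule M.finsum_singleton) (use assms in auto)
  finally show ?thesis .
qed

lemma mlin_zero:
  assumes "finite S" "\<And>k. k \<in> S \<Longrightarrow> r k \<odot>\<^bsub>M\<^esub> b k = \<zero>\<^bsub>M\<^esub>"
  shows "mlin S r b = \<zero>\<^bsub>M\<^esub>"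
  unfolding mlin_def by (rule M.add.finprod_one_eqI) (use assms in simp)

lemma mlin_reindex:
  assumes "inj_on h A" "r \<in> h ` A \<rightarrow> carrier R" "b \<in> h ` A \<rightarrow> carrier M"
  shows "mlin (h ` A) r b = mlin A (\<lambda>k. r (h k)) (\<lambda>k. b (h k))"
  unfolding mlin_def by (rule M.add.finprod_reindex) (use assms in \<open>auto simp: Pi_iff\<close>)

lemma mlin_superset_zero:
  assumes "finite T" "S \<subseteq> T" "r \<in> T \<rightarrow> carrier R" "b \<in> T \<rightarrow> carrier M"
    and "\<And>k. k \<in> T - S \<Longrightarrow> r k \<odot>\<^bsub>M\<^esub> b k = \<zero>\<^bsub>M\<^esub>"
  shows "mlin T r b = mlin S r b"
  unfolding mlin_def
  by (rule M.add.finprod_mono_neutral_cong_right) (use assms in \<open>auto simp: Pi_iff\<close>)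

text \<open>Connects relations among the elements \<open>y k\<close> of the ring with relations
  among the multiples \<open>y k x\<close> of a single vector.\<close>

lemma mlin_smult_right:
  assumes "finite S" "r \<in> S \<rightarrow> carrier R" "y \<in> S \<rightarrow> carrier R" "x \<in> carrier M"
  shows "mlin S r (\<lambda>k. y k \<odot>\<^bsub>M\<^esub> x) = lincomb S r y \<odot>\<^bsub>M\<^esub> x"
  using assms
proof (induction S)
  case (insert k S)
  have "mlin (insert k S) r (\<lambda>k. y k \<odot>\<^bsub>M\<^esub> x) = r k \<odot>\<^bsub>M\<^esub> (y k \<odot>\<^bsub>M\<^esub> x) \<oplus>\<^bsub>M\<^esub> mlin S r (\<lambda>k. y k \<odot>\<^bsub>M\<^esub> x)"
    unfolding mlin_def by (rule M.finsum_insert) (use insert in \<open>auto simp: Pi_iff\<close>)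
  then show ?case
    using insert lincomb_insert[of S k r y] lincomb_closed[of r S y]
    by (simp add: Pi_iff smult_l_distr smult_assoc1)
qed (simp add: lincomb_def)

end

lemma (in cring) regular_module_module: "module R (regular_module R)"
proof (rule moduleI[OF is_cring])
  show "abelian_group (regular_module R)"
    by (rule abelian_groupI) (auto simp: a_ac intro: bexI[of _ "\<ominus> _"] l_neg)
qed (auto simp: l_distr r_distr m_assoc)

section \<open>Torsion subcomplexes of a complex of injective modules\<close>

text \<open>Baer's condition: extend \<open>g\<close> from the ideal to the whole ring and evaluate
  the extension at 1.\<close>

lemma (in cring) injective_moduleD:
  assumes E: "injective_module R M" and K: "ideal K R"
    and g: "g \<in> K \<rightarrow> carrier M" "\<And>a b. a \<in> K \<Longrightarrow> b \<in> K \<Longrightarrow> g (a \<oplus> b) = g a \<oplus>\<^bsub>M\<^esub> g b"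
      "\<And>r a. r \<in> carrier R \<Longrightarrow> a \<in> K \<Longrightarrow> g (r \<otimes> a) = r \<odot>\<^bsub>M\<^esub> g a"
  shows "\<exists>x\<in>carrier M. \<forall>a\<in>K. a \<odot>\<^bsub>M\<^esub> x = g a"
proof -
  interpret B: module R "regular_module R" by (rule regular_module_module)
  let ?A = "(regular_module R)\<lparr>carrier := K\<rparr>"
  have Kc: "K \<subseteq> carrier R" using K ideal_subset_carrier by blast
  have "submodule K R (regular_module R)"
    by (rule B.submoduleI_add_smult) (use K Kc ideal_mem in auto)
  then have A: "module R ?A" using submodule.submodule_is_module B.module_axioms by blast
  have j: "(\<lambda>x. x) \<in> module_hom R ?A (regular_module R)" using Kc by (auto simp: module_hom_def)
  have g': "g \<in> module_hom R ?A M" using g by (auto simp: module_hom_def)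
  have "\<exists>h\<in>module_hom R (regular_module R) M. \<forall>x\<in>carrier ?A. h x = g x"
    using E[unfolded injective_module_def, THEN conjunct2, rule_format, of ?A "regular_module R" "\<lambda>x. x" g]
      A B.module_axioms j g' by auto
  then obtain h where h: "h \<in> module_hom R (regular_module R) M" "\<And>x. x \<in> K \<Longrightarrow> h x = g x"
    by auto
  have "a \<odot>\<^bsub>M\<^esub> h \<one> = g a" if "a \<in> K" for a
  proof -
    have ac: "a \<in> carrier R" using that Kc by blast
    then have "h (a \<otimes> \<one>) = a \<odot>\<^bsub>M\<^esub> h \<one>" using h(1) one_closed by (simp add: module_hom_def del: r_one)
    moreover have "a \<otimes> \<one> = a" using ac by simp
    ultimately show ?thesis using h(2)[OF that] by simp
  qed
  moreover have "h \<one> \<in> carrier M" using h(1) by (auto simp: module_hom_def)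
  ultimately show ?thesis by blast
qed

locale injective_complex = cring R for R (structure) +
  fixes E :: "('a, 'e) cochain"
  assumes cochain: "cochain_complex R E"
    and injective: "\<And>i. injective_module R (obj E i)"
begin

abbreviation \<E> :: "int \<Rightarrow> ('a, 'e) module" where "\<E> i \<equiv> obj E i"
abbreviation \<delta> :: "int \<Rightarrow> 'e \<Rightarrow> 'e" where "\<delta> i \<equiv> diff E i"

end

sublocale injective_complex \<subseteq> M: module R "obj E i" for i
  using cochain by (simp add: cochain_complex_def)

context injective_complex
begin

lemma diff_closed: "x \<in> carrier (\<E> i) \<Longrightarrow> \<delta> i x \<in> carrier (\<E> (i + 1))"
  using cochain by (auto simp: cochain_complex_def module_hom_def)

lemma diff_add:
  "x \<in> carrier (\<E> i) \<Longrightarrow> y \<in> carrier (\<E> i) \<Longrightarrow>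
    \<delta> i (x \<oplus>\<^bsub>\<E> i\<^esub> y) = \<delta> i x \<oplus>\<^bsub>\<E> (i + 1)\<^esub> \<delta> i y"
  using cochain by (auto simp: cochain_complex_def module_hom_def)

lemma diff_smult:
  "a \<in> carrier R \<Longrightarrow> x \<in> carrier (\<E> i) \<Longrightarrow> \<delta> i (a \<odot>\<^bsub>\<E> i\<^esub> x) = a \<odot>\<^bsub>\<E> (i + 1)\<^esub> \<delta> i x"
  using cochain by (auto simp: cochain_complex_def module_hom_def)

lemma diff_diff: "x \<in> carrier (\<E> i) \<Longrightarrow> \<delta> (i + 1) (\<delta> i x) = \<zero>\<^bsub>\<E> (i + 1 + 1)\<^esub>"
proof -
  assume "x \<in> carrier (\<E> i)"
  moreover have "i + 1 + 1 = i + 2" by simp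
  ultimately show ?thesis using cochain unfolding cochain_complex_def by metis
qed

lemma diff_zero: "\<delta> i \<zero>\<^bsub>\<E> i\<^esub> = \<zero>\<^bsub>\<E> (i + 1)\<^esub>"
proof -
  have "\<delta> i (\<zero> \<odot>\<^bsub>\<E> i\<^esub> \<zero>\<^bsub>\<E> i\<^esub>) = \<zero> \<odot>\<^bsub>\<E> (i + 1)\<^esub> \<delta> i \<zero>\<^bsub>\<E> i\<^esub>"
    by (rule diff_smult) auto
  then show ?thesis using diff_closed[OF M.zero_closed, of i] by simp
qed

lemma diff_minus:
  assumes "x \<in> carrier (\<E> i)" "y \<in> carrier (\<E> i)"
  shows "\<delta> i (x \<ominus>\<^bsub>\<E> i\<^esub> y) = \<delta> i x \<ominus>\<^bsub>\<E> (i + 1)\<^esub> \<delta> i y"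
proof -
  have "\<ominus>\<^bsub>\<E> i\<^esub> y = (\<ominus> \<one>) \<odot>\<^bsub>\<E> i\<^esub> y" using assms by (simp add: M.smult_l_minus)
  then have "\<delta> i (\<ominus>\<^bsub>\<E> i\<^esub> y) = (\<ominus> \<one>) \<odot>\<^bsub>\<E> (i + 1)\<^esub> \<delta> i y" using diff_smult assms by simp
  also have "\<dots> = \<ominus>\<^bsub>\<E> (i + 1)\<^esub> \<delta> i y"
    using diff_closed[OF assms(2)] by (simp add: M.smult_l_minus)
  finally show ?thesis using assms by (simp add: M.minus_eq diff_add)
qed

lemma diff_mlin:
  assumes "finite S" "r \<in> S \<rightarrow> carrier R" "b \<in> S \<rightarrow> carrier (\<E> i)"
  shows "\<delta> i (M.mlin i S r b) = M.mlin (i + 1) S r (\<lambda>k. \<delta> i (b k))"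
  using assms
proof (induction S)
  case (insert k S)
  have "M.mlin i (insert k S) r b = r k \<odot>\<^bsub>\<E> i\<^esub> b k \<oplus>\<^bsub>\<E> i\<^esub> M.mlin i S r b"
    unfolding M.mlin_def by (rule M.finsum_insert) (use insert in \<open>auto simp: Pi_iff\<close>)
  moreover have "M.mlin (i + 1) (insert k S) r (\<lambda>k. \<delta> i (b k)) =
      r k \<odot>\<^bsub>\<E> (i + 1)\<^esub> \<delta> i (b k) \<oplus>\<^bsub>\<E> (i + 1)\<^esub> M.mlin (i + 1) S r (\<lambda>k. \<delta> i (b k))"
    unfolding M.mlin_def
    by (rule M.finsum_insert) (use insert diff_closed in \<open>auto simp: Pi_iff\<close>)
  moreover have "M.mlin i S r b \<in> carrier (\<E> i)" by (rule M.mlin_closed) (use insert in auto)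
  ultimately show ?case using insert by (simp add: Pi_iff diff_add diff_smult)
qed (simp add: diff_zero)

text \<open>\<open>tors J i = Hom(R/J, E\<^sup>i)\<close>, with its cocycles and coboundaries.\<close>

definition tors :: "'a set \<Rightarrow> int \<Rightarrow> 'e set" where
  "tors J i = {x \<in> carrier (\<E> i). \<forall>a\<in>J. a \<odot>\<^bsub>\<E> i\<^esub> x = \<zero>\<^bsub>\<E> i\<^esub>}"

definition tcyc :: "'a set \<Rightarrow> int \<Rightarrow> 'e set" where
  "tcyc J i = {x \<in> tors J i. \<delta> i x = \<zero>\<^bsub>\<E> (i + 1)\<^esub>}"

definition tbd :: "'a set \<Rightarrow> int \<Rightarrow> 'e set" where
  "tbd J i = \<delta> (i - 1) ` tors J (i - 1)"

lemma tors_carrier: "x \<in> tors J i \<Longrightarrow> x \<in> carrier (\<E> i)"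
  by (simp add: tors_def)

lemma tors_smult_zero: "x \<in> tors J i \<Longrightarrow> a \<in> J \<Longrightarrow> a \<odot>\<^bsub>\<E> i\<^esub> x = \<zero>\<^bsub>\<E> i\<^esub>"
  by (simp add: tors_def)

lemma tcyc_tors: "x \<in> tcyc J i \<Longrightarrow> x \<in> tors J i"
  by (simp add: tcyc_def)

lemma tcyc_diff: "x \<in> tcyc J i \<Longrightarrow> \<delta> i x = \<zero>\<^bsub>\<E> (i + 1)\<^esub>"
  by (simp add: tcyc_def)

lemma tcyc_carrier: "x \<in> tcyc J i \<Longrightarrow> x \<in> carrier (\<E> i)"
  by (simp add: tcyc_def tors_def)

lemma tors_mono: "J \<subseteq> K \<Longrightarrow> tors K i \<subseteq> tors J i"
  by (auto simp: tors_def)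

lemma tcyc_mono: "J \<subseteq> K \<Longrightarrow> tcyc K i \<subseteq> tcyc J i"
  using tors_mono[of J K i] by (auto simp: tcyc_def)

lemma tbd_mono: "J \<subseteq> K \<Longrightarrow> tbd K i \<subseteq> tbd J i"
  using tors_mono[of J K "i - 1"] by (auto simp: tbd_def)

lemma tors_submodule:
  assumes "J \<subseteq> carrier R"
  shows "submodule (tors J i) R (\<E> i)"
proof (rule M.submoduleI_add_smult)
  show "a \<odot>\<^bsub>\<E> i\<^esub> x \<in> tors J i" if a: "a \<in> carrier R" and x: "x \<in> tors J i" for a x
  proof -
    have "c \<odot>\<^bsub>\<E> i\<^esub> (a \<odot>\<^bsub>\<E> i\<^esub> x) = \<zero>\<^bsub>\<E> i\<^esub>" if c: "c \<in> J" for c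
    proof -
      have cc: "c \<in> carrier R" using c assms by blast
      have "c \<odot>\<^bsub>\<E> i\<^esub> (a \<odot>\<^bsub>\<E> i\<^esub> x) = a \<odot>\<^bsub>\<E> i\<^esub> (c \<odot>\<^bsub>\<E> i\<^esub> x)"
        using a cc tors_carrier[OF x] by (metis M.smult_assoc1 m_comm)
      then show ?thesis using tors_smult_zero[OF x c] a by simp
    qed
    then show ?thesis using a tors_carrier[OF x] by (simp add: tors_def)
  qed
qed (use assms in \<open>auto simp: tors_def subset_iff M.smult_r_distr\<close>)

lemma tcyc_submodule:
  assumes "J \<subseteq> carrier R"
  shows "submodule (tcyc J i) R (\<E> i)"
proof -
  note T = tors_submodule[OF assms, of i]
  show ?thesis
  proof (rule M.submoduleI_add_smult)
    show "\<zero>\<^bsub>\<E> i\<^esub> \<in> tcyc J i" using M.submodule_zero[OF T] diff_zero by (simp add: tcyc_def)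
    show "x \<oplus>\<^bsub>\<E> i\<^esub> y \<in> tcyc J i" if "x \<in> tcyc J i" "y \<in> tcyc J i" for x y
      using that M.submoduleE(5)[OF T] by (auto simp: tcyc_def diff_add tors_carrier)
    show "a \<odot>\<^bsub>\<E> i\<^esub> x \<in> tcyc J i" if "a \<in> carrier R" "x \<in> tcyc J i" for a x
      using that M.submoduleE(4)[OF T] by (auto simp: tcyc_def diff_smult tors_carrier)
  qed (auto simp: tcyc_def tors_def)
qed

lemma diff_tors:
  assumes "J \<subseteq> carrier R" "x \<in> tors J i"
  shows "\<delta> i x \<in> tors J (i + 1)"
proof -
  have "a \<odot>\<^bsub>\<E> (i + 1)\<^esub> \<delta> i x = \<zero>\<^bsub>\<E> (i + 1)\<^esub>" if "a \<in> J" for a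
    using diff_smult[of a x i] that assms tors_carrier[OF assms(2)] tors_smult_zero[OF assms(2) that]
      diff_zero by auto
  then show ?thesis using diff_closed[OF tors_carrier[OF assms(2)]] by (simp add: tors_def)
qed

lemma diff_tcyc:
  assumes "J \<subseteq> carrier R" "x \<in> tors J i"
  shows "\<delta> i x \<in> tcyc J (i + 1)"
  using diff_tors[OF assms] diff_diff[OF tors_carrier[OF assms(2)]] by (simp add: tcyc_def)

lemma diff_tbd: "x \<in> tors J i \<Longrightarrow> \<delta> i x \<in> tbd J (i + 1)"
  by (simp add: tbd_def)

lemma tbdE:
  assumes "z \<in> tbd J i"
  obtains c where "c \<in> tors J (i - 1)" "z = \<delta> (i - 1) c"
  using assms by (auto simp: tbd_def)

lemma tbdE_Suc:
  assumes "z \<in> tbd J (i + 1)"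
  obtains c where "c \<in> tors J i" "z = \<delta> i c"
  using assms by (auto simp: tbd_def)

lemma tbd_tcyc:
  assumes "J \<subseteq> carrier R"
  shows "tbd J i \<subseteq> tcyc J i"
  using diff_tcyc[OF assms, of _ "i - 1"] by (auto simp: tbd_def)

lemma tbd_submodule:
  assumes "J \<subseteq> carrier R"
  shows "submodule (tbd J i) R (\<E> i)"
proof (rule M.submoduleI_add_smult)
  note T = tors_submodule[OF assms, of "i - 1"]
  show "tbd J i \<subseteq> carrier (\<E> i)" using tbd_tcyc[OF assms] tcyc_carrier by blast
  show "\<zero>\<^bsub>\<E> i\<^esub> \<in> tbd J i"
    using diff_tbd[OF M.submodule_zero[OF T]] diff_zero[of "i - 1"] by simp
  show "x \<oplus>\<^bsub>\<E> i\<^esub> y \<in> tbd J i" if xy: "x \<in> tbd J i" "y \<in> tbd J i" for x y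
  proof -
    obtain c c' where c: "c \<in> tors J (i - 1)" "x = \<delta> (i - 1) c"
      "c' \<in> tors J (i - 1)" "y = \<delta> (i - 1) c'" using xy by (metis tbdE)
    then show ?thesis
      using diff_tbd[OF M.submoduleE(5)[OF T c(1,3)]] diff_add[of c "i - 1" c'] tors_carrier by simp
  qed
  show "a \<odot>\<^bsub>\<E> i\<^esub> x \<in> tbd J i" if ax: "a \<in> carrier R" "x \<in> tbd J i" for a x
  proof -
    obtain c where c: "c \<in> tors J (i - 1)" "x = \<delta> (i - 1) c" using ax by (metis tbdE)
    then show ?thesis
      using diff_tbd[OF M.submoduleE(4)[OF T ax(1) c(1)]] diff_smult[of a c "i - 1"] ax tors_carrier
      by simp
  qed
qed

text \<open>A simultaneous version of Baer's condition: the map \<open>J + (y\<^sub>k) \<rightarrow> E\<^sup>i\<close> that kills \<open>J\<close> and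
  sends \<open>y\<^sub>k\<close> to \<open>z\<^sub>k\<close> is well defined, and extends to \<open>R\<close>.\<close>

lemma tors_solve:
  assumes J: "ideal J R" and S: "finite S" and y: "y \<in> S \<rightarrow> carrier R"
    and indep: "\<And>r k. r \<in> S \<rightarrow> carrier R \<Longrightarrow> lincomb S r y \<in> J \<Longrightarrow> k \<in> S \<Longrightarrow> r k \<in> J'"
    and z: "\<And>k. k \<in> S \<Longrightarrow> z k \<in> tors J' i"
  shows "\<exists>x\<in>tors J i. \<forall>k\<in>S. y k \<odot>\<^bsub>\<E> i\<^esub> x = z k"
proof -
  have zc: "z \<in> S \<rightarrow> carrier (\<E> i)" using z tors_carrier by auto
  \<comment> \<open>\<open>r\<close> is a coordinate vector of \<open>a\<close> modulo
    \<open>J\<close>; the map \<open>g\<close> replaces each \<open>y k\<close> by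
    \<open>z k\<close> for some choice of coordinates.\<close>
  define P where "P a r \<longleftrightarrow> r \<in> S \<rightarrow> carrier R \<and> a \<ominus> lincomb S r y \<in> J" for a r
  define K where "K = {a \<in> carrier R. \<exists>r. P a r}"
  define g where "g a = M.mlin i S (SOME r. P a r) z" for a
  have Padd: "P (a \<oplus> b) (\<lambda>k. r k \<oplus> s k)" if "P a r" "P b s" "a \<in> carrier R" "b \<in> carrier R" for a b r s
  proof -
    have rs: "r \<in> S \<rightarrow> carrier R" "s \<in> S \<rightarrow> carrier R" using that by (auto simp: P_def)
    have "a \<oplus> b \<ominus> lincomb S (\<lambda>k. r k \<oplus> s k) y = (a \<ominus> lincomb S r y) \<oplus> (b \<ominus> lincomb S s y)"
      unfolding lincomb_add[OF rs y]
      using that(3,4) lincomb_closed[OF rs(1) y] lincomb_closed[OF rs(2) y] by algebra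
    then show ?thesis using that rs ideal_add_mem[OF J] by (auto simp: P_def)
  qed
  have Pmult: "P (e \<otimes> a) (\<lambda>k. e \<otimes> r k)" if "P a r" "a \<in> carrier R" "e \<in> carrier R" for a e r
  proof -
    have r: "r \<in> S \<rightarrow> carrier R" using that by (auto simp: P_def)
    have "e \<otimes> a \<ominus> lincomb S (\<lambda>k. e \<otimes> r k) y = e \<otimes> (a \<ominus> lincomb S r y)"
      unfolding lincomb_scale[OF S that(3) r y]
      using that(2,3) lincomb_closed[OF r y] by algebra
    then show ?thesis using that r ideal_lmult_mem[OF J] by (auto simp: P_def)
  qed
  \<comment> \<open>Independence of the choice: two coordinate vectors of \<open>a\<close> differ by
    elements of \<open>J'\<close>, and these kill every \<open>z k\<close>.\<close>
  have g: "g a = M.mlin i S r z" if Pr: "P a r" and a: "a \<in> carrier R" for a r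
  proof -
    define s where "s = (SOME r. P a r)"
    have s: "P a s" unfolding s_def by (rule someI[of "P a", OF Pr])
    have rs: "r \<in> S \<rightarrow> carrier R" "s \<in> S \<rightarrow> carrier R" using Pr s by (auto simp: P_def)
    have ms: "(\<lambda>k. \<ominus> \<one> \<otimes> s k) \<in> S \<rightarrow> carrier R" using rs(2) by auto
    have "lincomb S (\<lambda>k. r k \<oplus> \<ominus> \<one> \<otimes> s k) y = lincomb S r y \<oplus> \<ominus> \<one> \<otimes> lincomb S s y"
      unfolding lincomb_add[OF rs(1) ms y] by (subst lincomb_scale[OF S _ rs(2) y]) auto
    also have "\<dots> = (a \<ominus> lincomb S s y) \<ominus> (a \<ominus> lincomb S r y)"
      using a lincomb_closed[OF rs(1) y] lincomb_closed[OF rs(2) y] by algebra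
    also have "\<dots> \<in> J" using ideal_diff_mem[OF J] Pr s by (auto simp: P_def)
    finally have mem: "r k \<oplus> \<ominus> \<one> \<otimes> s k \<in> J'" if "k \<in> S" for k
      using indep[of "\<lambda>k. r k \<oplus> \<ominus> \<one> \<otimes> s k"] that rs by (auto simp: Pi_iff)
    have "M.mlin i S s z = M.mlin i S r z"
    proof (rule M.mlin_cong)
      fix k assume k: "k \<in> S"
      have c: "r k \<in> carrier R" "s k \<in> carrier R" using rs k by auto
      have zk: "z k \<in> carrier (\<E> i)" using zc k by auto
      have "r k = (r k \<oplus> \<ominus> \<one> \<otimes> s k) \<oplus> s k" using c by algebra
      then have "r k \<odot>\<^bsub>\<E> i\<^esub> z k = (r k \<oplus> \<ominus> \<one> \<otimes> s k) \<odot>\<^bsub>\<E> i\<^esub> z k \<oplus>\<^bsub>\<E> i\<^esub> s k \<odot>\<^bsub>\<E> i\<^esub> z k"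
        using c zk M.smult_l_distr[of "r k \<oplus> \<ominus> \<one> \<otimes> s k" "s k" "z k"] by simp
      then show "s k \<odot>\<^bsub>\<E> i\<^esub> z k = r k \<odot>\<^bsub>\<E> i\<^esub> z k"
        using tors_smult_zero[OF z[OF k] mem[OF k]] c zk by simp
    qed (use rs zc in auto)
    then show ?thesis by (simp add: g_def s_def)
  qed
  have PJ: "P a (\<lambda>k. \<zero>)" if "a \<in> J" for a
  proof -
    have "lincomb S (\<lambda>k. \<zero>) y = \<zero>"
      using lincomb_mem[OF zeroideal S, of "\<lambda>k. \<zero>" y] y by (auto simp: Pi_iff)
    then show ?thesis using that J ideal_memD by (auto simp: P_def minus_eq)
  qed
  have Py: "P (y k) (\<lambda>l. if l = k then \<one> else \<zero>)" if k: "k \<in> S" for k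
    using lincomb_unit[OF S k y] y k ideal_zero_mem[OF J] by (auto simp: P_def minus_eq r_neg Pi_iff)
  have JK: "J \<subseteq> K" using PJ J ideal_memD by (auto simp: K_def)
  have K: "ideal K R"
  proof (rule idealI_comm)
    show "K \<subseteq> carrier R" by (auto simp: K_def)
    show "\<zero> \<in> K" using JK ideal_zero_mem[OF J] by blast
    show "a \<oplus> b \<in> K" if "a \<in> K" "b \<in> K" for a b using that Padd by (force simp: K_def)
    show "e \<otimes> a \<in> K" if "e \<in> carrier R" "a \<in> K" for a e using that Pmult by (force simp: K_def)
  qed
  have "\<exists>x\<in>carrier (\<E> i). \<forall>a\<in>K. a \<odot>\<^bsub>\<E> i\<^esub> x = g a"
  proof (rule injective_moduleD[OF injective K])
    show "g \<in> K \<rightarrow> carrier (\<E> i)"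
    proof
      fix a assume "a \<in> K"
      then obtain r where r: "P a r" "a \<in> carrier R" by (auto simp: K_def)
      then have "r \<in> S \<rightarrow> carrier R" by (simp add: P_def)
      then show "g a \<in> carrier (\<E> i)" unfolding g[OF r] using zc by (rule M.mlin_closed)
    qed
    fix a assume "a \<in> K"
    then obtain r where r: "P a r" "a \<in> carrier R" by (auto simp: K_def)
    then have rS: "r \<in> S \<rightarrow> carrier R" by (simp add: P_def)
    show "g (e \<otimes> a) = e \<odot>\<^bsub>\<E> i\<^esub> g a" if e: "e \<in> carrier R" for e
      unfolding g[OF r] g[OF Pmult[OF r e] m_closed[OF e r(2)]] by (rule M.mlin_scale[OF S e rS zc])
    fix b assume "b \<in> K"
    then obtain s where s: "P b s" "b \<in> carrier R" by (auto simp: K_def)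
    then have sS: "s \<in> S \<rightarrow> carrier R" by (simp add: P_def)
    show "g (a \<oplus> b) = g a \<oplus>\<^bsub>\<E> i\<^esub> g b"
      unfolding g[OF r] g[OF s] g[OF Padd[OF r(1) s(1) r(2) s(2)] a_closed[OF r(2) s(2)]]
      by (rule M.mlin_add[OF rS sS zc])
  qed
  then obtain x where x: "x \<in> carrier (\<E> i)" "\<And>a. a \<in> K \<Longrightarrow> a \<odot>\<^bsub>\<E> i\<^esub> x = g a" by blast
  have "a \<odot>\<^bsub>\<E> i\<^esub> x = \<zero>\<^bsub>\<E> i\<^esub>" if "a \<in> J" for a
  proof -
    have ac: "a \<in> carrier R" using that J ideal_memD by blast
    have "g a = \<zero>\<^bsub>\<E> i\<^esub>" unfolding g[OF PJ[OF that] ac]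
      by (rule M.mlin_zero[OF S]) (use tors_carrier[OF z] in simp)
    then show ?thesis using x(2) JK that by auto
  qed
  moreover have "y k \<odot>\<^bsub>\<E> i\<^esub> x = z k" if k: "k \<in> S" for k
  proof -
    have yk: "y k \<in> carrier R" using y k by auto
    have "y k \<in> K" using Py[OF k] yk by (auto simp: K_def)
    moreover have "g (y k) = z k" unfolding g[OF Py[OF k] yk] by (rule M.mlin_unit[OF S k zc])
    ultimately show ?thesis using x(2) by simp
  qed
  ultimately show ?thesis using x(1) by (auto simp: tors_def)
qed

end

text \<open>The exact sequence \<open>0 \<rightarrow> Hom(R/J\<^sub>1, E) \<rightarrow> Hom(R/J, E) \<rightarrow> Hom(R/J', E)\<^sup>S \<rightarrow> 0\<close> of complexes,
  where \<open>J\<^sub>1 = J + (y\<^sub>k)\<close> and \<open>J\<^sub>1/J\<close> is free over \<open>R/J'\<close> on the \<open>y\<^sub>k\<close>.\<close>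

locale torsion_sequence = injective_complex R E for R (structure) and E :: "('a, 'e) cochain" +
  fixes J J' J1 :: "'a set" and S :: "'i set" and y :: "'i \<Rightarrow> 'a"
  assumes ideals: "ideal J R" "ideal J' R" "ideal J1 R"
    and finite_S: "finite S" and y_mem: "y \<in> S \<rightarrow> J1" and J_sub: "J \<subseteq> J1"
    and y_indep: "\<And>r k. r \<in> S \<rightarrow> carrier R \<Longrightarrow> lincomb S r y \<in> J \<Longrightarrow> k \<in> S \<Longrightarrow> r k \<in> J'"
    and y_gen: "\<And>a. a \<in> J1 \<Longrightarrow> \<exists>q\<in>J. \<exists>r\<in>S \<rightarrow> carrier R. a = q \<oplus> lincomb S r y"
    and y_mult: "\<And>a k. a \<in> J' \<Longrightarrow> k \<in> S \<Longrightarrow> a \<otimes> y k \<in> J"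
begin

lemma ideals_carrier: "J \<subseteq> carrier R" "J' \<subseteq> carrier R" "J1 \<subseteq> carrier R"
  using ideals ideal_subset_carrier by auto

lemma y_carrier: "y \<in> S \<rightarrow> carrier R"
  using y_mem ideals_carrier(3) by auto

lemma y_mem_carrier: "k \<in> S \<Longrightarrow> y k \<in> carrier R"
  using y_carrier by auto

lemma tors_J1_sub: "x \<in> tors J1 i \<Longrightarrow> x \<in> tors J i"
  using tors_mono[OF J_sub] by blast

lemma tcyc_J1_sub: "x \<in> tcyc J1 i \<Longrightarrow> x \<in> tcyc J i"
  using tcyc_mono[OF J_sub] by blast

lemma y_kills: "x \<in> tors J1 i \<Longrightarrow> k \<in> S \<Longrightarrow> y k \<odot>\<^bsub>\<E> i\<^esub> x = \<zero>\<^bsub>\<E> i\<^esub>"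
  using y_mem by (intro tors_smult_zero) auto

lemma tors_J1_I:
  assumes w: "w \<in> tors J i" and yw: "\<And>k. k \<in> S \<Longrightarrow> y k \<odot>\<^bsub>\<E> i\<^esub> w = \<zero>\<^bsub>\<E> i\<^esub>"
  shows "w \<in> tors J1 i"
proof -
  have wc: "w \<in> carrier (\<E> i)" using w tors_carrier by blast
  have "a \<odot>\<^bsub>\<E> i\<^esub> w = \<zero>\<^bsub>\<E> i\<^esub>" if a: "a \<in> J1" for a
  proof -
    obtain q r where qr: "q \<in> J" "r \<in> S \<rightarrow> carrier R" "a = q \<oplus> lincomb S r y"
      using y_gen[OF a] by blast
    have qc: "q \<in> carrier R" using qr ideals_carrier by blast
    have "lincomb S r y \<odot>\<^bsub>\<E> i\<^esub> w = M.mlin i S r (\<lambda>k. y k \<odot>\<^bsub>\<E> i\<^esub> w)"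
      using M.mlin_smult_right[OF finite_S qr(2) y_carrier wc] by simp
    also have "\<dots> = \<zero>\<^bsub>\<E> i\<^esub>" by (rule M.mlin_zero[OF finite_S]) (use yw qr(2) in \<open>auto simp: Pi_iff\<close>)
    finally show ?thesis
      unfolding qr(3) using M.smult_l_distr[OF qc lincomb_closed[OF qr(2) y_carrier] wc]
        tors_smult_zero[OF w qr(1)] by simp
  qed
  then show ?thesis using wc by (simp add: tors_def)
qed

lemma y_tors:
  assumes "w \<in> tors J i" "k \<in> S"
  shows "y k \<odot>\<^bsub>\<E> i\<^esub> w \<in> tors J' i"
proof -
  have "a \<odot>\<^bsub>\<E> i\<^esub> (y k \<odot>\<^bsub>\<E> i\<^esub> w) = \<zero>\<^bsub>\<E> i\<^esub>" if "a \<in> J'" for a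
    using M.smult_assoc1[of a "y k" w i] that assms y_mem_carrier tors_carrier[OF assms(1)]
      ideals_carrier(2) tors_smult_zero[OF assms(1) y_mult[OF that assms(2)]] by auto
  then show ?thesis using assms y_mem_carrier tors_carrier[OF assms(1)] by (simp add: tors_def)
qed

lemma y_tcyc:
  assumes "w \<in> tcyc J i" "k \<in> S"
  shows "y k \<odot>\<^bsub>\<E> i\<^esub> w \<in> tcyc J' i"
  using y_tors[OF tcyc_tors[OF assms(1)] assms(2)] tcyc_diff[OF assms(1)] tcyc_carrier[OF assms(1)]
    y_mem_carrier[OF assms(2)] by (simp add: tcyc_def diff_smult)

lemma y_tbd:
  assumes "w \<in> tbd J i" "k \<in> S"
  shows "y k \<odot>\<^bsub>\<E> i\<^esub> w \<in> tbd J' i"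
proof -
  obtain c where c: "c \<in> tors J (i - 1)" "w = \<delta> (i - 1) c" using assms(1) by (rule tbdE)
  have "\<delta> (i - 1) (y k \<odot>\<^bsub>\<E> (i - 1)\<^esub> c) = y k \<odot>\<^bsub>\<E> i\<^esub> w"
    using diff_smult[OF y_mem_carrier[OF assms(2)] tors_carrier[OF c(1)]] c(2) by simp
  then show ?thesis using diff_tbd[OF y_tors[OF c(1) assms(2)]] by simp
qed

lemma solve: "(\<And>k. k \<in> S \<Longrightarrow> z k \<in> tors J' i) \<Longrightarrow> \<exists>x\<in>tors J i. \<forall>k\<in>S. y k \<odot>\<^bsub>\<E> i\<^esub> x = z k"
  by (rule tors_solve[OF ideals(1) finite_S y_carrier, where J' = J']) (use y_indep in auto)

text \<open>The connecting homomorphism is well defined on cohomology.\<close>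

lemma lift_boundary:
  assumes w: "w \<in> tors J i" and yw: "\<And>k. k \<in> S \<Longrightarrow> y k \<odot>\<^bsub>\<E> i\<^esub> w \<in> tbd J' i"
  shows "\<delta> i w \<in> tbd J1 (i + 1)"
proof -
  have "\<forall>k\<in>S. \<exists>c. c \<in> tors J' (i - 1) \<and> y k \<odot>\<^bsub>\<E> i\<^esub> w = \<delta> (i - 1) c"
    using yw by (auto simp: tbd_def)
  then obtain c where c: "\<And>k. k \<in> S \<Longrightarrow> c k \<in> tors J' (i - 1) \<and> y k \<odot>\<^bsub>\<E> i\<^esub> w = \<delta> (i - 1) (c k)"
    by metis
  \<comment> \<open>The primitives \<open>c k\<close> are lifted simultaneously. Then
    \<open>w\<close> minus the differential of \<open>u\<close> is killed by all \<open>y k\<close>,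
    hence is \<open>J1\<close>-torsion, and has the same differential as \<open>w\<close>.\<close>
  obtain u where u: "u \<in> tors J (i - 1)" "\<And>k. k \<in> S \<Longrightarrow> y k \<odot>\<^bsub>\<E> (i - 1)\<^esub> u = c k"
    using solve[of c "i - 1"] c by blast
  define v where "v = \<delta> (i - 1) u"
  have v: "v \<in> tors J i" using diff_tors[OF ideals_carrier(1) u(1)] by (simp add: v_def)
  have wc: "w \<in> carrier (\<E> i)" and vc: "v \<in> carrier (\<E> i)" using w v tors_carrier by auto
  have "y k \<odot>\<^bsub>\<E> i\<^esub> (w \<ominus>\<^bsub>\<E> i\<^esub> v) = \<zero>\<^bsub>\<E> i\<^esub>" if k: "k \<in> S" for k
  proof -
    have "\<delta> (i - 1) (c k) = y k \<odot>\<^bsub>\<E> i\<^esub> v"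
      using diff_smult[OF y_mem_carrier[OF k] tors_carrier[OF u(1)]] u(2)[OF k] by (simp add: v_def)
    then show ?thesis
      using M.smult_r_diff[OF y_mem_carrier[OF k] wc vc] c[OF k] y_mem_carrier[OF k] vc
      by (simp add: M.diff_self_M)
  qed
  then have "w \<ominus>\<^bsub>\<E> i\<^esub> v \<in> tors J1 i"
    using tors_J1_I M.submodule_diff[OF tors_submodule[OF ideals_carrier(1)] w v] by blast
  then have "\<delta> i (w \<ominus>\<^bsub>\<E> i\<^esub> v) \<in> tbd J1 (i + 1)" by (rule diff_tbd)
  moreover have "\<delta> i v = \<zero>\<^bsub>\<E> (i + 1)\<^esub>"
    using diff_diff[OF tors_carrier[OF u(1)]] by (simp add: v_def)
  ultimately show ?thesis
    using diff_minus[OF wc vc] diff_closed[OF wc] by (simp add: M.diff_zero_M)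
qed

end

section \<open>Cohomology of \<open>Hom(R/Q, E)\<close> for a regular sequence\<close>

context injective_complex
begin

text \<open>The cohomology of \<open>Hom(R/J, E)\<close> is \<open>R/J\<close>, generated by the class of \<open>e\<close> in degree \<open>n\<close>.\<close>

definition concentrated :: "int \<Rightarrow> 'a set \<Rightarrow> 'e \<Rightarrow> bool" where
  "concentrated n J e \<longleftrightarrow> e \<in> tcyc J n \<and>
     (\<forall>z\<in>tcyc J n. \<exists>a\<in>carrier R. \<exists>c\<in>tbd J n. z = a \<odot>\<^bsub>\<E> n\<^esub> e \<oplus>\<^bsub>\<E> n\<^esub> c) \<and>
     (\<forall>a\<in>carrier R. a \<odot>\<^bsub>\<E> n\<^esub> e \<in> tbd J n \<longrightarrow> a \<in> J) \<and>
     (\<forall>i. i \<noteq> n \<longrightarrow> tcyc J i \<subseteq> tbd J i)"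

lemma concentratedD:
  assumes "concentrated n J e"
  shows "e \<in> tcyc J n"
    and "z \<in> tcyc J n \<Longrightarrow> \<exists>a\<in>carrier R. \<exists>c\<in>tbd J n. z = a \<odot>\<^bsub>\<E> n\<^esub> e \<oplus>\<^bsub>\<E> n\<^esub> c"
    and "a \<in> carrier R \<Longrightarrow> a \<odot>\<^bsub>\<E> n\<^esub> e \<in> tbd J n \<Longrightarrow> a \<in> J"
    and "i \<noteq> n \<Longrightarrow> tcyc J i \<subseteq> tbd J i"
  using assms unfolding concentrated_def by blast+

text \<open>Since \<open>x\<close> is regular modulo \<open>J\<close>, the module
  \<open>(J + (x))/J\<close> is free over \<open>R/J\<close> on the single generator
  \<open>x\<close>; the index set is the unit type.\<close>

lemma torsion_sequence_adjoin:
  assumes J: "ideal J R" and x: "reg_mod J x"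
  shows "torsion_sequence R E J J (adjoin J x) {()} (\<lambda>_. x)"
proof -
  have xc: "x \<in> carrier R" using x by (rule reg_mod_carrier)
  have lc: "lincomb {()} r (\<lambda>_. x) = r () \<otimes> x" if "r () \<in> carrier R" for r
    using lincomb_insert[of "{}" "()" r "\<lambda>_. x"] that xc by (auto simp: lincomb_def)
  show ?thesis
  proof (rule torsion_sequence.intro[OF injective_complex_axioms], rule torsion_sequence_axioms.intro)
    show "ideal J R" "ideal J R" by fact+
    show "ideal (adjoin J x) R" by (rule adjoin_ideal[OF J xc])
    show "finite {()}" by simp
    show "(\<lambda>_. x) \<in> {()} \<rightarrow> adjoin J x" using mem_adjoin[OF J xc] by auto
    show "J \<subseteq> adjoin J x" by (rule subset_adjoin[OF J xc])
    show "r k \<in> J" if "r \<in> {()} \<rightarrow> carrier R" "lincomb {()} r (\<lambda>_. x) \<in> J" "k \<in> {()}" for r k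
    proof -
      have r: "r () \<in> carrier R" using that(1) by auto
      then have "x \<otimes> r () \<in> J" using that(2) lc[of r] m_comm[OF xc r] by simp
      then show ?thesis using reg_modD[OF x r] by simp
    qed
    show "\<exists>q\<in>J. \<exists>r\<in>{()} \<rightarrow> carrier R. a = q \<oplus> lincomb {()} r (\<lambda>_. x)" if a: "a \<in> adjoin J x" for a
    proof -
      obtain q s where "q \<in> J" "s \<in> carrier R" "a = q \<oplus> s \<otimes> x" using a by (rule adjoinE)
      then show ?thesis using lc[of "\<lambda>_. s"] by (intro bexI[of _ q] bexI[of _ "\<lambda>_. s"]) auto
    qed
    show "a \<otimes> x \<in> J" if "a \<in> J" for a using ideal_rmult_mem[OF J that xc] .
  qed
qed

text \<open>The long exact sequence of multiplication by \<open>x\<close> on \<open>R/J\<close>: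
  multiplication is injective there with cokernel \<open>R/(J + (x))\<close>, which appears one
  degree higher through the connecting homomorphism.\<close>

lemma concentrated_adjoin:
  assumes J: "ideal J R" and x: "reg_mod J x" and conc: "concentrated n J e"
  shows "\<exists>e'. concentrated (n + 1) (adjoin J x) e'"
proof -
  interpret T: torsion_sequence R E J J "adjoin J x" "{()}" "\<lambda>_. x"
    by (rule torsion_sequence_adjoin[OF J x])
  let ?J1 = "adjoin J x"
  note c = concentratedD[OF conc]
  have xc: "x \<in> carrier R" using x by (rule reg_mod_carrier)
  note bdJ = tbd_submodule[OF T.ideals_carrier(1)]
  have kills: "x \<odot>\<^bsub>\<E> i\<^esub> w = \<zero>\<^bsub>\<E> i\<^esub>" if "w \<in> tors ?J1 i" for w i using T.y_kills[OF that] by simp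
  have lift: "\<delta> i w \<in> tbd ?J1 (i + 1)" if "w \<in> tors J i" "x \<odot>\<^bsub>\<E> i\<^esub> w \<in> tbd J i" for i w
    using T.lift_boundary[OF that(1)] that(2) by simp
  \<comment> \<open>In \<open>Hom(R/J, E)\<close> such a cocycle bounds, in degree \<open>n\<close>
    because \<open>x\<close> is regular modulo \<open>J\<close>. For a primitive \<open>w\<close>
    the multiple \<open>x w\<close> is a cocycle of degree \<open>i - 1\<close>, different from
    \<open>n\<close>, hence a coboundary, and \<open>lift\<close> applies.\<close>
  have other: "tcyc ?J1 i \<subseteq> tbd ?J1 i" if i: "i \<noteq> n + 1" for i
  proof
    fix z assume z: "z \<in> tcyc ?J1 i"
    then have zJ: "z \<in> tcyc J i" by (rule T.tcyc_J1_sub)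
    have "z \<in> tbd J i"
    proof (cases "i = n")
      case False
      then show ?thesis using c(4) zJ by blast
    next
      case True
      obtain a b where ab: "a \<in> carrier R" "b \<in> tbd J n" "z = a \<odot>\<^bsub>\<E> n\<^esub> e \<oplus>\<^bsub>\<E> n\<^esub> b"
        using c(2) zJ True by blast
      have ec: "e \<in> carrier (\<E> n)" using c(1) tcyc_carrier by blast
      have bc: "b \<in> carrier (\<E> n)" using M.submodule_carrier[OF bdJ ab(2)] .
      have "\<zero>\<^bsub>\<E> n\<^esub> = x \<odot>\<^bsub>\<E> n\<^esub> z" using kills[OF tcyc_tors[OF z]] True by simp
      also have "\<dots> = (x \<otimes> a) \<odot>\<^bsub>\<E> n\<^esub> e \<oplus>\<^bsub>\<E> n\<^esub> x \<odot>\<^bsub>\<E> n\<^esub> b"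
        unfolding ab(3) using ab(1) xc ec bc by (simp add: M.smult_r_distr M.smult_assoc1)
      finally have "(x \<otimes> a) \<odot>\<^bsub>\<E> n\<^esub> e = \<zero>\<^bsub>\<E> n\<^esub> \<ominus>\<^bsub>\<E> n\<^esub> x \<odot>\<^bsub>\<E> n\<^esub> b"
        using M.add_diff_cancel_M[of "(x \<otimes> a) \<odot>\<^bsub>\<E> n\<^esub> e" n "x \<odot>\<^bsub>\<E> n\<^esub> b"] ab(1) xc ec bc by simp
      moreover have "\<dots> \<in> tbd J n"
        by (intro M.submodule_diff[OF bdJ] M.submodule_zero[OF bdJ] M.submoduleE(4)[OF bdJ] xc ab(2))
      ultimately have "x \<otimes> a \<in> J" using c(3)[of "x \<otimes> a"] xc ab(1) by simp
      then have "a \<in> J" using reg_modD[OF x ab(1)] by blast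
      then have "a \<odot>\<^bsub>\<E> n\<^esub> e = \<zero>\<^bsub>\<E> n\<^esub>" using tors_smult_zero[OF tcyc_tors[OF c(1)]] by blast
      then show ?thesis using ab(2,3) bc True by simp
    qed
    then obtain w where w: "w \<in> tors J (i - 1)" "z = \<delta> (i - 1) w" by (rule tbdE)
    have "x \<odot>\<^bsub>\<E> (i - 1)\<^esub> w \<in> tors J (i - 1)" using T.y_tors[OF w(1)] by simp
    moreover have "\<delta> (i - 1) (x \<odot>\<^bsub>\<E> (i - 1)\<^esub> w) = \<zero>\<^bsub>\<E> (i - 1 + 1)\<^esub>"
      using diff_smult[OF xc tors_carrier[OF w(1)]] w(2) kills[OF tcyc_tors[OF z]] by simp
    ultimately have "x \<odot>\<^bsub>\<E> (i - 1)\<^esub> w \<in> tcyc J (i - 1)" by (simp add: tcyc_def)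
    then have "x \<odot>\<^bsub>\<E> (i - 1)\<^esub> w \<in> tbd J (i - 1)" using c(4)[of "i - 1"] i by auto
    then show "z \<in> tbd ?J1 i" using lift[OF w(1)] w(2) by simp
  qed
  \<comment> \<open>A lift of \<open>e\<close> along multiplication by \<open>x\<close>; the
    differential of \<open>x0\<close> is the connecting image of \<open>e\<close>, the new
    generator.\<close>
  obtain x0 where x0: "x0 \<in> tors J n" "x \<odot>\<^bsub>\<E> n\<^esub> x0 = e"
    using T.solve[of "\<lambda>_. e" n] tcyc_tors[OF c(1)] by auto
  have x0c: "x0 \<in> carrier (\<E> n)" and ec: "e \<in> carrier (\<E> n)"
    using x0 c(1) tors_carrier tcyc_carrier by auto
  define e' where "e' = \<delta> n x0"
  have e'c: "e' \<in> tcyc J (n + 1)" unfolding e'_def by (rule diff_tcyc[OF T.ideals_carrier(1) x0(1)])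
  have "x \<odot>\<^bsub>\<E> (n + 1)\<^esub> e' = \<zero>\<^bsub>\<E> (n + 1)\<^esub>"
    using diff_smult[OF xc x0c] x0(2) tcyc_diff[OF c(1)] by (simp add: e'_def)
  then have "e' \<in> tors ?J1 (n + 1)" using T.tors_J1_I[OF tcyc_tors[OF e'c]] by simp
  then have 1: "e' \<in> tcyc ?J1 (n + 1)" using tcyc_diff[OF e'c] by (simp add: tcyc_def)
  have 2: "\<exists>a\<in>carrier R. \<exists>b\<in>tbd ?J1 (n + 1). z = a \<odot>\<^bsub>\<E> (n + 1)\<^esub> e' \<oplus>\<^bsub>\<E> (n + 1)\<^esub> b"
    if z: "z \<in> tcyc ?J1 (n + 1)" for z
  proof -
    have "z \<in> tbd J (n + 1)" using c(4)[of "n + 1"] T.tcyc_J1_sub[OF z] by auto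
    then obtain w where w: "w \<in> tors J n" "z = \<delta> n w" by (rule tbdE_Suc)
    have wc: "w \<in> carrier (\<E> n)" using w tors_carrier by blast
    have "x \<odot>\<^bsub>\<E> n\<^esub> w \<in> tors J n" using T.y_tors[OF w(1)] by simp
    moreover have "\<delta> n (x \<odot>\<^bsub>\<E> n\<^esub> w) = \<zero>\<^bsub>\<E> (n + 1)\<^esub>"
      using diff_smult[OF xc wc] w(2) kills[OF tcyc_tors[OF z]] by simp
    ultimately have "x \<odot>\<^bsub>\<E> n\<^esub> w \<in> tcyc J n" by (simp add: tcyc_def)
    then obtain a b where ab: "a \<in> carrier R" "b \<in> tbd J n"
      "x \<odot>\<^bsub>\<E> n\<^esub> w = a \<odot>\<^bsub>\<E> n\<^esub> e \<oplus>\<^bsub>\<E> n\<^esub> b" using c(2) by blast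
    have bc: "b \<in> carrier (\<E> n)" using M.submodule_carrier[OF bdJ ab(2)] .
    \<comment> \<open>The part of \<open>w\<close> with \<open>x v\<close> a coboundary; by
      \<open>lift\<close> its differential contributes nothing to the class of
      \<open>z\<close>.\<close>
    define v where "v = w \<ominus>\<^bsub>\<E> n\<^esub> a \<odot>\<^bsub>\<E> n\<^esub> x0"
    have v: "v \<in> tors J n" unfolding v_def
      by (intro M.submodule_diff[OF tors_submodule] M.submoduleE(4)[OF tors_submodule]
          T.ideals_carrier(1) w x0 ab)
    have "x \<odot>\<^bsub>\<E> n\<^esub> (a \<odot>\<^bsub>\<E> n\<^esub> x0) = a \<odot>\<^bsub>\<E> n\<^esub> e"
      using ab(1) xc x0c x0(2) by (metis M.smult_assoc1 m_comm)
    then have "x \<odot>\<^bsub>\<E> n\<^esub> v = b"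
      unfolding v_def using M.smult_r_diff[OF xc wc, of "a \<odot>\<^bsub>\<E> n\<^esub> x0"] ab x0c ec bc
      by (simp add: M.add_diff_cancel_left_M)
    then have "\<delta> n v \<in> tbd ?J1 (n + 1)" using lift[OF v] ab(2) by simp
    moreover have "z = a \<odot>\<^bsub>\<E> (n + 1)\<^esub> e' \<oplus>\<^bsub>\<E> (n + 1)\<^esub> \<delta> n v"
    proof -
      have "w = a \<odot>\<^bsub>\<E> n\<^esub> x0 \<oplus>\<^bsub>\<E> n\<^esub> v"
        unfolding v_def using M.diff_add_cancel_M[OF wc, of "a \<odot>\<^bsub>\<E> n\<^esub> x0"] wc ab(1) x0c
        by (simp add: M.a_comm)
      then show ?thesis
        using w(2) diff_add[of "a \<odot>\<^bsub>\<E> n\<^esub> x0" n v] diff_smult[OF ab(1) x0c] ab(1) x0c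
          tors_carrier[OF v] by (simp add: e'_def)
    qed
    ultimately show ?thesis using ab(1) by blast
  qed
  have 3: "a \<in> ?J1" if a: "a \<in> carrier R" "a \<odot>\<^bsub>\<E> (n + 1)\<^esub> e' \<in> tbd ?J1 (n + 1)" for a
  proof -
    obtain u where u: "u \<in> tors ?J1 n" "a \<odot>\<^bsub>\<E> (n + 1)\<^esub> e' = \<delta> n u" using a(2) by (rule tbdE_Suc)
    have uJ: "u \<in> tors J n" using T.tors_J1_sub[OF u(1)] .
    have uc: "u \<in> carrier (\<E> n)" using u tors_carrier by blast
    \<comment> \<open>A cocycle for \<open>J\<close>. As \<open>x\<close> kills \<open>u\<close>,
      multiplying \<open>v\<close> by \<open>x\<close> gives \<open>a e\<close>, while writing
      \<open>v\<close> through \<open>e\<close> gives \<open>x b e\<close> up to a coboundary; hence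
      \<open>a\<close> is congruent to \<open>x b\<close> modulo \<open>J\<close>.\<close>
    define v where "v = a \<odot>\<^bsub>\<E> n\<^esub> x0 \<ominus>\<^bsub>\<E> n\<^esub> u"
    have "v \<in> tors J n" unfolding v_def
      by (intro M.submodule_diff[OF tors_submodule] M.submoduleE(4)[OF tors_submodule]
          T.ideals_carrier(1) uJ x0 a)
    moreover have "\<delta> n v = \<zero>\<^bsub>\<E> (n + 1)\<^esub>"
      unfolding v_def using diff_minus[of "a \<odot>\<^bsub>\<E> n\<^esub> x0" n u] a(1) x0c uc diff_smult[OF a(1) x0c] u(2)
        diff_closed[OF uc] by (simp add: e'_def M.diff_self_M)
    ultimately have "v \<in> tcyc J n" by (simp add: tcyc_def)
    then obtain b f where bf: "b \<in> carrier R" "f \<in> tbd J n" "v = b \<odot>\<^bsub>\<E> n\<^esub> e \<oplus>\<^bsub>\<E> n\<^esub> f"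
      using c(2) by blast
    have fc: "f \<in> carrier (\<E> n)" using M.submodule_carrier[OF bdJ bf(2)] .
    have "x \<odot>\<^bsub>\<E> n\<^esub> (a \<odot>\<^bsub>\<E> n\<^esub> x0) = a \<odot>\<^bsub>\<E> n\<^esub> e"
      using a(1) xc x0c x0(2) by (metis M.smult_assoc1 m_comm)
    then have "a \<odot>\<^bsub>\<E> n\<^esub> e = x \<odot>\<^bsub>\<E> n\<^esub> v"
      unfolding v_def using M.smult_r_diff[OF xc _ uc, of "a \<odot>\<^bsub>\<E> n\<^esub> x0"] a(1) x0c ec
        kills[OF u(1)] by (simp add: M.diff_zero_M)
    also have "\<dots> = (x \<otimes> b) \<odot>\<^bsub>\<E> n\<^esub> e \<oplus>\<^bsub>\<E> n\<^esub> x \<odot>\<^bsub>\<E> n\<^esub> f"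
      unfolding bf(3) using bf(1) xc ec fc by (simp add: M.smult_r_distr M.smult_assoc1)
    finally have "(a \<ominus> x \<otimes> b) \<odot>\<^bsub>\<E> n\<^esub> e = x \<odot>\<^bsub>\<E> n\<^esub> f"
      using a(1) bf(1) xc ec fc by (simp add: M.smult_l_diff M.add_diff_cancel_left_M)
    then have "(a \<ominus> x \<otimes> b) \<odot>\<^bsub>\<E> n\<^esub> e \<in> tbd J n"
      using M.submoduleE(4)[OF bdJ xc bf(2)] by simp
    then have "a \<ominus> x \<otimes> b \<in> J" using c(3) a(1) bf(1) xc by simp
    moreover have "a = (a \<ominus> x \<otimes> b) \<oplus> b \<otimes> x" using a(1) bf(1) xc by algebra
    ultimately show ?thesis using adjoinI[OF _ bf(1), of "a \<ominus> x \<otimes> b" J x] by simp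
  qed
  show ?thesis
    unfolding concentrated_def using 1 2 3 other by (intro exI[of _ e']) blast
qed

lemma concentrated_regseq:
  assumes "ideal J R" "regseq J xs" "concentrated n J e"
  shows "\<exists>e'. concentrated (n + int (length xs)) (adjoins J xs) e'"
  using assms
proof (induction xs arbitrary: J n e)
  case (Cons x xs)
  have x: "reg_mod J x" and xs: "regseq (adjoin J x) xs" using Cons.prems by auto
  obtain e' where e': "concentrated (n + 1) (adjoin J x) e'"
    using concentrated_adjoin[OF Cons.prems(1) x Cons.prems(3)] by blast
  have "ideal (adjoin J x) R" using adjoin_ideal Cons.prems(1) reg_mod_carrier[OF x] by blast
  moreover have "n + 1 + int (length xs) = n + int (length (x # xs))" by simp
  ultimately show ?case using Cons.IH[OF _ xs e'] by (metis adjoins.simps(2))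
qed auto

end

section \<open>Cohomology of \<open>Hom(R/I, E)\<close> for an Ulrich ideal\<close>

context injective_complex
begin

text \<open>\<open>b\<close> induces a basis over \<open>R/J\<close> of the cohomology of \<open>Hom(R/J, E)\<close> in degree \<open>i\<close>.\<close>

definition cobasis :: "int \<Rightarrow> 'a set \<Rightarrow> 'i set \<Rightarrow> ('i \<Rightarrow> 'e) \<Rightarrow> bool" where
  "cobasis i J S b \<longleftrightarrow> finite S \<and> b \<in> S \<rightarrow> tcyc J i \<and>
     (\<forall>z\<in>tcyc J i. \<exists>r\<in>S \<rightarrow> carrier R. \<exists>c\<in>tbd J i. z = M.mlin i S r b \<oplus>\<^bsub>\<E> i\<^esub> c) \<and>
     (\<forall>r\<in>S \<rightarrow> carrier R. M.mlin i S r b \<in> tbd J i \<longrightarrow> (\<forall>k\<in>S. r k \<in> J))"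

lemma cobasisD:
  assumes "cobasis i J S b"
  shows "finite S" and "b \<in> S \<rightarrow> tcyc J i" and "b \<in> S \<rightarrow> carrier (\<E> i)"
    and "z \<in> tcyc J i \<Longrightarrow> \<exists>r\<in>S \<rightarrow> carrier R. \<exists>c\<in>tbd J i. z = M.mlin i S r b \<oplus>\<^bsub>\<E> i\<^esub> c"
    and "r \<in> S \<rightarrow> carrier R \<Longrightarrow> M.mlin i S r b \<in> tbd J i \<Longrightarrow> k \<in> S \<Longrightarrow> r k \<in> J"
proof -
  show "b \<in> S \<rightarrow> carrier (\<E> i)" using assms tcyc_carrier by (auto simp: cobasis_def Pi_iff)
qed (use assms in \<open>unfold cobasis_def, blast+\<close>)

lemma cobasis_reindex:
  assumes B: "cobasis i J S b" and h: "bij_betw h T S"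
  shows "cobasis i J T (\<lambda>k. b (h k))"
proof -
  note c = cobasisD[OF B]
  have inj: "inj_on h T" and im: "h ` T = S" using h by (auto simp: bij_betw_def)
  have re: "M.mlin i S r b = M.mlin i T (\<lambda>k. r (h k)) (\<lambda>k. b (h k))" if "r \<in> S \<rightarrow> carrier R" for r
    using M.mlin_reindex[OF inj, of r b] that c(3) im by simp
  show ?thesis
    unfolding cobasis_def
  proof (intro conjI ballI impI)
    show "finite T" using c(1) h bij_betw_finite by blast
    show "(\<lambda>k. b (h k)) \<in> T \<rightarrow> tcyc J i" using c(2) im by auto
    fix z assume "z \<in> tcyc J i"
    then obtain r f where rf: "r \<in> S \<rightarrow> carrier R" "f \<in> tbd J i" "z = M.mlin i S r b \<oplus>\<^bsub>\<E> i\<^esub> f"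
      using c(4) by blast
    moreover have "(\<lambda>k. r (h k)) \<in> T \<rightarrow> carrier R" using rf(1) im by auto
    ultimately show "\<exists>r\<in>T \<rightarrow> carrier R. \<exists>c\<in>tbd J i. z = M.mlin i T r (\<lambda>k. b (h k)) \<oplus>\<^bsub>\<E> i\<^esub> c"
      using re[OF rf(1)] by metis
  next
    fix r k assume r: "r \<in> T \<rightarrow> carrier R" "M.mlin i T r (\<lambda>k. b (h k)) \<in> tbd J i" and k: "k \<in> T"
    define s where "s = (\<lambda>l. r (inv_into T h l))"
    have sh: "s (h l) = r l" if "l \<in> T" for l using that inj by (simp add: s_def)
    have s: "s \<in> S \<rightarrow> carrier R" using r(1) sh im by (auto simp: Pi_iff)
    have "M.mlin i S s b = M.mlin i T r (\<lambda>k. b (h k))"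
      unfolding re[OF s] by (rule M.mlin_cong) (use sh r(1) c(3) im in auto)
    then have "s (h k) \<in> J" using c(5)[OF s, of "h k"] r(2) k im by auto
    then show "r k \<in> J" using sh k by simp
  qed
qed

text \<open>Each step produces a basis indexed by pairs. Returning to an initial segment of the
  naturals keeps one index type throughout the induction on degrees, and it is the form required by
  \<open>power_module\<close>.\<close>

lemma cobasis_lessThan:
  assumes "cobasis i J S b"
  shows "\<exists>b'. cobasis i J {..<card S} b'"
proof -
  obtain h where "bij_betw h {..<card S} S"
    using cobasisD(1)[OF assms] by (metis ex_bij_betw_nat_finite atLeast0LessThan)
  then show ?thesis using cobasis_reindex[OF assms] by blast
qed

lemma cobasis_empty: "tcyc J i \<subseteq> tbd J i \<Longrightarrow> J \<subseteq> carrier R \<Longrightarrow> cobasis i J {} b"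
  using M.submodule_carrier[OF tbd_submodule] by (auto simp: cobasis_def)

end

text \<open>The torsion sequence with \<open>J = Q\<close> and \<open>J' = J1 = I\<close>: the
  quotient complex is a power of the subcomplex, so the cohomology of \<open>Hom(R/I, E)\<close> is
  determined recursively, degree by degree, by that of \<open>Hom(R/Q, E)\<close>.\<close>

locale ulrich_complex = torsion_sequence R E Q I I S y
  for R (structure) and E :: "('a, 'e) cochain" and Q I :: "'a set" and S :: "'i set" and y :: "'i \<Rightarrow> 'a" +
  fixes d :: int and e :: 'e
  assumes conc: "concentrated d Q e"
    and negative: "\<And>i. i < 0 \<Longrightarrow> carrier (\<E> i) = {\<zero>\<^bsub>\<E> i\<^esub>}"
    and S_nonempty: "S \<noteq> {}"
begin

lemmas conc' = concentratedD[OF conc]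

lemmas tors_sub = tors_submodule[OF ideals_carrier(1)] tors_submodule[OF ideals_carrier(2)]
lemmas tbd_sub = tbd_submodule[OF ideals_carrier(1)] tbd_submodule[OF ideals_carrier(2)]

lemma y_diff:
  assumes "w \<in> carrier (\<E> i)" "k \<in> S"
  shows "\<delta> i (y k \<odot>\<^bsub>\<E> i\<^esub> w) = y k \<odot>\<^bsub>\<E> (i + 1)\<^esub> \<delta> i w"
  using diff_smult[OF y_mem_carrier[OF assms(2)] assms(1)] .

lemma y_tcyc_of_diff:
  assumes "w \<in> tors Q i" "\<delta> i w \<in> tors I (i + 1)" "k \<in> S"
  shows "y k \<odot>\<^bsub>\<E> i\<^esub> w \<in> tcyc I i"
  using y_tors[OF assms(1,3)] y_diff[OF tors_carrier[OF assms(1)] assms(3)] y_kills[OF assms(2,3)]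
  by (simp add: tcyc_def)

text \<open>Away from degree \<open>d\<close> a cocycle bounds in \<open>Hom(R/Q, E)\<close>; the
  multiples of its primitive by the \<open>y k\<close> are cocycles one degree lower, hence
  coboundaries, and \<open>lift_boundary\<close> concludes.\<close>

lemma acyclic_step:
  assumes "tcyc I i \<subseteq> tbd I i" "i + 1 \<noteq> d"
  shows "tcyc I (i + 1) \<subseteq> tbd I (i + 1)"
proof
  fix z assume z: "z \<in> tcyc I (i + 1)"
  then have "z \<in> tbd Q (i + 1)" using tcyc_J1_sub conc'(4)[OF assms(2)] by blast
  then obtain w where w: "w \<in> tors Q i" "z = \<delta> i w" by (rule tbdE_Suc)
  have "y k \<odot>\<^bsub>\<E> i\<^esub> w \<in> tbd I i" if "k \<in> S" for k
    using y_tcyc_of_diff[OF w(1) _ that] tcyc_tors[OF z] w(2) assms(1) by blast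
  then show "z \<in> tbd I (i + 1)" using lift_boundary[OF w(1)] w(2) by simp
qed

lemma acyclic_below:
  assumes "i < d" "0 \<le> d"
  shows "tcyc I i \<subseteq> tbd I i"
proof (cases "i < 0")
  case True
  then have "tcyc I i \<subseteq> {\<zero>\<^bsub>\<E> i\<^esub>}" using negative tcyc_carrier by blast
  then show ?thesis using M.submodule_zero[OF tbd_sub(2)] by blast
next
  case False
  \<comment> \<open>The induction starts in degree -1, where \<open>E\<close> vanishes, so that
    degree 0 is reached by a regular step.\<close>
  then have "-1 \<le> i" by simp
  then show ?thesis using assms(1)
  proof (induction i rule: int_ge_induct)
    case base
    have "tcyc I (-1) \<subseteq> {\<zero>\<^bsub>\<E> (-1)\<^esub>}" using negative[of "-1"] tcyc_carrier by force
    then show ?case using M.submodule_zero[OF tbd_sub(2)] by blast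
  next
    case (step i)
    then show ?case using acyclic_step[of i] by simp
  qed
qed

lemma e_facts: "e \<in> tcyc Q d" "e \<in> carrier (\<E> d)" "e \<in> tors Q d"
  using conc'(1) tcyc_carrier tcyc_tors by auto

text \<open>A cocycle is \<open>a e + c\<close> with \<open>c\<close> a coboundary for
  \<open>Q\<close>. Being killed by the \<open>y k\<close>, it forces \<open>a y k\<close> into
  \<open>Q\<close> and hence \<open>a\<close> into \<open>I\<close>, so that \<open>a e\<close> is a
  combination of the \<open>y k e\<close>; this is \<open>I/Q\<close> inside
  \<open>R/Q\<close>.\<close>

lemma cobasis_at_d:
  assumes "0 \<le> d"
  shows "cobasis d I S (\<lambda>k. y k \<odot>\<^bsub>\<E> d\<^esub> e)"
  unfolding cobasis_def
proof (intro conjI ballI impI)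
  show "finite S" by (rule finite_S)
  show "(\<lambda>k. y k \<odot>\<^bsub>\<E> d\<^esub> e) \<in> S \<rightarrow> tcyc I d" using y_tcyc[OF e_facts(1)] by auto
next
  fix z assume z: "z \<in> tcyc I d"
  obtain a c where ac: "a \<in> carrier R" "c \<in> tbd Q d" "z = a \<odot>\<^bsub>\<E> d\<^esub> e \<oplus>\<^bsub>\<E> d\<^esub> c"
    using conc'(2) tcyc_J1_sub[OF z] by blast
  have cc: "c \<in> carrier (\<E> d)" using M.submodule_carrier[OF tbd_sub(1) ac(2)] .
  have yz: "(a \<otimes> y k) \<odot>\<^bsub>\<E> d\<^esub> e \<oplus>\<^bsub>\<E> d\<^esub> y k \<odot>\<^bsub>\<E> d\<^esub> c = \<zero>\<^bsub>\<E> d\<^esub>" if k: "k \<in> S" for k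
  proof -
    have yk: "y k \<in> carrier R" using y_mem_carrier[OF k] .
    have "\<zero>\<^bsub>\<E> d\<^esub> = y k \<odot>\<^bsub>\<E> d\<^esub> z" using y_kills[OF tcyc_tors[OF z] k] by simp
    also have "\<dots> = (y k \<otimes> a) \<odot>\<^bsub>\<E> d\<^esub> e \<oplus>\<^bsub>\<E> d\<^esub> y k \<odot>\<^bsub>\<E> d\<^esub> c"
      unfolding ac(3) using ac(1) yk e_facts(2) cc by (simp add: M.smult_r_distr M.smult_assoc1)
    finally show ?thesis using m_comm[OF yk ac(1)] by simp
  qed
  have ay: "a \<otimes> y k \<in> Q" if k: "k \<in> S" for k
  proof -
    have yk: "y k \<in> carrier R" using y_mem_carrier[OF k] .
    have "(a \<otimes> y k) \<odot>\<^bsub>\<E> d\<^esub> e = \<zero>\<^bsub>\<E> d\<^esub> \<ominus>\<^bsub>\<E> d\<^esub> y k \<odot>\<^bsub>\<E> d\<^esub> c"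
      using M.add_diff_cancel_M[of "(a \<otimes> y k) \<odot>\<^bsub>\<E> d\<^esub> e" d "y k \<odot>\<^bsub>\<E> d\<^esub> c"] yz[OF k] ac(1) yk e_facts(2) cc
      by simp
    moreover have "\<dots> \<in> tbd Q d"
      by (intro M.submodule_diff[OF tbd_sub(1)] M.submodule_zero[OF tbd_sub(1)]
          M.submoduleE(4)[OF tbd_sub(1)] yk ac(2))
    ultimately show ?thesis using conc'(3)[of "a \<otimes> y k"] ac(1) yk by simp
  qed
  obtain k0 where k0: "k0 \<in> S" using S_nonempty by blast
  \<comment> \<open>Independence is applied to the constant coefficient \<open>a\<close>;
    nonemptiness of \<open>S\<close> provides an index at which to read off that \<open>a\<close> is
    in \<open>I\<close>.\<close>
  have "lincomb S (\<lambda>_. a) y \<in> Q" by (rule lincomb_mem[OF ideals(1) finite_S ay])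
  then have "a \<in> I" using y_indep[of "\<lambda>_. a" k0] ac(1) k0 by auto
  then obtain q r where qr: "q \<in> Q" "r \<in> S \<rightarrow> carrier R" "a = q \<oplus> lincomb S r y" using y_gen by blast
  have qc: "q \<in> carrier R" using qr(1) ideals_carrier by blast
  have "a \<odot>\<^bsub>\<E> d\<^esub> e = M.mlin d S r (\<lambda>k. y k \<odot>\<^bsub>\<E> d\<^esub> e)"
    unfolding qr(3) M.mlin_smult_right[OF finite_S qr(2) y_carrier e_facts(2)]
    using M.smult_l_distr[OF qc lincomb_closed[OF qr(2) y_carrier] e_facts(2)]
      tors_smult_zero[OF e_facts(3) qr(1)] lincomb_closed[OF qr(2) y_carrier] e_facts(2) by simp
  \<comment> \<open>Now \<open>y k c\<close> vanishes, so \<open>y k w\<close> is a cocycle in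
    degree \<open>d - 1\<close>, where \<open>Hom(R/I, E)\<close> is acyclic; \<open>c\<close>
    therefore bounds in the smaller complex too.\<close>
  moreover have "c \<in> tbd I d"
  proof -
    obtain w where w: "w \<in> tors Q (d - 1)" "c = \<delta> (d - 1) w" using ac(2) by (rule tbdE)
    have "y k \<odot>\<^bsub>\<E> (d - 1)\<^esub> w \<in> tbd I (d - 1)" if k: "k \<in> S" for k
    proof -
      have "(a \<otimes> y k) \<odot>\<^bsub>\<E> d\<^esub> e = \<zero>\<^bsub>\<E> d\<^esub>" using tors_smult_zero[OF e_facts(3) ay[OF k]] .
      then have "y k \<odot>\<^bsub>\<E> d\<^esub> c = \<zero>\<^bsub>\<E> d\<^esub>" using yz[OF k] cc y_mem_carrier[OF k] by simp
      then have "\<delta> (d - 1) (y k \<odot>\<^bsub>\<E> (d - 1)\<^esub> w) = \<zero>\<^bsub>\<E> (d - 1 + 1)\<^esub>"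
        using y_diff[OF tors_carrier[OF w(1)] k] w(2) by simp
      then have "y k \<odot>\<^bsub>\<E> (d - 1)\<^esub> w \<in> tcyc I (d - 1)"
        using y_tors[OF w(1) k] by (simp add: tcyc_def)
      then show ?thesis using acyclic_below[of "d - 1"] assms by auto
    qed
    then show ?thesis using lift_boundary[OF w(1)] w(2) by simp
  qed
  ultimately show "\<exists>r\<in>S \<rightarrow> carrier R. \<exists>c\<in>tbd I d. z = M.mlin d S r (\<lambda>k. y k \<odot>\<^bsub>\<E> d\<^esub> e) \<oplus>\<^bsub>\<E> d\<^esub> c"
    using ac(3) qr(2) by auto
next
  fix r k assume r: "r \<in> S \<rightarrow> carrier R" "M.mlin d S r (\<lambda>k. y k \<odot>\<^bsub>\<E> d\<^esub> e) \<in> tbd I d" and k: "k \<in> S"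
  have "lincomb S r y \<odot>\<^bsub>\<E> d\<^esub> e \<in> tbd Q d"
    using r(2) tbd_mono[OF J_sub] M.mlin_smult_right[OF finite_S r(1) y_carrier e_facts(2)] by auto
  then have "lincomb S r y \<in> Q" using conc'(3) lincomb_closed[OF r(1) y_carrier] by blast
  then show "r k \<in> I" using y_indep r(1) k by blast
qed

context
  fixes i :: int and S' :: "'j set" and b :: "'j \<Rightarrow> 'e" and x :: "'i \<Rightarrow> 'j \<Rightarrow> 'e"
  assumes B: "cobasis i I S' b"
    and x_tors: "\<And>l k. l \<in> S \<Longrightarrow> k \<in> S' \<Longrightarrow> x l k \<in> tors Q i"
    and x_y: "\<And>l k l'. l \<in> S \<Longrightarrow> k \<in> S' \<Longrightarrow> l' \<in> S \<Longrightarrow>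
      y l' \<odot>\<^bsub>\<E> i\<^esub> x l k = (if l' = l then b k else \<zero>\<^bsub>\<E> i\<^esub>)"
begin

lemmas B' = cobasisD[OF B]

lemma x_carrier: "(\<lambda>p. x (fst p) (snd p)) \<in> S \<times> S' \<rightarrow> carrier (\<E> i)"
  by (auto intro: tors_carrier[OF x_tors])

lemma finite_SS': "finite (S \<times> S')"
  using finite_S B'(1) by simp

lemma mlin_x_tors:
  assumes "r \<in> S \<times> S' \<rightarrow> carrier R"
  shows "M.mlin i (S \<times> S') r (\<lambda>p. x (fst p) (snd p)) \<in> tors Q i"
  by (rule M.mlin_mem[OF tors_sub(1) finite_SS'])
    (use assms in \<open>auto simp: Pi_iff intro!: M.submoduleE(4)[OF tors_sub(1)] x_tors\<close>)

text \<open>With \<open>r\<close> read as a matrix, multiplication by \<open>y l\<close> extracts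
  its row \<open>l\<close>.\<close>

lemma y_mlin_x:
  assumes r: "r \<in> S \<times> S' \<rightarrow> carrier R" and l: "l \<in> S"
  shows "y l \<odot>\<^bsub>\<E> i\<^esub> M.mlin i (S \<times> S') r (\<lambda>p. x (fst p) (snd p)) = M.mlin i S' (\<lambda>k. r (l, k)) b"
proof -
  let ?b = "\<lambda>p. if fst p = l then b (snd p) else \<zero>\<^bsub>\<E> i\<^esub>"
  have yl: "y l \<in> carrier R" using y_mem_carrier[OF l] .
  have bc: "?b \<in> S \<times> S' \<rightarrow> carrier (\<E> i)" using B'(3) by auto
  have "y l \<odot>\<^bsub>\<E> i\<^esub> M.mlin i (S \<times> S') r (\<lambda>p. x (fst p) (snd p)) =
      M.mlin i (S \<times> S') (\<lambda>p. y l \<otimes> r p) (\<lambda>p. x (fst p) (snd p))"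
    by (rule M.mlin_scale[symmetric, OF finite_SS' yl r x_carrier])
  also have "\<dots> = M.mlin i (S \<times> S') r ?b"
  proof (rule M.mlin_cong[OF _ r bc])
    fix p assume p: "p \<in> S \<times> S'"
    then have rp: "r p \<in> carrier R" using r by auto
    have xp: "x (fst p) (snd p) \<in> carrier (\<E> i)" using x_carrier p by auto
    have "(y l \<otimes> r p) \<odot>\<^bsub>\<E> i\<^esub> x (fst p) (snd p) = r p \<odot>\<^bsub>\<E> i\<^esub> (y l \<odot>\<^bsub>\<E> i\<^esub> x (fst p) (snd p))"
      using m_comm[OF yl rp] M.smult_assoc1[OF rp yl xp] by simp
    also have "y l \<odot>\<^bsub>\<E> i\<^esub> x (fst p) (snd p) = ?b p" using x_y[of "fst p" "snd p" l] p l by auto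
    finally show "(y l \<otimes> r p) \<odot>\<^bsub>\<E> i\<^esub> x (fst p) (snd p) = r p \<odot>\<^bsub>\<E> i\<^esub> ?b p" .
  qed
  also have "\<dots> = M.mlin i (Pair l ` S') r ?b"
    by (rule M.mlin_superset_zero[OF finite_SS' _ r bc]) (use l r in \<open>auto simp: Pi_iff image_iff\<close>)
  also have "\<dots> = M.mlin i S' (\<lambda>k. r (l, k)) (\<lambda>k. ?b (l, k))"
    by (rule M.mlin_reindex) (use l r B'(3) in \<open>auto simp: inj_on_def Pi_iff\<close>)
  finally show ?thesis by simp
qed

lemma diff_mlin_x:
  assumes "r \<in> S \<times> S' \<rightarrow> carrier R"
  shows "\<delta> i (M.mlin i (S \<times> S') r (\<lambda>p. x (fst p) (snd p))) =
    M.mlin (i + 1) (S \<times> S') r (\<lambda>p. \<delta> i (x (fst p) (snd p)))"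
  by (rule diff_mlin[OF finite_SS' assms x_carrier])

text \<open>Every \<open>y l'\<close> sends \<open>x l k\<close> to a cocycle, either
  \<open>b k\<close> or zero, and so kills its differential.\<close>

lemma diff_x_tcyc:
  assumes "l \<in> S" "k \<in> S'"
  shows "\<delta> i (x l k) \<in> tcyc I (i + 1)"
proof -
  have xt: "x l k \<in> tors Q i" using x_tors assms by blast
  have bt: "b k \<in> tcyc I i" using B'(2) assms by auto
  have "y l' \<odot>\<^bsub>\<E> (i + 1)\<^esub> \<delta> i (x l k) = \<zero>\<^bsub>\<E> (i + 1)\<^esub>" if l': "l' \<in> S" for l'
    using y_diff[OF tors_carrier[OF xt] l'] x_y[OF assms l'] tcyc_diff[OF bt] diff_zero
    by (simp split: if_splits)
  then have "\<delta> i (x l k) \<in> tors I (i + 1)"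
    using tors_J1_I diff_tors[OF ideals_carrier(1) xt] by blast
  then show ?thesis using diff_diff[OF tors_carrier[OF xt]] by (simp add: tcyc_def)
qed

text \<open>Exactness at the target of the connecting map: the rows of coefficients come from
  expanding \<open>y l w\<close> for a primitive \<open>w\<close> of \<open>z\<close>. The condition
  is that \<open>z\<close> bounds in \<open>Hom(R/Q, E)\<close>, so the lemma serves degree
  \<open>d + 1\<close> and the degrees above alike.\<close>

lemma step_span:
  assumes z: "z \<in> tcyc I (i + 1)" and zQ: "z \<in> tbd Q (i + 1)"
  shows "\<exists>r\<in>S \<times> S' \<rightarrow> carrier R. \<exists>c\<in>tbd I (i + 1).
    z = M.mlin (i + 1) (S \<times> S') r (\<lambda>p. \<delta> i (x (fst p) (snd p))) \<oplus>\<^bsub>\<E> (i + 1)\<^esub> c"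
proof -
  obtain w where w: "w \<in> tors Q i" "z = \<delta> i w" using zQ by (rule tbdE_Suc)
  have wc: "w \<in> carrier (\<E> i)" using tors_carrier[OF w(1)] .
  have "\<forall>l\<in>S. \<exists>s. s \<in> S' \<rightarrow> carrier R \<and> (\<exists>c\<in>tbd I i. y l \<odot>\<^bsub>\<E> i\<^esub> w = M.mlin i S' s b \<oplus>\<^bsub>\<E> i\<^esub> c)"
    using y_tcyc_of_diff[OF w(1)] tcyc_tors[OF z] w(2) B'(4) by blast
  then obtain s where s: "\<And>l. l \<in> S \<Longrightarrow> s l \<in> S' \<rightarrow> carrier R \<and>
      (\<exists>c\<in>tbd I i. y l \<odot>\<^bsub>\<E> i\<^esub> w = M.mlin i S' (s l) b \<oplus>\<^bsub>\<E> i\<^esub> c)" by metis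
  define r where "r = (\<lambda>p. s (fst p) (snd p))"
  have r: "r \<in> S \<times> S' \<rightarrow> carrier R" using s by (auto simp: r_def Pi_iff)
  define u where "u = M.mlin i (S \<times> S') r (\<lambda>p. x (fst p) (snd p))"
  have u: "u \<in> tors Q i" unfolding u_def by (rule mlin_x_tors[OF r])
  have uc: "u \<in> carrier (\<E> i)" using tors_carrier[OF u] .
  define v where "v = w \<ominus>\<^bsub>\<E> i\<^esub> u"
  have v: "v \<in> tors Q i" unfolding v_def by (rule M.submodule_diff[OF tors_sub(1) w(1) u])
  have "y l \<odot>\<^bsub>\<E> i\<^esub> v \<in> tbd I i" if l: "l \<in> S" for l
  proof -
    obtain c where c: "c \<in> tbd I i" "y l \<odot>\<^bsub>\<E> i\<^esub> w = M.mlin i S' (s l) b \<oplus>\<^bsub>\<E> i\<^esub> c" using s l by blast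
    have "y l \<odot>\<^bsub>\<E> i\<^esub> u = M.mlin i S' (s l) b" unfolding u_def y_mlin_x[OF r l] by (simp add: r_def)
    moreover have "M.mlin i S' (s l) b \<in> carrier (\<E> i)" by (rule M.mlin_closed) (use s l B'(3) in auto)
    ultimately have "y l \<odot>\<^bsub>\<E> i\<^esub> v = c"
      unfolding v_def using M.smult_r_diff[OF y_mem_carrier[OF l] wc uc] c
        M.submodule_carrier[OF tbd_sub(2) c(1)] by (simp add: M.add_diff_cancel_left_M)
    then show ?thesis using c(1) by simp
  qed
  then have dv: "\<delta> i v \<in> tbd I (i + 1)" by (rule lift_boundary[OF v])
  have "w = u \<oplus>\<^bsub>\<E> i\<^esub> v" unfolding v_def
    using M.diff_add_cancel_M[OF wc uc] wc uc by (simp add: M.a_comm)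
  then have "z = \<delta> i u \<oplus>\<^bsub>\<E> (i + 1)\<^esub> \<delta> i v"
    using w(2) diff_add[OF uc tors_carrier[OF v]] by simp
  then have "z = M.mlin (i + 1) (S \<times> S') r (\<lambda>p. \<delta> i (x (fst p) (snd p))) \<oplus>\<^bsub>\<E> (i + 1)\<^esub> \<delta> i v"
    unfolding u_def diff_mlin_x[OF r] .
  then show ?thesis using dv r by (intro bexI[of _ r] bexI[of _ "\<delta> i v"])
qed

text \<open>Exactness at the source of the connecting map: a relation among connecting images comes
  from a cocycle of \<open>Hom(R/Q, E)\<close>.\<close>

lemma step_relation:
  assumes r: "r \<in> S \<times> S' \<rightarrow> carrier R"
    and rel: "M.mlin (i + 1) (S \<times> S') r (\<lambda>p. \<delta> i (x (fst p) (snd p))) \<in> tbd I (i + 1)"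
  shows "\<exists>v\<in>tcyc Q i. \<forall>l\<in>S. y l \<odot>\<^bsub>\<E> i\<^esub> v = M.mlin i S' (\<lambda>k. r (l, k)) b"
proof -
  obtain c where c: "c \<in> tors I i"
    "M.mlin (i + 1) (S \<times> S') r (\<lambda>p. \<delta> i (x (fst p) (snd p))) = \<delta> i c" using rel by (rule tbdE_Suc)
  define u where "u = M.mlin i (S \<times> S') r (\<lambda>p. x (fst p) (snd p))"
  have u: "u \<in> tors Q i" unfolding u_def by (rule mlin_x_tors[OF r])
  have uc: "u \<in> carrier (\<E> i)" and cc: "c \<in> carrier (\<E> i)" using u c tors_carrier by auto
  define v where "v = u \<ominus>\<^bsub>\<E> i\<^esub> c"
  have "v \<in> tors Q i" unfolding v_def by (rule M.submodule_diff[OF tors_sub(1) u tors_J1_sub[OF c(1)]])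
  moreover have "\<delta> i v = \<zero>\<^bsub>\<E> (i + 1)\<^esub>"
    unfolding v_def using diff_minus[OF uc cc] diff_mlin_x[OF r] c(2) diff_closed[OF cc]
    by (simp add: u_def M.diff_self_M)
  moreover have "y l \<odot>\<^bsub>\<E> i\<^esub> v = M.mlin i S' (\<lambda>k. r (l, k)) b" if l: "l \<in> S" for l
  proof -
    have "M.mlin i S' (\<lambda>k. r (l, k)) b \<in> carrier (\<E> i)"
      by (rule M.mlin_closed) (use r l B'(3) in auto)
    then show ?thesis
      unfolding v_def using M.smult_r_diff[OF y_mem_carrier[OF l] uc cc] y_mlin_x[OF r l]
        y_kills[OF c(1) l] by (simp add: u_def M.diff_zero_M)
  qed
  ultimately show ?thesis by (intro bexI[of _ v]) (auto simp: tcyc_def)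
qed

text \<open>The hypotheses say that \<open>Hom(R/Q, E)\<close> has no cohomology in degrees
  \<open>i\<close> and \<open>i + 1\<close>, so the connecting map is an isomorphism from the
  \<open>S\<close>-th power of the cohomology in degree \<open>i\<close>.\<close>

lemma cobasis_step_above:
  assumes "i \<noteq> d" "i + 1 \<noteq> d"
  shows "cobasis (i + 1) I (S \<times> S') (\<lambda>p. \<delta> i (x (fst p) (snd p)))"
  unfolding cobasis_def
proof (intro conjI ballI impI)
  show "finite (S \<times> S')" by (rule finite_SS')
  show "(\<lambda>p. \<delta> i (x (fst p) (snd p))) \<in> S \<times> S' \<rightarrow> tcyc I (i + 1)" using diff_x_tcyc by auto
  show "\<exists>r\<in>S \<times> S' \<rightarrow> carrier R. \<exists>c\<in>tbd I (i + 1).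
      z = M.mlin (i + 1) (S \<times> S') r (\<lambda>p. \<delta> i (x (fst p) (snd p))) \<oplus>\<^bsub>\<E> (i + 1)\<^esub> c"
    if "z \<in> tcyc I (i + 1)" for z
    by (rule step_span[OF that]) (use tcyc_J1_sub[OF that] conc'(4)[OF assms(2)] in blast)
  fix r p assume r: "r \<in> S \<times> S' \<rightarrow> carrier R"
    and rel: "M.mlin (i + 1) (S \<times> S') r (\<lambda>p. \<delta> i (x (fst p) (snd p))) \<in> tbd I (i + 1)"
    and p: "p \<in> S \<times> S'"
  obtain l k where lk: "p = (l, k)" "l \<in> S" "k \<in> S'" using p by auto
  obtain v where v: "v \<in> tcyc Q i" "y l \<odot>\<^bsub>\<E> i\<^esub> v = M.mlin i S' (\<lambda>k. r (l, k)) b"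
    using step_relation[OF r rel] lk(2) by blast
  have "v \<in> tbd Q i" using v(1) conc'(4)[OF assms(1)] by blast
  then have "M.mlin i S' (\<lambda>k. r (l, k)) b \<in> tbd I i" using y_tbd[OF _ lk(2)] v(2) by metis
  then show "r p \<in> I" using B'(5)[of "\<lambda>k. r (l, k)" k] r lk by auto
qed

end

text \<open>\<open>x l k\<close> lifts the vector with \<open>b k\<close> in place \<open>l\<close>
  and zeros elsewhere, so its differential represents the connecting image of that vector.\<close>

lemma exists_connecting_lifts:
  assumes "cobasis i I S' b"
  shows "\<exists>x. (\<forall>l\<in>S. \<forall>k\<in>S'. x l k \<in> tors Q i) \<and> (\<forall>l\<in>S. \<forall>k\<in>S'. \<forall>l'\<in>S.
      y l' \<odot>\<^bsub>\<E> i\<^esub> x l k = (if l' = l then b k else \<zero>\<^bsub>\<E> i\<^esub>))"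
proof -
  have "\<exists>w\<in>tors Q i. \<forall>l'\<in>S. y l' \<odot>\<^bsub>\<E> i\<^esub> w = (if l' = l then b k else \<zero>\<^bsub>\<E> i\<^esub>)"
    if "k \<in> S'" for l k
  proof (rule solve)
    show "(if l' = l then b k else \<zero>\<^bsub>\<E> i\<^esub>) \<in> tors I i" for l'
      using cobasisD(2)[OF assms] that tcyc_tors M.submodule_zero[OF tors_sub(2)] by auto
  qed
  then have "\<forall>l k. \<exists>w. k \<in> S' \<longrightarrow> w \<in> tors Q i \<and>
      (\<forall>l'\<in>S. y l' \<odot>\<^bsub>\<E> i\<^esub> w = (if l' = l then b k else \<zero>\<^bsub>\<E> i\<^esub>))" by blast
  then obtain x where "\<forall>l k. k \<in> S' \<longrightarrow> x l k \<in> tors Q i \<and>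
      (\<forall>l'\<in>S. y l' \<odot>\<^bsub>\<E> i\<^esub> x l k = (if l' = l then b k else \<zero>\<^bsub>\<E> i\<^esub>))" by metis
  then show ?thesis by (intro exI[of _ x]) auto
qed

lemma rank_step_above:
  assumes "\<exists>b. cobasis i I {..<n} b" "i > d"
  shows "\<exists>b. cobasis (i + 1) I {..<card S * n} b"
proof -
  obtain b where b: "cobasis i I {..<n} b" using assms(1) by blast
  obtain x where x: "\<And>l k. l \<in> S \<Longrightarrow> k \<in> {..<n} \<Longrightarrow> x l k \<in> tors Q i"
    "\<And>l k l'. l \<in> S \<Longrightarrow> k \<in> {..<n} \<Longrightarrow> l' \<in> S \<Longrightarrow>
      y l' \<odot>\<^bsub>\<E> i\<^esub> x l k = (if l' = l then b k else \<zero>\<^bsub>\<E> i\<^esub>)"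
    using exists_connecting_lifts[OF b] by blast
  have "cobasis (i + 1) I (S \<times> {..<n}) (\<lambda>p. \<delta> i (x (fst p) (snd p)))"
    by (rule cobasis_step_above[OF b x]) (use assms(2) in auto)
  from cobasis_lessThan[OF this] show ?thesis by (simp add: card_cartesian_product)
qed

text \<open>The map \<open>R/Q \<rightarrow> H\<^sup>d(Hom(R/I, E))\<^sup>S\<close> sends the class of \<open>e\<close> to the identity matrix, so in
  degree \<open>d + 1\<close> the connecting images satisfy the single relation \<open>\<Sum>\<^sub>l \<delta> x\<^sub>l\<^sub>l = 0\<close>.\<close>

lemma rank_step_at_d:
  assumes "0 \<le> d"
  shows "\<exists>b. cobasis (d + 1) I {..<(card S)\<^sup>2 - 1} b"
proof -
  define b where "b = (\<lambda>k. y k \<odot>\<^bsub>\<E> d\<^esub> e)"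
  have B: "cobasis d I S b" unfolding b_def by (rule cobasis_at_d[OF assms])
  note c = cobasisD[OF B]
  obtain x where x: "\<And>l k. l \<in> S \<Longrightarrow> k \<in> S \<Longrightarrow> x l k \<in> tors Q d"
    "\<And>l k l'. l \<in> S \<Longrightarrow> k \<in> S \<Longrightarrow> l' \<in> S \<Longrightarrow>
      y l' \<odot>\<^bsub>\<E> d\<^esub> x l k = (if l' = l then b k else \<zero>\<^bsub>\<E> d\<^esub>)"
    using exists_connecting_lifts[OF B] by blast
  define f where "f = (\<lambda>p. \<delta> d (x (fst p) (snd p)))"
  have fin: "finite (S \<times> S)" using finite_S by simp
  have f: "f \<in> S \<times> S \<rightarrow> tcyc I (d + 1)" using diff_x_tcyc[OF B x] by (auto simp: f_def)
  then have fc: "f \<in> S \<times> S \<rightarrow> carrier (\<E> (d + 1))" using tcyc_carrier[of _ I "d + 1"] by blast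
  \<comment> \<open>The relation has coefficient 1 at every diagonal pair, so one of them,
    \<open>(l0, l0)\<close>, can be eliminated.\<close>
  obtain l0 where l0: "l0 \<in> S" using S_nonempty by blast
  let ?p0 = "(l0, l0)"
  let ?T = "S \<times> S - {?p0}"
  define diag where "diag = (\<lambda>p :: 'i \<times> 'i. if fst p = snd p then \<one> else \<zero>)"
  have diagc: "diag \<in> S \<times> S \<rightarrow> carrier R" by (auto simp: diag_def)
  have trace: "M.mlin (d + 1) (S \<times> S) diag f \<in> tbd I (d + 1)"
  proof -
    \<comment> \<open>The sum of the diagonal lifts. It agrees with \<open>e\<close> after
      multiplication by each \<open>y l\<close>, so \<open>u - e\<close> is
      \<open>I\<close>-torsion; as \<open>e\<close> is a cocycle, the differential of
      \<open>u\<close> bounds.\<close>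
    define u where "u = M.mlin d (S \<times> S) diag (\<lambda>p. x (fst p) (snd p))"
    have u: "u \<in> tors Q d" unfolding u_def by (rule mlin_x_tors[OF B x diagc])
    have uc: "u \<in> carrier (\<E> d)" using tors_carrier[OF u] .
    have "y l \<odot>\<^bsub>\<E> d\<^esub> (u \<ominus>\<^bsub>\<E> d\<^esub> e) = \<zero>\<^bsub>\<E> d\<^esub>" if l: "l \<in> S" for l
    proof -
      have "y l \<odot>\<^bsub>\<E> d\<^esub> u = M.mlin d S (\<lambda>k. diag (l, k)) b"
        unfolding u_def by (rule y_mlin_x[OF B x diagc l])
      also have "(\<lambda>k. diag (l, k)) = (\<lambda>k. if k = l then \<one> else \<zero>)" by (auto simp: diag_def)
      also have "M.mlin d S (\<lambda>k. if k = l then \<one> else \<zero>) b = b l" by (rule M.mlin_unit[OF finite_S l c(3)])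
      finally show ?thesis
        using M.smult_r_diff[OF y_mem_carrier[OF l] uc e_facts(2)] y_mem_carrier[OF l] e_facts(2)
        by (simp add: b_def M.diff_self_M)
    qed
    then have "u \<ominus>\<^bsub>\<E> d\<^esub> e \<in> tors I d"
      using tors_J1_I M.submodule_diff[OF tors_sub(1) u e_facts(3)] by blast
    then have "\<delta> d (u \<ominus>\<^bsub>\<E> d\<^esub> e) \<in> tbd I (d + 1)" by (rule diff_tbd)
    moreover have "\<delta> d (u \<ominus>\<^bsub>\<E> d\<^esub> e) = \<delta> d u"
      using diff_minus[OF uc e_facts(2)] tcyc_diff[OF e_facts(1)] diff_closed[OF uc]
      by (simp add: M.diff_zero_M)
    moreover have "\<delta> d u = M.mlin (d + 1) (S \<times> S) diag f"
      unfolding u_def f_def by (rule diff_mlin_x[OF B x diagc])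
    ultimately show ?thesis by simp
  qed
  have span: "\<exists>r\<in>?T \<rightarrow> carrier R. \<exists>g\<in>tbd I (d + 1).
      z = M.mlin (d + 1) ?T r f \<oplus>\<^bsub>\<E> (d + 1)\<^esub> g" if z: "z \<in> tcyc I (d + 1)" for z
  proof -
    have "z \<in> tbd Q (d + 1)" using tcyc_J1_sub[OF z] conc'(4)[of "d + 1"] by auto
    then obtain r g where r: "r \<in> S \<times> S \<rightarrow> carrier R" and g: "g \<in> tbd I (d + 1)"
      "z = M.mlin (d + 1) (S \<times> S) r f \<oplus>\<^bsub>\<E> (d + 1)\<^esub> g"
      using step_span[OF B x z] unfolding f_def by blast
    define a where "a = r ?p0"
    have a: "a \<in> carrier R" using r l0 by (auto simp: a_def)
    \<comment> \<open>Subtracting \<open>a\<close> times the relation cancels the coefficient at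
      \<open>(l0, l0)\<close> and changes the sum only by a coboundary.\<close>
    define s where "s = (\<lambda>p. r p \<ominus> a \<otimes> diag p)"
    have s: "s \<in> S \<times> S \<rightarrow> carrier R" using r a diagc by (auto simp: s_def Pi_iff)
    have ad: "(\<lambda>p. a \<otimes> diag p) \<in> S \<times> S \<rightarrow> carrier R" using a diagc by (auto simp: Pi_iff)
    have "s ?p0 = \<zero>" using a by (simp add: s_def a_def diag_def minus_eq r_neg)
    define D where "D = M.mlin (d + 1) (S \<times> S) diag f"
    have D: "D \<in> tbd I (d + 1)" using trace by (simp add: D_def)
    have Dc: "D \<in> carrier (\<E> (d + 1))" using M.submodule_carrier[OF tbd_sub(2) D] .
    have gc: "g \<in> carrier (\<E> (d + 1))" using M.submodule_carrier[OF tbd_sub(2) g(1)] .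
    let ?m = "M.mlin (d + 1) (S \<times> S) r f"
    have mc: "?m \<in> carrier (\<E> (d + 1))" by (rule M.mlin_closed[OF r fc])
    have "M.mlin (d + 1) ?T s f = M.mlin (d + 1) (S \<times> S) s f"
    proof (rule M.mlin_superset_zero[symmetric, OF fin _ s fc])
      fix k assume "k \<in> S \<times> S - ?T"
      then have "k = ?p0" by auto
      then show "s k \<odot>\<^bsub>\<E> (d + 1)\<^esub> f k = \<zero>\<^bsub>\<E> (d + 1)\<^esub>"
        using \<open>s ?p0 = \<zero>\<close> Pi_mem[OF fc, of ?p0] l0 by simp
    qed auto
    also have "\<dots> = ?m \<ominus>\<^bsub>\<E> (d + 1)\<^esub> a \<odot>\<^bsub>\<E> (d + 1)\<^esub> D"
      unfolding s_def M.mlin_diff[OF fin r ad fc] M.mlin_scale[OF fin a diagc fc] D_def ..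
    finally have "?m = M.mlin (d + 1) ?T s f \<oplus>\<^bsub>\<E> (d + 1)\<^esub> a \<odot>\<^bsub>\<E> (d + 1)\<^esub> D"
      using M.diff_add_cancel_M[OF mc, of "a \<odot>\<^bsub>\<E> (d + 1)\<^esub> D"] a Dc by simp
    moreover have "M.mlin (d + 1) ?T s f \<in> carrier (\<E> (d + 1))"
      by (rule M.mlin_closed) (use s fc in auto)
    ultimately have "z = M.mlin (d + 1) ?T s f \<oplus>\<^bsub>\<E> (d + 1)\<^esub> (a \<odot>\<^bsub>\<E> (d + 1)\<^esub> D \<oplus>\<^bsub>\<E> (d + 1)\<^esub> g)"
      using g(2) a Dc gc by (simp add: M.a_assoc)
    moreover have "a \<odot>\<^bsub>\<E> (d + 1)\<^esub> D \<oplus>\<^bsub>\<E> (d + 1)\<^esub> g \<in> tbd I (d + 1)"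
      by (intro M.submoduleE(5)[OF tbd_sub(2)] M.submoduleE(4)[OF tbd_sub(2)] a D g)
    moreover have "s \<in> ?T \<rightarrow> carrier R" using s by auto
    ultimately show ?thesis by blast
  qed
  have indep: "r p \<in> I" if rT: "r \<in> ?T \<rightarrow> carrier R" and rel: "M.mlin (d + 1) ?T r f \<in> tbd I (d + 1)"
    and p: "p \<in> ?T" for r p
  proof -
    \<comment> \<open>\<open>r\<close> extended by zero at the removed pair. A relation comes from a
      cocycle \<open>v = a e + g\<close>, so that as a matrix \<open>s\<close> is \<open>a\<close>
      times the identity modulo \<open>I\<close>.\<close>
    define s where "s = (\<lambda>q. if q = ?p0 then \<zero> else r q)"
    have s: "s \<in> S \<times> S \<rightarrow> carrier R" using rT by (auto simp: s_def Pi_iff)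
    have "M.mlin (d + 1) (S \<times> S) s f = M.mlin (d + 1) ?T s f"
    proof (rule M.mlin_superset_zero[OF fin _ s fc])
      fix k assume "k \<in> S \<times> S - ?T"
      then have "k = ?p0" by auto
      then show "s k \<odot>\<^bsub>\<E> (d + 1)\<^esub> f k = \<zero>\<^bsub>\<E> (d + 1)\<^esub>"
        using Pi_mem[OF fc, of ?p0] l0 by (simp add: s_def)
    qed auto
    also have "\<dots> = M.mlin (d + 1) ?T r f"
      by (rule M.mlin_cong) (use rT fc in \<open>auto simp: s_def\<close>)
    finally have "M.mlin (d + 1) (S \<times> S) s f \<in> tbd I (d + 1)" using rel by simp
    then obtain v where v: "v \<in> tcyc Q d" "\<And>l. l \<in> S \<Longrightarrow> y l \<odot>\<^bsub>\<E> d\<^esub> v = M.mlin d S (\<lambda>k. s (l, k)) b"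
      using step_relation[OF B x s] unfolding f_def by blast
    obtain a g where ag: "a \<in> carrier R" "g \<in> tbd Q d" "v = a \<odot>\<^bsub>\<E> d\<^esub> e \<oplus>\<^bsub>\<E> d\<^esub> g"
      using conc'(2)[OF v(1)] by blast
    have gc: "g \<in> carrier (\<E> d)" using M.submodule_carrier[OF tbd_sub(1) ag(2)] .
    have mem: "s (l, k) \<ominus> a \<otimes> (if k = l then \<one> else \<zero>) \<in> I" if l: "l \<in> S" and k: "k \<in> S" for l k
    proof -
      let ?u = "\<lambda>k. if k = l then \<one> else \<zero>"
      have yl: "y l \<in> carrier R" using y_mem_carrier[OF l] .
      have sl: "(\<lambda>k. s (l, k)) \<in> S \<rightarrow> carrier R" using s l by auto
      have u: "?u \<in> S \<rightarrow> carrier R" "(\<lambda>k. a \<otimes> ?u k) \<in> S \<rightarrow> carrier R" using ag(1) by auto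
      have bl: "b l \<in> carrier (\<E> d)" using c(3) l by auto
      have ygc: "y l \<odot>\<^bsub>\<E> d\<^esub> g \<in> carrier (\<E> d)" using yl gc by simp
      have "M.mlin d S (\<lambda>k. s (l, k)) b = y l \<odot>\<^bsub>\<E> d\<^esub> (a \<odot>\<^bsub>\<E> d\<^esub> e) \<oplus>\<^bsub>\<E> d\<^esub> y l \<odot>\<^bsub>\<E> d\<^esub> g"
        unfolding v(2)[OF l, symmetric] ag(3) using yl ag(1) e_facts(2) gc
        by (simp add: M.smult_r_distr)
      also have "y l \<odot>\<^bsub>\<E> d\<^esub> (a \<odot>\<^bsub>\<E> d\<^esub> e) = a \<odot>\<^bsub>\<E> d\<^esub> b l"
        unfolding b_def using yl ag(1) e_facts(2) by (metis M.smult_assoc1 m_comm)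
      finally have 1: "M.mlin d S (\<lambda>k. s (l, k)) b = a \<odot>\<^bsub>\<E> d\<^esub> b l \<oplus>\<^bsub>\<E> d\<^esub> y l \<odot>\<^bsub>\<E> d\<^esub> g" .
      have "M.mlin d S (\<lambda>k. s (l, k) \<ominus> a \<otimes> ?u k) b = y l \<odot>\<^bsub>\<E> d\<^esub> g"
        unfolding M.mlin_diff[OF finite_S sl u(2) c(3)] M.mlin_scale[OF finite_S ag(1) u(1) c(3)]
          M.mlin_unit[OF finite_S l c(3)] 1
        using ag(1) bl ygc by (simp add: M.add_diff_cancel_left_M)
      then have "M.mlin d S (\<lambda>k. s (l, k) \<ominus> a \<otimes> ?u k) b \<in> tbd I d" using y_tbd[OF ag(2) l] by simp
      moreover have "(\<lambda>k. s (l, k) \<ominus> a \<otimes> ?u k) \<in> S \<rightarrow> carrier R" using sl u(2) by (auto simp: Pi_iff)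
      ultimately show ?thesis using c(5) k by blast
    qed
    \<comment> \<open>The entry at the removed pair is zero, which puts \<open>a\<close> into
      \<open>I\<close>; then all entries are in \<open>I\<close>.\<close>
    have "s ?p0 \<ominus> a \<otimes> \<one> \<in> I" using mem[OF l0 l0] by simp
    then have "\<ominus> a \<in> I" using ag(1) by (simp add: s_def minus_eq)
    then have "\<ominus> (\<ominus> a) \<in> I" using ideal_neg_mem[OF ideals(2)] by blast
    then have aI: "a \<in> I" using ag(1) by simp
    obtain l k where lk: "p = (l, k)" "l \<in> S" "k \<in> S" "p \<noteq> ?p0" using p by auto
    let ?w = "if k = l then \<one> else \<zero>"
    have wc: "?w \<in> carrier R" by simp
    have sp: "s p \<in> carrier R" using s p by auto
    have "s p \<ominus> a \<otimes> ?w \<in> I" using mem[OF lk(2,3)] lk(1) by simp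
    moreover have "a \<otimes> ?w \<in> I" by (rule ideal_rmult_mem[OF ideals(2) aI wc])
    ultimately have "(s p \<ominus> a \<otimes> ?w) \<oplus> a \<otimes> ?w \<in> I" by (rule ideal_add_mem[OF ideals(2)])
    moreover have "(s p \<ominus> a \<otimes> ?w) \<oplus> a \<otimes> ?w = s p" using sp ag(1) wc by algebra
    ultimately show ?thesis using lk(4) by (simp add: s_def)
  qed
  have "cobasis (d + 1) I ?T f"
    unfolding cobasis_def using fin f span indep by (intro conjI ballI impI) auto
  moreover have "card ?T = (card S)\<^sup>2 - 1"
    using l0 fin by (simp add: card_Diff_singleton card_cartesian_product power2_eq_square)
  ultimately show ?thesis using cobasis_lessThan by metis
qed

text \<open>The recursion \<open>u (i + 1) = t * u i\<close> runs from degree \<open>d + 1\<close>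
  on, where the exponent in \<open>ulrich_mult\<close> starts at 0; degrees \<open>d\<close> and
  \<open>d + 1\<close> have been computed on their own.\<close>

theorem cobasis_ulrich_mult:
  assumes d: "d = int n"
  shows "\<exists>b. cobasis i I {..<ulrich_mult n (card S) i} b"
proof -
  have d0: "0 \<le> d" using d by simp
  consider "i < d" | "i = d" | "d + 1 \<le> i" by linarith
  then show ?thesis
  proof cases
    case 1
    then have "cobasis i I {} (\<lambda>_ :: nat. \<zero>\<^bsub>\<E> i\<^esub>)"
      using cobasis_empty acyclic_below d0 ideals_carrier(2) by blast
    then show ?thesis using 1 d by (auto simp: ulrich_mult_def)
  next
    case 2
    then show ?thesis
      using cobasis_lessThan[OF cobasis_at_d[OF d0]] d by (simp add: ulrich_mult_def)
  next
    case 3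
    then show ?thesis
    proof (induction i rule: int_ge_induct)
      case base
      then show ?case using rank_step_at_d[OF d0] d by (simp add: ulrich_mult_def)
    next
      case (step i)
      have "card S * ulrich_mult n (card S) i = ulrich_mult n (card S) (i + 1)"
      proof -
        have "nat (i + 1 - int n - 1) = Suc (nat (i - int n - 1))" using step.hyps d by linarith
        then show ?thesis using step.hyps d by (simp add: ulrich_mult_def)
      qed
      then show ?case using rank_step_above[OF step.IH] step.hyps by simp
    qed
  qed
qed

end

section \<open>Quotient modules and cohomology\<close>

lemma quot_module_simps:
  "carrier (quot_module M N) = {N +>\<^bsub>M\<^esub> x | x. x \<in> carrier M}"
  "\<zero>\<^bsub>quot_module M N\<^esub> = N"
  "A \<oplus>\<^bsub>quot_module M N\<^esub> B = A <+>\<^bsub>M\<^esub> B"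
  by (auto simp: quot_module_def A_RCOSETS_def')

context module
begin

lemma submodule_abelian_subgroup: "submodule N R M \<Longrightarrow> abelian_subgroup N M"
  by (intro abelian_subgroupI3 additive_subgroupI) (auto simp: submodule_def M.abelian_group_axioms)

lemma coset_eq_iff:
  assumes N: "submodule N R M" and x: "x \<in> carrier M" and y: "y \<in> carrier M"
  shows "N +>\<^bsub>M\<^esub> x = N +>\<^bsub>M\<^esub> y \<longleftrightarrow> x \<ominus>\<^bsub>M\<^esub> y \<in> N"
proof -
  interpret N: abelian_subgroup N M using N by (rule submodule_abelian_subgroup)
  show ?thesis
    using N.a_rcos_module[OF y x] N.a_repr_independence'[of x y]
      N.a_rcos_self[OF x] x y by (auto simp: M.minus_eq)
qed

lemma coset_eq_self_iff:
  assumes N: "submodule N R M" and x: "x \<in> carrier M"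
  shows "N +>\<^bsub>M\<^esub> x = N \<longleftrightarrow> x \<in> N"
proof -
  have "N +>\<^bsub>M\<^esub> \<zero>\<^bsub>M\<^esub> = N" using M.a_coset_add_zero submoduleE(1)[OF N] by blast
  then show ?thesis using coset_eq_iff[OF N x M.zero_closed] x by (simp add: diff_zero_M)
qed

lemma coset_add:
  assumes "submodule N R M" "x \<in> carrier M" "y \<in> carrier M"
  shows "(N +>\<^bsub>M\<^esub> x) <+>\<^bsub>M\<^esub> (N +>\<^bsub>M\<^esub> y) = N +>\<^bsub>M\<^esub> (x \<oplus>\<^bsub>M\<^esub> y)"
  using abelian_subgroup.a_rcos_sum[OF submodule_abelian_subgroup[OF assms(1)]] assms(2,3) by blast

lemma mem_coset: "submodule N R M \<Longrightarrow> x \<in> carrier M \<Longrightarrow> x \<in> N +>\<^bsub>M\<^esub> x"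
  using abelian_subgroup.a_rcos_self[OF submodule_abelian_subgroup] by blast

lemma coset_memD:
  assumes "submodule N R M" "y \<in> carrier M" "x \<in> N +>\<^bsub>M\<^esub> y"
  shows "x \<in> carrier M" "x \<ominus>\<^bsub>M\<^esub> y \<in> N"
proof -
  obtain n where n: "n \<in> N" "x = n \<oplus>\<^bsub>M\<^esub> y" using assms(3) by (auto simp: a_r_coset_def')
  then have "n \<in> carrier M" using submodule_carrier[OF assms(1)] by blast
  then show "x \<in> carrier M" "x \<ominus>\<^bsub>M\<^esub> y \<in> N" using n assms(2) by (auto simp: add_diff_cancel_M)
qed

end

context
  fixes R (structure) and M :: "('a, 'c) module"
  assumes M: "module R M"
begin

interpretation module R M by (rule M)

text \<open>Scalar multiplication preserves \<open>N\<close>, so all members of a coset contribute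
  the same coset to the union, and the coset is nonempty.\<close>

lemma quot_module_smult:
  assumes N: "submodule N R M" and r: "r \<in> carrier R" and y: "y \<in> carrier M"
  shows "r \<odot>\<^bsub>quot_module M N\<^esub> (N +>\<^bsub>M\<^esub> y) = N +>\<^bsub>M\<^esub> (r \<odot>\<^bsub>M\<^esub> y)"
proof -
  have "N +>\<^bsub>M\<^esub> (r \<odot>\<^bsub>M\<^esub> x) = N +>\<^bsub>M\<^esub> (r \<odot>\<^bsub>M\<^esub> y)" if "x \<in> N +>\<^bsub>M\<^esub> y" for x
  proof -
    note x = coset_memD[OF N y that]
    have "r \<odot>\<^bsub>M\<^esub> x \<ominus>\<^bsub>M\<^esub> r \<odot>\<^bsub>M\<^esub> y \<in> N"
      using submoduleE(4)[OF N r x(2)] smult_r_diff[OF r x(1) y] by simp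
    then show ?thesis using coset_eq_iff[OF N] r x(1) y by simp
  qed
  then have "(\<Union>x\<in>N +>\<^bsub>M\<^esub> y. N +>\<^bsub>M\<^esub> (r \<odot>\<^bsub>M\<^esub> x)) = (\<Union>x\<in>N +>\<^bsub>M\<^esub> y. N +>\<^bsub>M\<^esub> (r \<odot>\<^bsub>M\<^esub> y))"
    by (intro SUP_cong) auto
  also have "\<dots> = N +>\<^bsub>M\<^esub> (r \<odot>\<^bsub>M\<^esub> y)" using mem_coset[OF N y] by (intro SUP_const) blast
  finally show ?thesis by (simp add: quot_module_def)
qed

lemma quot_module_module:
  assumes N: "submodule N R M"
  shows "module R (quot_module M N)"
proof (rule moduleI[OF is_cring])
  have N0: "N +>\<^bsub>M\<^esub> \<zero>\<^bsub>M\<^esub> = N" using coset_eq_self_iff[OF N M.zero_closed] submodule_zero[OF N] by simp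
  show "abelian_group (quot_module M N)"
  proof (rule abelian_groupI)
    show "\<zero>\<^bsub>quot_module M N\<^esub> \<in> carrier (quot_module M N)"
      unfolding quot_module_simps using N0 M.zero_closed by (intro CollectI exI[of _ "\<zero>\<^bsub>M\<^esub>"]) simp
    fix A assume "A \<in> carrier (quot_module M N)"
    then obtain x where x: "x \<in> carrier M" "A = N +>\<^bsub>M\<^esub> x" by (auto simp: quot_module_simps)
    show "\<zero>\<^bsub>quot_module M N\<^esub> \<oplus>\<^bsub>quot_module M N\<^esub> A = A"
      using coset_add[OF N M.zero_closed x(1)] x N0 by (simp add: quot_module_simps)
    show "\<exists>B\<in>carrier (quot_module M N). B \<oplus>\<^bsub>quot_module M N\<^esub> A = \<zero>\<^bsub>quot_module M N\<^esub>"
      using coset_add[OF N M.a_inv_closed[OF x(1)] x(1)] x N0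
      by (intro bexI[of _ "N +>\<^bsub>M\<^esub> (\<ominus>\<^bsub>M\<^esub> x)"]) (auto simp: quot_module_simps M.l_neg)
  qed (auto simp: quot_module_simps coset_add[OF N] M.a_ac)
qed (auto simp: quot_module_simps quot_module_smult[OF N] coset_add[OF N]
    smult_l_distr smult_r_distr smult_assoc1)

lemma module_hom_zero:
  assumes N: "module R N" and f: "f \<in> module_hom R M N"
  shows "f \<zero>\<^bsub>M\<^esub> = \<zero>\<^bsub>N\<^esub>"
proof -
  interpret N: module R N by (rule N)
  have "f (\<zero> \<odot>\<^bsub>M\<^esub> \<zero>\<^bsub>M\<^esub>) = \<zero> \<odot>\<^bsub>N\<^esub> f \<zero>\<^bsub>M\<^esub>" using f by (simp add: module_hom_def del: smult_r_null smult_l_null)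
  moreover have "f \<zero>\<^bsub>M\<^esub> \<in> carrier N" using f by (auto simp: module_hom_def)
  ultimately show ?thesis by simp
qed

lemma module_hom_diff:
  assumes N: "module R N" and f: "f \<in> module_hom R M N" and x: "x \<in> carrier M" "y \<in> carrier M"
  shows "f (x \<ominus>\<^bsub>M\<^esub> y) = f x \<ominus>\<^bsub>N\<^esub> f y"
proof -
  interpret N: module R N by (rule N)
  have fc: "f z \<in> carrier N" if "z \<in> carrier M" for z using f that by (auto simp: module_hom_def)
  have "f ((x \<ominus>\<^bsub>M\<^esub> y) \<oplus>\<^bsub>M\<^esub> y) = f (x \<ominus>\<^bsub>M\<^esub> y) \<oplus>\<^bsub>N\<^esub> f y"
    using f x by (simp add: module_hom_def)
  then show ?thesis using diff_add_cancel_M[OF x] N.add_diff_cancel_M fc x by simp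
qed

end

lemma module_homD:
  assumes "f \<in> module_hom R M N"
  shows "x \<in> carrier M \<Longrightarrow> f x \<in> carrier N"
    and "x \<in> carrier M \<Longrightarrow> y \<in> carrier M \<Longrightarrow> f (x \<oplus>\<^bsub>M\<^esub> y) = f x \<oplus>\<^bsub>N\<^esub> f y"
    and "r \<in> carrier R \<Longrightarrow> x \<in> carrier M \<Longrightarrow> f (r \<odot>\<^bsub>M\<^esub> x) = r \<odot>\<^bsub>N\<^esub> f x"
  using assms by (auto simp: module_hom_def)

text \<open>The natural map goes from the power of the residue module to cohomology, while the
  result is stated in the opposite direction.\<close>

lemma module_isoI_inverse:
  assumes M: "module R M" and N: "module R N" and f: "f \<in> module_hom R M N"
    and bij: "bij_betw f (carrier M) (carrier N)"
  shows "module_iso R N M"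
proof -
  interpret M: module R M by (rule M)
  interpret N: module R N by (rule N)
  define g where "g = inv_into (carrier M) f"
  have gc: "g y \<in> carrier M" "f (g y) = y" if "y \<in> carrier N" for y
    using that bij unfolding g_def by (auto simp: bij_betw_def inv_into_into f_inv_into_f)
  have gf: "g (f x) = x" if "x \<in> carrier M" for x
    using that bij unfolding g_def by (auto simp: bij_betw_def)
  note hf = module_homD[OF f]
  have "g \<in> module_hom R N M"
    unfolding module_hom_def
  proof (intro CollectI conjI ballI)
    show "g \<in> carrier N \<rightarrow> carrier M" using gc by auto
    show "g (x \<oplus>\<^bsub>N\<^esub> y) = g x \<oplus>\<^bsub>M\<^esub> g y" if "x \<in> carrier N" "y \<in> carrier N" for x y
      using hf(2)[of "g x" "g y"] gc that gf[of "g x \<oplus>\<^bsub>M\<^esub> g y"] by simp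
    show "g (r \<odot>\<^bsub>N\<^esub> x) = r \<odot>\<^bsub>M\<^esub> g x" if "r \<in> carrier R" "x \<in> carrier N" for r x
      using hf(3)[of r "g x"] gc that gf[of "r \<odot>\<^bsub>M\<^esub> g x"] by simp
  qed
  moreover have "bij_betw g (carrier N) (carrier M)"
    unfolding g_def using bij by (rule bij_betw_inv_into)
  ultimately show ?thesis using M N by (auto simp: module_iso_def)
qed

context cring
begin

context
  fixes C :: "('a, 'c) cochain"
  assumes C: "cochain_complex R C"
begin

lemma obj_module: "module R (obj C i)"
  using C by (simp add: cochain_complex_def)

lemma diff_hom: "diff C i \<in> module_hom R (obj C i) (obj C (i + 1))"
  using C by (simp add: cochain_complex_def)

lemma cocycles_submodule: "submodule (cocycles C i) R (obj C i)"
proof -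
  interpret M: module R "obj C i" by (rule obj_module)
  interpret N: module R "obj C (i + 1)" by (rule obj_module)
  note h = module_homD[OF diff_hom[of i]]
  show ?thesis
    by (rule M.submoduleI_add_smult)
      (auto simp: cocycles_def h module_hom_zero[OF M.module_axioms N.module_axioms diff_hom])
qed

lemma coboundaries_submodule: "submodule (coboundaries C i) R (obj C i)"
proof -
  interpret M: module R "obj C (i - 1)" by (rule obj_module)
  interpret N: module R "obj C i" by (rule obj_module)
  have d: "diff C (i - 1) \<in> module_hom R (obj C (i - 1)) (obj C i)" using diff_hom[of "i - 1"] by simp
  note h = module_homD[OF d]
  show ?thesis unfolding coboundaries_def
  proof (rule N.submoduleI_add_smult)
    show "\<zero>\<^bsub>obj C i\<^esub> \<in> diff C (i - 1) ` carrier (obj C (i - 1))"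
      using module_hom_zero[OF M.module_axioms N.module_axioms d] M.zero_closed by (metis image_eqI)
    show "x \<oplus>\<^bsub>obj C i\<^esub> y \<in> diff C (i - 1) ` carrier (obj C (i - 1))"
      if "x \<in> diff C (i - 1) ` carrier (obj C (i - 1))" "y \<in> diff C (i - 1) ` carrier (obj C (i - 1))" for x y
      using that by (auto simp flip: h(2))
    show "a \<odot>\<^bsub>obj C i\<^esub> x \<in> diff C (i - 1) ` carrier (obj C (i - 1))"
      if "a \<in> carrier R" "x \<in> diff C (i - 1) ` carrier (obj C (i - 1))" for a x
      using that by (auto simp flip: h(3))
  qed (use h(1) in auto)
qed

lemma coboundaries_subset_cocycles: "coboundaries C i \<subseteq> cocycles C i"
proof
  fix z assume "z \<in> coboundaries C i"
  then obtain x where x: "x \<in> carrier (obj C (i - 1))" "z = diff C (i - 1) x"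
    by (auto simp: coboundaries_def)
  have "diff C (i - 1 + 1) (diff C (i - 1) x) = \<zero>\<^bsub>obj C (i - 1 + 2)\<^esub>"
    using C x(1) unfolding cochain_complex_def by blast
  moreover have "i - 1 + 2 = i + 1" by simp
  ultimately have "diff C i z = \<zero>\<^bsub>obj C (i + 1)\<^esub>" using x(2) by (metis diff_add_cancel)
  moreover have "z \<in> carrier (obj C i)" using module_homD(1)[OF diff_hom x(1)] x(2) by simp
  ultimately show "z \<in> cocycles C i" by (simp add: cocycles_def)
qed

lemma cohomology_module: "module R (cohomology C i)"
proof -
  interpret M: module R "obj C i" by (rule obj_module)
  let ?Z = "(obj C i)\<lparr>carrier := cocycles C i\<rparr>"
  have Z: "module R ?Z"
    using submodule.submodule_is_module[OF cocycles_submodule M.module_axioms] .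
  interpret Z: module R ?Z by (rule Z)
  have "submodule (coboundaries C i) R ?Z"
    by (rule Z.submoduleI_add_smult)
      (use coboundaries_subset_cocycles M.submodule_zero[OF coboundaries_submodule]
          M.submoduleE(4,5)[OF coboundaries_submodule] in auto)
  then show ?thesis unfolding cohomology_def by (rule quot_module_module[OF Z])
qed

lemma cohomology_carrier:
  "carrier (cohomology C i) = {coboundaries C i +>\<^bsub>obj C i\<^esub> z | z. z \<in> cocycles C i}"
  by (simp add: cohomology_def quot_module_simps)

lemma cocycles_carrier: "z \<in> cocycles C i \<Longrightarrow> z \<in> carrier (obj C i)"
  by (simp add: cocycles_def)

lemma cohomology_coset_eq_iff:
  assumes "z \<in> carrier (obj C i)" "w \<in> carrier (obj C i)"
  shows "coboundaries C i +>\<^bsub>obj C i\<^esub> z = coboundaries C i +>\<^bsub>obj C i\<^esub> w \<longleftrightarrow>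
    z \<ominus>\<^bsub>obj C i\<^esub> w \<in> coboundaries C i"
  by (rule module.coset_eq_iff[OF obj_module coboundaries_submodule assms])

lemma cohomology_add:
  assumes "z \<in> cocycles C i" "w \<in> cocycles C i"
  shows "(coboundaries C i +>\<^bsub>obj C i\<^esub> z) \<oplus>\<^bsub>cohomology C i\<^esub> (coboundaries C i +>\<^bsub>obj C i\<^esub> w) =
    coboundaries C i +>\<^bsub>obj C i\<^esub> (z \<oplus>\<^bsub>obj C i\<^esub> w)"
  using module.coset_add[OF obj_module coboundaries_submodule] assms cocycles_carrier
  by (simp add: cohomology_def quot_module_simps)

lemma cohomology_smult:
  assumes r: "r \<in> carrier R" and z: "z \<in> cocycles C i"
  shows "r \<odot>\<^bsub>cohomology C i\<^esub> (coboundaries C i +>\<^bsub>obj C i\<^esub> z) =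
    coboundaries C i +>\<^bsub>obj C i\<^esub> (r \<odot>\<^bsub>obj C i\<^esub> z)"
  using quot_module_smult[OF obj_module coboundaries_submodule r cocycles_carrier[OF z]]
  by (simp add: cohomology_def quot_module_def)

end

text \<open>A criterion free of cosets: the first conjunct is injectivity and the second
  surjectivity on cohomology.\<close>

lemma quasi_iso_iff:
  fixes C :: "('a, 'c) cochain" and D :: "('a, 'd) cochain"
  assumes C: "cochain_complex R C" and D: "cochain_complex R D" and f: "chain_map R C D f"
  shows "quasi_iso R C D f \<longleftrightarrow>
    (\<forall>i. \<forall>z\<in>cocycles C i. f i z \<in> coboundaries D i \<longrightarrow> z \<in> coboundaries C i) \<and>
    (\<forall>i. \<forall>w\<in>cocycles D i. \<exists>z\<in>cocycles C i. \<exists>c\<in>coboundaries D i. w = f i z \<oplus>\<^bsub>obj D i\<^esub> c)"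
proof -
  note fh = f[unfolded chain_map_def, rule_format, THEN conjunct1]
  note fd = f[unfolded chain_map_def, rule_format, THEN conjunct2, rule_format]
  have fZ: "f i z \<in> cocycles D i" if "z \<in> cocycles C i" for i z
  proof -
    interpret M: module R "obj C (i + 1)" by (rule obj_module[OF C])
    have "diff D i (f i z) = f (i + 1) \<zero>\<^bsub>obj C (i + 1)\<^esub>"
      using fd[of z i] that by (simp add: cocycles_def)
    then show ?thesis
      using that module_homD(1)[OF fh] module_hom_zero[OF M.module_axioms obj_module[OF D] fh]
      by (simp add: cocycles_def)
  qed
  have fB: "f i z \<in> coboundaries D i" if z: "z \<in> coboundaries C i" for i z
  proof -
    obtain x where x: "x \<in> carrier (obj C (i - 1))" "z = diff C (i - 1) x"
      using z by (auto simp: coboundaries_def)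
    have "f (i - 1 + 1) (diff C (i - 1) x) = diff D (i - 1) (f (i - 1) x)" using fd[OF x(1)] .
    then show ?thesis using x(2) module_homD(1)[OF fh x(1)] by (auto simp: coboundaries_def)
  qed
  have H: "cohomology_map D f i (coboundaries C i +>\<^bsub>obj C i\<^esub> z) = coboundaries D i +>\<^bsub>obj D i\<^esub> f i z"
    if z: "z \<in> cocycles C i" for i z
  proof -
    interpret M: module R "obj C i" by (rule obj_module[OF C])
    have zc: "z \<in> carrier (obj C i)" using z cocycles_carrier[OF C] by blast
    have "coboundaries D i +>\<^bsub>obj D i\<^esub> f i x = coboundaries D i +>\<^bsub>obj D i\<^esub> f i z"
      if "x \<in> coboundaries C i +>\<^bsub>obj C i\<^esub> z" for x
    proof -
      note x = M.coset_memD[OF coboundaries_submodule[OF C] zc that]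
      have "f i x \<ominus>\<^bsub>obj D i\<^esub> f i z \<in> coboundaries D i"
        using fB[OF x(2)] module_hom_diff[OF M.module_axioms obj_module[OF D] fh x(1) zc] by simp
      then show ?thesis
        using cohomology_coset_eq_iff[OF D] module_homD(1)[OF fh] x(1) zc by blast
    qed
    then have "cohomology_map D f i (coboundaries C i +>\<^bsub>obj C i\<^esub> z) =
        (\<Union>x\<in>coboundaries C i +>\<^bsub>obj C i\<^esub> z. coboundaries D i +>\<^bsub>obj D i\<^esub> f i z)"
      unfolding cohomology_map_def by (intro SUP_cong) auto
    also have "\<dots> = coboundaries D i +>\<^bsub>obj D i\<^esub> f i z"
      using M.mem_coset[OF coboundaries_submodule[OF C] zc] by (intro SUP_const) blast
    finally show ?thesis .
  qed
  have inj: "inj_on (cohomology_map D f i) (carrier (cohomology C i)) \<longleftrightarrow>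
      (\<forall>z\<in>cocycles C i. f i z \<in> coboundaries D i \<longrightarrow> z \<in> coboundaries C i)" for i
  proof
    interpret M: module R "obj C i" by (rule obj_module[OF C])
    interpret N: module R "obj D i" by (rule obj_module[OF D])
    note ZC = cocycles_submodule[OF C, of i] and BC = coboundaries_submodule[OF C, of i]
    note BD = coboundaries_submodule[OF D, of i]
    assume inj: "inj_on (cohomology_map D f i) (carrier (cohomology C i))"
    show "\<forall>z\<in>cocycles C i. f i z \<in> coboundaries D i \<longrightarrow> z \<in> coboundaries C i"
    proof (intro ballI impI)
      fix z assume z: "z \<in> cocycles C i" "f i z \<in> coboundaries D i"
      have zc: "z \<in> carrier (obj C i)" using M.submodule_carrier[OF ZC z(1)] .
      have z0: "\<zero>\<^bsub>obj C i\<^esub> \<in> cocycles C i" using M.submodule_zero[OF ZC] .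
      have "f i \<zero>\<^bsub>obj C i\<^esub> = \<zero>\<^bsub>obj D i\<^esub>" by (rule module_hom_zero[OF M.module_axioms N.module_axioms fh])
      then have "coboundaries D i +>\<^bsub>obj D i\<^esub> f i z = coboundaries D i +>\<^bsub>obj D i\<^esub> f i \<zero>\<^bsub>obj C i\<^esub>"
        using N.coset_eq_self_iff[OF BD module_homD(1)[OF fh zc]]
          N.coset_eq_self_iff[OF BD N.zero_closed] z(2) N.submodule_zero[OF BD] by simp
      then have "coboundaries C i +>\<^bsub>obj C i\<^esub> z = coboundaries C i +>\<^bsub>obj C i\<^esub> \<zero>\<^bsub>obj C i\<^esub>"
        using inj_onD[OF inj, of "coboundaries C i +>\<^bsub>obj C i\<^esub> z" "coboundaries C i +>\<^bsub>obj C i\<^esub> \<zero>\<^bsub>obj C i\<^esub>"]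
          H z(1) z0 unfolding cohomology_carrier[OF C] by auto
      then show "z \<in> coboundaries C i"
        using M.coset_eq_iff[OF BC zc M.zero_closed] zc by (simp add: M.diff_zero_M)
    qed
  next
    interpret M: module R "obj C i" by (rule obj_module[OF C])
    assume *: "\<forall>z\<in>cocycles C i. f i z \<in> coboundaries D i \<longrightarrow> z \<in> coboundaries C i"
    show "inj_on (cohomology_map D f i) (carrier (cohomology C i))"
    proof (rule inj_onI)
      fix A A' assume "A \<in> carrier (cohomology C i)" "A' \<in> carrier (cohomology C i)"
        and eq: "cohomology_map D f i A = cohomology_map D f i A'"
      then obtain z z' where z: "z \<in> cocycles C i" "A = coboundaries C i +>\<^bsub>obj C i\<^esub> z"
        "z' \<in> cocycles C i" "A' = coboundaries C i +>\<^bsub>obj C i\<^esub> z'"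
        unfolding cohomology_carrier[OF C] by auto
      have c: "z \<in> carrier (obj C i)" "z' \<in> carrier (obj C i)"
        using z cocycles_carrier[OF C] by auto
      have "coboundaries D i +>\<^bsub>obj D i\<^esub> f i z = coboundaries D i +>\<^bsub>obj D i\<^esub> f i z'"
        using eq H z by simp
      then have "f i z \<ominus>\<^bsub>obj D i\<^esub> f i z' \<in> coboundaries D i"
        using cohomology_coset_eq_iff[OF D] module_homD(1)[OF fh] c by blast
      then have "f i (z \<ominus>\<^bsub>obj C i\<^esub> z') \<in> coboundaries D i"
        using module_hom_diff[OF M.module_axioms obj_module[OF D] fh c] by simp
      then have "z \<ominus>\<^bsub>obj C i\<^esub> z' \<in> coboundaries C i"
        using * M.submodule_diff[OF cocycles_submodule[OF C] z(1,3)] by blast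
      then show "A = A'" using z(2,4) cohomology_coset_eq_iff[OF C c] by simp
    qed
  qed
  have surj: "cohomology_map D f i ` carrier (cohomology C i) = carrier (cohomology D i) \<longleftrightarrow>
      (\<forall>w\<in>cocycles D i. \<exists>z\<in>cocycles C i. \<exists>c\<in>coboundaries D i. w = f i z \<oplus>\<^bsub>obj D i\<^esub> c)" for i
  proof -
    interpret N: module R "obj D i" by (rule obj_module[OF D])
    note BD = coboundaries_submodule[OF D, of i]
    have im: "cohomology_map D f i ` carrier (cohomology C i) =
        {coboundaries D i +>\<^bsub>obj D i\<^esub> f i z | z. z \<in> cocycles C i}"
      unfolding cohomology_carrier[OF C] using H by (auto simp: image_iff)
    have key: "coboundaries D i +>\<^bsub>obj D i\<^esub> w = coboundaries D i +>\<^bsub>obj D i\<^esub> f i z \<longleftrightarrow>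
        (\<exists>c\<in>coboundaries D i. w = f i z \<oplus>\<^bsub>obj D i\<^esub> c)" if "w \<in> cocycles D i" "z \<in> cocycles C i" for w z
    proof -
      have c: "w \<in> carrier (obj D i)" "f i z \<in> carrier (obj D i)"
        using that fZ cocycles_carrier[OF D] by auto
      have "w = f i z \<oplus>\<^bsub>obj D i\<^esub> (w \<ominus>\<^bsub>obj D i\<^esub> f i z)"
        using N.diff_add_cancel_M[OF c] c by (simp add: N.a_comm)
      then show ?thesis
        unfolding cohomology_coset_eq_iff[OF D c]
        using N.add_diff_cancel_left_M[OF c(2)] N.submodule_carrier[OF BD] by metis
    qed
    show ?thesis unfolding im cohomology_carrier[OF D]
    proof
      assume eq: "{coboundaries D i +>\<^bsub>obj D i\<^esub> f i z |z. z \<in> cocycles C i} =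
        {coboundaries D i +>\<^bsub>obj D i\<^esub> z |z. z \<in> cocycles D i}"
      show "\<forall>w\<in>cocycles D i. \<exists>z\<in>cocycles C i. \<exists>c\<in>coboundaries D i. w = f i z \<oplus>\<^bsub>obj D i\<^esub> c"
      proof
        fix w assume w: "w \<in> cocycles D i"
        then have "coboundaries D i +>\<^bsub>obj D i\<^esub> w \<in>
          {coboundaries D i +>\<^bsub>obj D i\<^esub> f i z |z. z \<in> cocycles C i}" using eq by auto
        then obtain z where z: "z \<in> cocycles C i"
          "coboundaries D i +>\<^bsub>obj D i\<^esub> w = coboundaries D i +>\<^bsub>obj D i\<^esub> f i z" by auto
        then show "\<exists>z\<in>cocycles C i. \<exists>c\<in>coboundaries D i. w = f i z \<oplus>\<^bsub>obj D i\<^esub> c"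
          using iffD1[OF key[OF w z(1)] z(2)] by (intro bexI[of _ z])
      qed
    next
      assume *: "\<forall>w\<in>cocycles D i. \<exists>z\<in>cocycles C i. \<exists>c\<in>coboundaries D i. w = f i z \<oplus>\<^bsub>obj D i\<^esub> c"
      have "\<exists>z\<in>cocycles C i. coboundaries D i +>\<^bsub>obj D i\<^esub> w = coboundaries D i +>\<^bsub>obj D i\<^esub> f i z"
        if w: "w \<in> cocycles D i" for w
      proof -
        obtain z where z: "z \<in> cocycles C i" "\<exists>c\<in>coboundaries D i. w = f i z \<oplus>\<^bsub>obj D i\<^esub> c"
          using * w by blast
        then show ?thesis using iffD2[OF key[OF w z(1)] z(2)] by (intro bexI[of _ z])
      qed
      then show "{coboundaries D i +>\<^bsub>obj D i\<^esub> f i z |z. z \<in> cocycles C i} =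
        {coboundaries D i +>\<^bsub>obj D i\<^esub> z |z. z \<in> cocycles D i}"
        using fZ by fast
    qed
  qed
  show ?thesis
    unfolding quasi_iso_def bij_betw_def inj surj using f by (simp add: all_conj_distrib)
qed

lemma chain_map_id: "cochain_complex R C \<Longrightarrow> chain_map R C C (\<lambda>i x. x)"
  by (auto simp: chain_map_def module_hom_def)

text \<open>Supplies the trivial leg of a roof.\<close>

lemma quasi_iso_id:
  assumes C: "cochain_complex R C"
  shows "quasi_iso R C C (\<lambda>i x. x)"
  unfolding quasi_iso_iff[OF C C chain_map_id[OF C]]
proof (intro conjI allI ballI impI)
  fix i z assume z: "z \<in> cocycles C i"
  interpret M: module R "obj C i" by (rule obj_module[OF C])
  have "z = z \<oplus>\<^bsub>obj C i\<^esub> \<zero>\<^bsub>obj C i\<^esub>" using z by (simp add: cocycles_def)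
  then show "\<exists>w\<in>cocycles C i. \<exists>c\<in>coboundaries C i. z = w \<oplus>\<^bsub>obj C i\<^esub> c"
    using z M.submodule_zero[OF coboundaries_submodule[OF C]] by blast
qed

section \<open>Stalk complexes\<close>

lemma zero_submodule_module:
  assumes "module R M"
  shows "module R (M\<lparr>carrier := {\<zero>\<^bsub>M\<^esub>}\<rparr>)"
proof -
  interpret M: module R M by (rule assms)
  have "submodule {\<zero>\<^bsub>M\<^esub>} R M" by (rule M.submoduleI_add_smult) auto
  then show ?thesis using submodule.submodule_is_module assms by blast
qed

lemma stalk_complex_simps:
  "\<zero>\<^bsub>obj (stalk_complex M) i\<^esub> = \<zero>\<^bsub>M\<^esub>"
  "x \<oplus>\<^bsub>obj (stalk_complex M) i\<^esub> y = x \<oplus>\<^bsub>M\<^esub> y"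
  "r \<odot>\<^bsub>obj (stalk_complex M) i\<^esub> x = r \<odot>\<^bsub>M\<^esub> x"
  "carrier (obj (stalk_complex M) i) = (if i = 0 then carrier M else {\<zero>\<^bsub>M\<^esub>})"
  "diff (stalk_complex M) i x = \<zero>\<^bsub>M\<^esub>"
  by (simp_all add: stalk_complex_def)

lemma stalk_complex_obj_module: "module R M \<Longrightarrow> module R (obj (stalk_complex M) i)"
  using zero_submodule_module[of M] by (simp add: stalk_complex_def)

lemma stalk_complex_cochain:
  assumes "module R M"
  shows "cochain_complex R (stalk_complex M)"
proof -
  interpret M: module R M by (rule assms)
  show ?thesis
    unfolding cochain_complex_def module_hom_def
    by (auto simp: stalk_complex_simps stalk_complex_obj_module[OF assms])
qed

lemma stalk_complex_cocycles:
  "cocycles (stalk_complex M) i = (if i = 0 then carrier M else {\<zero>\<^bsub>M\<^esub>})"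
  by (auto simp: cocycles_def stalk_complex_simps)

lemma stalk_complex_coboundaries: "coboundaries (stalk_complex M) i \<subseteq> {\<zero>\<^bsub>M\<^esub>}"
  by (auto simp: coboundaries_def stalk_complex_simps)

end

section \<open>A resolution of \<open>R\<close> as the initial case of concentrated
  cohomology\<close>

context injective_complex
begin

lemma tcyc_zero: "tcyc {\<zero>} i = cocycles E i"
  by (auto simp: tcyc_def tors_def cocycles_def)

lemma tbd_zero: "tbd {\<zero>} i = coboundaries E i"
  by (auto simp: tbd_def tors_def coboundaries_def)

text \<open>For the zero ideal the torsion is all of \<open>E\<close>, and the image of 1 under the
  augmentation generates the cohomology, which is \<open>R\<close> in degree 0. The induction along
  the regular sequence starts here.\<close>

lemma concentrated_of_quasi_iso:
  assumes qi: "quasi_iso R (stalk_complex (regular_module R)) E \<epsilon>"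
  shows "concentrated 0 {\<zero>} (\<epsilon> 0 \<one>)"
proof -
  let ?C = "stalk_complex (regular_module R)"
  have C: "cochain_complex R ?C" by (rule stalk_complex_cochain[OF regular_module_module])
  have cm: "chain_map R ?C E \<epsilon>" using qi by (simp add: quasi_iso_def)
  have h: "\<epsilon> i \<in> module_hom R (obj ?C i) (obj E i)" for i using cm by (simp add: chain_map_def)
  note qi' = qi[unfolded quasi_iso_iff[OF C cochain cm]]
  have inj: "z \<in> coboundaries ?C i" if "z \<in> cocycles ?C i" "\<epsilon> i z \<in> coboundaries E i" for i z
    using qi' that by blast
  have surj: "\<exists>z\<in>cocycles ?C i. \<exists>c\<in>coboundaries E i. w = \<epsilon> i z \<oplus>\<^bsub>\<E> i\<^esub> c" if "w \<in> cocycles E i" for i w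
    using qi' that by blast
  have e: "\<epsilon> 0 a = a \<odot>\<^bsub>\<E> 0\<^esub> \<epsilon> 0 \<one>" if "a \<in> carrier R" for a
    using module_homD(3)[OF h[of 0], of a \<one>] that by (simp add: stalk_complex_simps)
  have hz: "\<epsilon> i \<zero> = \<zero>\<^bsub>\<E> i\<^esub>" for i
    using module_hom_zero[OF stalk_complex_obj_module[OF regular_module_module] M.module_axioms h]
    by (simp add: stalk_complex_simps)
  show ?thesis
    unfolding concentrated_def tcyc_zero tbd_zero
  proof (intro conjI ballI impI allI)
    have "\<epsilon> 0 \<one> \<in> carrier (\<E> 0)" using module_homD(1)[OF h[of 0]] by (simp add: stalk_complex_simps)
    moreover have "\<epsilon> (0 + 1) (diff ?C 0 \<one>) = diff E 0 (\<epsilon> 0 \<one>)"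
      using cm[unfolded chain_map_def, rule_format, THEN conjunct2, rule_format, of \<one> 0]
      by (simp add: stalk_complex_simps)
    ultimately show "\<epsilon> 0 \<one> \<in> cocycles E 0" using hz by (simp add: cocycles_def stalk_complex_simps)
  next
    fix z assume "z \<in> cocycles E 0"
    then obtain a c where "a \<in> cocycles ?C 0" "c \<in> coboundaries E 0" "z = \<epsilon> 0 a \<oplus>\<^bsub>\<E> 0\<^esub> c"
      using surj by blast
    moreover from this have "a \<in> carrier R" by (simp add: stalk_complex_cocycles)
    ultimately show "\<exists>a\<in>carrier R. \<exists>c\<in>coboundaries E 0. z = a \<odot>\<^bsub>\<E> 0\<^esub> \<epsilon> 0 \<one> \<oplus>\<^bsub>\<E> 0\<^esub> c"
      using e[of a] by (intro bexI[of _ a] bexI[of _ c]) simp_all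
  next
    fix a assume a: "a \<in> carrier R" "a \<odot>\<^bsub>\<E> 0\<^esub> \<epsilon> 0 \<one> \<in> coboundaries E 0"
    then have "a \<in> coboundaries ?C 0" using inj[of a 0] e[OF a(1)] by (simp add: stalk_complex_cocycles)
    then show "a \<in> {\<zero>}" using stalk_complex_coboundaries[of "regular_module R" 0] by auto
  next
    fix i :: int assume i: "i \<noteq> 0"
    show "cocycles E i \<subseteq> coboundaries E i"
    proof
      fix w assume "w \<in> cocycles E i"
      then obtain z c where zc: "z \<in> cocycles ?C i" "c \<in> coboundaries E i" "w = \<epsilon> i z \<oplus>\<^bsub>\<E> i\<^esub> c"
        using surj by blast
      have "c \<in> carrier (\<E> i)" using zc(2) coboundaries_subset_cocycles[OF cochain] cocycles_carrier[OF cochain] by blast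
      then show "w \<in> coboundaries E i" using zc i hz by (simp add: stalk_complex_cocycles)
    qed
  qed
qed

end

section \<open>Direct sums and modules of homomorphisms\<close>

lemma dsum_module_simps:
  "carrier (dsum_module J M) = {f \<in> (\<Pi>\<^sub>E j\<in>J. carrier (M j)). finite {j \<in> J. f j \<noteq> \<zero>\<^bsub>M j\<^esub>}}"
  "\<zero>\<^bsub>dsum_module J M\<^esub> = (\<lambda>j\<in>J. \<zero>\<^bsub>M j\<^esub>)"
  "f \<oplus>\<^bsub>dsum_module J M\<^esub> g = (\<lambda>j\<in>J. f j \<oplus>\<^bsub>M j\<^esub> g j)"
  "r \<odot>\<^bsub>dsum_module J M\<^esub> f = (\<lambda>j\<in>J. r \<odot>\<^bsub>M j\<^esub> f j)"
  by (simp_all add: dsum_module_def)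

lemma hom_module_simps:
  "carrier (hom_module R M N) = module_hom R M N \<inter> extensional (carrier M)"
  "\<zero>\<^bsub>hom_module R M N\<^esub> = (\<lambda>x\<in>carrier M. \<zero>\<^bsub>N\<^esub>)"
  "f \<oplus>\<^bsub>hom_module R M N\<^esub> g = (\<lambda>x\<in>carrier M. f x \<oplus>\<^bsub>N\<^esub> g x)"
  "r \<odot>\<^bsub>hom_module R M N\<^esub> f = (\<lambda>x\<in>carrier M. r \<odot>\<^bsub>N\<^esub> f x)"
  by (simp_all add: hom_module_def)

context cring
begin

lemma dsum_module_module:
  assumes mod: "\<And>j. module R (M j)"
  shows "module R (dsum_module J M)"
proof -
  interpret M: module R "M j" for j by (rule mod)
  have mem: "f j \<in> carrier (M j)" if "f \<in> carrier (dsum_module J M)" "j \<in> J" for f j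
    using that by (auto simp: dsum_module_simps)
  have ext: "(\<lambda>j\<in>J. f j) = f" if "f \<in> carrier (dsum_module J M)" for f
    using that by (auto simp: dsum_module_simps)
  \<comment> \<open>A finite set \<open>A\<close> containing the support is given instead of the
    support itself, which for a sum can be smaller than the union of the supports of the
    summands.\<close>
  have close: "(\<lambda>j\<in>J. h j) \<in> carrier (dsum_module J M)"
    if "\<And>j. j \<in> J \<Longrightarrow> h j \<in> carrier (M j)" "finite A" "\<And>j. j \<in> J \<Longrightarrow> j \<notin> A \<Longrightarrow> h j = \<zero>\<^bsub>M j\<^esub>" for h A
  proof -
    have "{j \<in> J. (\<lambda>j\<in>J. h j) j \<noteq> \<zero>\<^bsub>M j\<^esub>} \<subseteq> A" using that(3) by auto
    then have "finite {j \<in> J. (\<lambda>j\<in>J. h j) j \<noteq> \<zero>\<^bsub>M j\<^esub>}" using that(2) by (rule finite_subset)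
    moreover have "(\<lambda>j\<in>J. h j) \<in> (\<Pi>\<^sub>E j\<in>J. carrier (M j))" using that(1) by auto
    ultimately show ?thesis unfolding dsum_module_simps by blast
  qed
  let ?s = "\<lambda>f. {j \<in> J. f j \<noteq> \<zero>\<^bsub>M j\<^esub>}"
  have fin: "finite (?s f)" if "f \<in> carrier (dsum_module J M)" for f
    using that by (auto simp: dsum_module_simps)
  show ?thesis
  proof (rule moduleI[OF is_cring])
    show "abelian_group (dsum_module J M)"
    proof (rule abelian_groupI)
      fix f g assume f: "f \<in> carrier (dsum_module J M)" and g: "g \<in> carrier (dsum_module J M)"
      show "f \<oplus>\<^bsub>dsum_module J M\<^esub> g \<in> carrier (dsum_module J M)" unfolding dsum_module_simps(3)
        by (rule close[of _ "?s f \<union> ?s g"]) (use mem f g fin in auto)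
      show "f \<oplus>\<^bsub>dsum_module J M\<^esub> g = g \<oplus>\<^bsub>dsum_module J M\<^esub> f" unfolding dsum_module_simps(3)
        by (rule restrict_ext) (use mem f g in \<open>simp add: M.a_comm\<close>)
      fix h assume h: "h \<in> carrier (dsum_module J M)"
      show "f \<oplus>\<^bsub>dsum_module J M\<^esub> g \<oplus>\<^bsub>dsum_module J M\<^esub> h = f \<oplus>\<^bsub>dsum_module J M\<^esub> (g \<oplus>\<^bsub>dsum_module J M\<^esub> h)"
        unfolding dsum_module_simps(3)
        by (rule restrict_ext) (use mem f g h in \<open>simp add: M.a_assoc\<close>)
    next
      show "\<zero>\<^bsub>dsum_module J M\<^esub> \<in> carrier (dsum_module J M)" unfolding dsum_module_simps(2)
        by (rule close[of _ "{}"]) auto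
      fix f assume f: "f \<in> carrier (dsum_module J M)"
      have "(\<lambda>j\<in>J. (\<lambda>j\<in>J. \<zero>\<^bsub>M j\<^esub>) j \<oplus>\<^bsub>M j\<^esub> f j) = (\<lambda>j\<in>J. f j)"
        by (rule restrict_ext) (use mem f in simp)
      then show "\<zero>\<^bsub>dsum_module J M\<^esub> \<oplus>\<^bsub>dsum_module J M\<^esub> f = f"
        using ext[OF f] by (simp add: dsum_module_simps)
      have "(\<lambda>j\<in>J. (\<lambda>j\<in>J. \<ominus>\<^bsub>M j\<^esub> f j) j \<oplus>\<^bsub>M j\<^esub> f j) = (\<lambda>j\<in>J. \<zero>\<^bsub>M j\<^esub>)"
        by (rule restrict_ext) (use mem f in \<open>simp add: M.l_neg\<close>)
      moreover have "(\<lambda>j\<in>J. \<ominus>\<^bsub>M j\<^esub> f j) \<in> carrier (dsum_module J M)"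
        by (rule close[of _ "?s f"]) (use mem f fin in auto)
      ultimately show "\<exists>g\<in>carrier (dsum_module J M). g \<oplus>\<^bsub>dsum_module J M\<^esub> f = \<zero>\<^bsub>dsum_module J M\<^esub>"
        unfolding dsum_module_simps(2,3) by (rule bexI)
    qed
  next
    fix a f assume a: "a \<in> carrier R" and f: "f \<in> carrier (dsum_module J M)"
    show "a \<odot>\<^bsub>dsum_module J M\<^esub> f \<in> carrier (dsum_module J M)" unfolding dsum_module_simps(4)
      by (rule close[of _ "?s f"]) (use mem f fin a in auto)
    fix b assume b: "b \<in> carrier R"
    show "(a \<oplus> b) \<odot>\<^bsub>dsum_module J M\<^esub> f =
        a \<odot>\<^bsub>dsum_module J M\<^esub> f \<oplus>\<^bsub>dsum_module J M\<^esub> b \<odot>\<^bsub>dsum_module J M\<^esub> f"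
      unfolding dsum_module_simps(3,4)
      by (rule restrict_ext) (use mem f a b in \<open>simp add: M.smult_l_distr\<close>)
    show "(a \<otimes> b) \<odot>\<^bsub>dsum_module J M\<^esub> f = a \<odot>\<^bsub>dsum_module J M\<^esub> (b \<odot>\<^bsub>dsum_module J M\<^esub> f)"
      unfolding dsum_module_simps(4)
      by (rule restrict_ext) (use mem f a b in \<open>simp add: M.smult_assoc1\<close>)
  next
    fix a f g assume a: "a \<in> carrier R" and f: "f \<in> carrier (dsum_module J M)"
      and g: "g \<in> carrier (dsum_module J M)"
    show "a \<odot>\<^bsub>dsum_module J M\<^esub> (f \<oplus>\<^bsub>dsum_module J M\<^esub> g) =
        a \<odot>\<^bsub>dsum_module J M\<^esub> f \<oplus>\<^bsub>dsum_module J M\<^esub> a \<odot>\<^bsub>dsum_module J M\<^esub> g"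
      unfolding dsum_module_simps(3,4)
      by (rule restrict_ext) (use mem f a g in \<open>simp add: M.smult_r_distr\<close>)
  next
    fix f assume f: "f \<in> carrier (dsum_module J M)"
    have "(\<lambda>j\<in>J. \<one> \<odot>\<^bsub>M j\<^esub> f j) = (\<lambda>j\<in>J. f j)" by (rule restrict_ext) (use mem f in simp)
    then show "\<one> \<odot>\<^bsub>dsum_module J M\<^esub> f = f" using ext[OF f] by (simp add: dsum_module_simps)
  qed
qed

lemma hom_module_module:
  assumes M: "module R M" and N: "module R N"
  shows "module R (hom_module R M N)"
proof -
  interpret M: module R M by (rule M)
  interpret N: module R N by (rule N)
  let ?H = "hom_module R M N"
  have hD: "x \<in> carrier M \<Longrightarrow> f x \<in> carrier N"
    "x \<in> carrier M \<Longrightarrow> y \<in> carrier M \<Longrightarrow> f (x \<oplus>\<^bsub>M\<^esub> y) = f x \<oplus>\<^bsub>N\<^esub> f y"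
    "r \<in> carrier R \<Longrightarrow> x \<in> carrier M \<Longrightarrow> f (r \<odot>\<^bsub>M\<^esub> x) = r \<odot>\<^bsub>N\<^esub> f x"
    if "f \<in> carrier ?H" for f x y r
    using that by (auto simp: hom_module_simps module_hom_def)
  have ext: "(\<lambda>x\<in>carrier M. f x) = f" if "f \<in> carrier ?H" for f
    using that by (auto simp: hom_module_simps extensional_restrict)
  have close: "(\<lambda>x\<in>carrier M. h x) \<in> carrier ?H"
    if "\<And>x. x \<in> carrier M \<Longrightarrow> h x \<in> carrier N"
      "\<And>x y. x \<in> carrier M \<Longrightarrow> y \<in> carrier M \<Longrightarrow> h (x \<oplus>\<^bsub>M\<^esub> y) = h x \<oplus>\<^bsub>N\<^esub> h y"
      "\<And>r x. r \<in> carrier R \<Longrightarrow> x \<in> carrier M \<Longrightarrow> h (r \<odot>\<^bsub>M\<^esub> x) = r \<odot>\<^bsub>N\<^esub> h x" for h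
    using that by (auto simp: hom_module_simps module_hom_def)
  show ?thesis
  proof (rule moduleI[OF is_cring])
    show "abelian_group ?H"
    proof (rule abelian_groupI)
      fix f g assume f: "f \<in> carrier ?H" and g: "g \<in> carrier ?H"
      show "f \<oplus>\<^bsub>?H\<^esub> g \<in> carrier ?H" unfolding hom_module_simps(3)
        by (rule close) (use hD[OF f] hD[OF g] in \<open>auto simp: N.a_ac N.smult_r_distr\<close>)
      show "f \<oplus>\<^bsub>?H\<^esub> g = g \<oplus>\<^bsub>?H\<^esub> f" unfolding hom_module_simps(3)
        by (rule restrict_ext) (use hD[OF f] hD[OF g] in \<open>simp add: N.a_comm\<close>)
      fix h assume h: "h \<in> carrier ?H"
      show "f \<oplus>\<^bsub>?H\<^esub> g \<oplus>\<^bsub>?H\<^esub> h = f \<oplus>\<^bsub>?H\<^esub> (g \<oplus>\<^bsub>?H\<^esub> h)" unfolding hom_module_simps(3)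
        by (rule restrict_ext) (use hD(1)[OF f] hD(1)[OF g] hD(1)[OF h] in \<open>simp add: N.a_assoc\<close>)
    next
      show "\<zero>\<^bsub>?H\<^esub> \<in> carrier ?H" unfolding hom_module_simps(2) by (rule close) auto
      fix f assume f: "f \<in> carrier ?H"
      have "(\<lambda>x\<in>carrier M. (\<lambda>x\<in>carrier M. \<zero>\<^bsub>N\<^esub>) x \<oplus>\<^bsub>N\<^esub> f x) = (\<lambda>x\<in>carrier M. f x)"
        by (rule restrict_ext) (use hD[OF f] in simp)
      then show "\<zero>\<^bsub>?H\<^esub> \<oplus>\<^bsub>?H\<^esub> f = f" using ext[OF f] by (simp add: hom_module_simps)
      have "(\<lambda>x\<in>carrier M. (\<lambda>x\<in>carrier M. \<ominus>\<^bsub>N\<^esub> f x) x \<oplus>\<^bsub>N\<^esub> f x) = (\<lambda>x\<in>carrier M. \<zero>\<^bsub>N\<^esub>)"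
        by (rule restrict_ext) (use hD[OF f] in \<open>simp add: N.l_neg\<close>)
      moreover have "(\<lambda>x\<in>carrier M. \<ominus>\<^bsub>N\<^esub> f x) \<in> carrier ?H"
        by (rule close) (use hD[OF f] in \<open>auto simp: N.minus_add N.smult_r_minus\<close>)
      ultimately show "\<exists>g\<in>carrier ?H. g \<oplus>\<^bsub>?H\<^esub> f = \<zero>\<^bsub>?H\<^esub>"
        unfolding hom_module_simps(2,3) by (rule bexI)
    qed
  next
    fix a f assume a: "a \<in> carrier R" and f: "f \<in> carrier ?H"
    show "a \<odot>\<^bsub>?H\<^esub> f \<in> carrier ?H" unfolding hom_module_simps(4)
      by (rule close)
        (use hD[OF f] a in \<open>auto simp: N.smult_r_distr m_comm simp flip: N.smult_assoc1\<close>)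
    fix b assume b: "b \<in> carrier R"
    show "(a \<oplus> b) \<odot>\<^bsub>?H\<^esub> f = a \<odot>\<^bsub>?H\<^esub> f \<oplus>\<^bsub>?H\<^esub> b \<odot>\<^bsub>?H\<^esub> f" unfolding hom_module_simps(3,4)
      by (rule restrict_ext) (use hD[OF f] a b in \<open>simp add: N.smult_l_distr\<close>)
    show "(a \<otimes> b) \<odot>\<^bsub>?H\<^esub> f = a \<odot>\<^bsub>?H\<^esub> (b \<odot>\<^bsub>?H\<^esub> f)" unfolding hom_module_simps(4)
      by (rule restrict_ext) (use hD[OF f] a b in \<open>simp add: N.smult_assoc1\<close>)
  next
    fix a f g assume a: "a \<in> carrier R" and f: "f \<in> carrier ?H" and g: "g \<in> carrier ?H"
    show "a \<odot>\<^bsub>?H\<^esub> (f \<oplus>\<^bsub>?H\<^esub> g) = a \<odot>\<^bsub>?H\<^esub> f \<oplus>\<^bsub>?H\<^esub> a \<odot>\<^bsub>?H\<^esub> g" unfolding hom_module_simps(3,4)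
      by (rule restrict_ext) (use hD(1)[OF f] hD(1)[OF g] a in \<open>simp add: N.smult_r_distr\<close>)
  next
    fix f assume f: "f \<in> carrier ?H"
    have "(\<lambda>x\<in>carrier M. \<one> \<odot>\<^bsub>N\<^esub> f x) = (\<lambda>x\<in>carrier M. f x)"
      by (rule restrict_ext) (use hD[OF f] in simp)
    then show "\<one> \<odot>\<^bsub>?H\<^esub> f = f" using ext[OF f] by (simp add: hom_module_simps)
  qed
qed

section \<open>The residue module\<close>

lemma ideal_submodule:
  assumes "ideal J R"
  shows "submodule J R (regular_module R)"
proof -
  interpret B: module R "regular_module R" by (rule regular_module_module)
  show ?thesis
    by (rule B.submoduleI_add_smult)
      (use ideal_subset_carrier[OF assms] ideal_mem[OF assms] in auto)
qed

lemma residue_module_module: "ideal J R \<Longrightarrow> module R (residue_module R J)"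
  unfolding residue_module_def
  by (rule quot_module_module[OF regular_module_module ideal_submodule])

lemma residue_module_simps:
  assumes J: "ideal J R"
  shows "carrier (residue_module R J) = {J +> r | r. r \<in> carrier R}"
    and "\<zero>\<^bsub>residue_module R J\<^esub> = J"
    and "r \<in> carrier R \<Longrightarrow> s \<in> carrier R \<Longrightarrow>
      (J +> r) \<oplus>\<^bsub>residue_module R J\<^esub> (J +> s) = J +> (r \<oplus> s)"
    and "a \<in> carrier R \<Longrightarrow> r \<in> carrier R \<Longrightarrow>
      a \<odot>\<^bsub>residue_module R J\<^esub> (J +> r) = J +> (a \<otimes> r)"
proof -
  interpret B: module R "regular_module R" by (rule regular_module_module)
  note N = ideal_submodule[OF J]
  show "carrier (residue_module R J) = {J +> r | r. r \<in> carrier R}" "\<zero>\<^bsub>residue_module R J\<^esub> = J"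
    by (auto simp: residue_module_def quot_module_simps)
  show "(J +> r) \<oplus>\<^bsub>residue_module R J\<^esub> (J +> s) = J +> (r \<oplus> s)"
    if "r \<in> carrier R" "s \<in> carrier R"
    using B.coset_add[OF N, of r s] that by (simp add: residue_module_def quot_module_simps)
  show "a \<odot>\<^bsub>residue_module R J\<^esub> (J +> r) = J +> (a \<otimes> r)"
    if "a \<in> carrier R" "r \<in> carrier R"
    using quot_module_smult[OF B.module_axioms N that(1), of r] that by (simp add: residue_module_def)
qed

text \<open>Products with elements killed by \<open>J\<close> do not depend on the choice of
  representative.\<close>

definition coset_rep :: "'a set \<Rightarrow> 'a set \<Rightarrow> 'a" where
  "coset_rep J A = (SOME r. r \<in> carrier R \<and> A = J +> r)"

lemma coset_rep:
  assumes "ideal J R" "A \<in> carrier (residue_module R J)"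
  shows "coset_rep J A \<in> carrier R" "A = J +> coset_rep J A"
proof -
  have "\<exists>r. r \<in> carrier R \<and> A = J +> r" using assms by (auto simp: residue_module_simps)
  then have "coset_rep J A \<in> carrier R \<and> A = J +> coset_rep J A"
    unfolding coset_rep_def by (rule someI_ex)
  then show "coset_rep J A \<in> carrier R" "A = J +> coset_rep J A" by auto
qed

lemma coset_rep_diff:
  assumes "ideal J R" "r \<in> carrier R"
  shows "coset_rep J (J +> r) \<ominus> r \<in> J"
proof -
  have "J +> r \<in> carrier (residue_module R J)" using assms by (auto simp: residue_module_simps)
  then show ?thesis using coset_rep[OF assms(1)] rcoset_eq_iff[OF assms(1)] assms(2) by metis
qed

end

lemma RHom_simps:
  "obj (RHom R M E) i = hom_module R M (obj E i)"
  "diff (RHom R M E) i f = (\<lambda>x\<in>carrier M. diff E i (f x))"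
  by (simp_all add: RHom_def)

section \<open>The isomorphism in the derived category\<close>

context injective_complex
begin

context
  fixes I :: "'a set" and u :: "int \<Rightarrow> nat" and b :: "int \<Rightarrow> nat \<Rightarrow> 'e"
  assumes I: "ideal I R" and B: "\<And>n. cobasis n I {..<u n} (b n)"
begin

abbreviation RI :: "('a, 'a set) module" where "RI \<equiv> residue_module R I"
abbreviation P :: "int \<Rightarrow> ('a, nat \<Rightarrow> 'a set) module" where "P n \<equiv> power_module RI (u n)"
abbreviation K :: "('a, 'a set \<Rightarrow> 'e) cochain" where "K \<equiv> RHom R RI E"
abbreviation L :: "('a, int \<Rightarrow> nat \<Rightarrow> 'a set) cochain" where
  "L \<equiv> dsum_complex UNIV (\<lambda>i. shift_complex (stalk_complex (P i)) (- i))"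

lemmas RI = residue_module_simps[OF I]
lemmas RI_module = residue_module_module[OF I]
lemmas Isub = ideal_subset_carrier[OF I]

lemma coset_rep_smult:
  assumes r: "r \<in> carrier R" and x: "x \<in> tors I n"
  shows "coset_rep I (I +> r) \<odot>\<^bsub>\<E> n\<^esub> x = r \<odot>\<^bsub>\<E> n\<^esub> x"
proof -
  have "I +> r \<in> carrier RI" using r RI(1) by auto
  then have c: "coset_rep I (I +> r) \<in> carrier R" by (rule coset_rep[OF I])
  have xc: "x \<in> carrier (\<E> n)" using tors_carrier[OF x] .
  have "(coset_rep I (I +> r) \<ominus> r) \<odot>\<^bsub>\<E> n\<^esub> x = \<zero>\<^bsub>\<E> n\<^esub>"
    using tors_smult_zero[OF x] coset_rep_diff[OF I r] by blast
  then have "coset_rep I (I +> r) \<odot>\<^bsub>\<E> n\<^esub> x \<ominus>\<^bsub>\<E> n\<^esub> r \<odot>\<^bsub>\<E> n\<^esub> x = \<zero>\<^bsub>\<E> n\<^esub>"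
    using M.smult_l_diff[OF c r xc] by simp
  then show ?thesis
    using M.diff_add_cancel_M[of "coset_rep I (I +> r) \<odot>\<^bsub>\<E> n\<^esub> x" n "r \<odot>\<^bsub>\<E> n\<^esub> x"] c r xc by simp
qed

text \<open>\<open>phi\<close> identifies \<open>x\<close> with the homomorphism \<open>R/I \<rightarrow> E\<^sup>n\<close> that sends \<open>1\<close> to \<open>x\<close>.\<close>

definition phi :: "int \<Rightarrow> 'e \<Rightarrow> 'a set \<Rightarrow> 'e" where
  "phi n x = (\<lambda>A\<in>carrier RI. coset_rep I A \<odot>\<^bsub>\<E> n\<^esub> x)"

lemma coset_in_RI: "r \<in> carrier R \<Longrightarrow> I +> r \<in> carrier RI"
  using RI(1) by auto

lemma phi_apply: "r \<in> carrier R \<Longrightarrow> x \<in> tors I n \<Longrightarrow> phi n x (I +> r) = r \<odot>\<^bsub>\<E> n\<^esub> x"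
  using coset_rep_smult coset_in_RI by (simp add: phi_def)

lemma ext_eqI:
  assumes "f \<in> extensional (carrier RI)" "g \<in> extensional (carrier RI)"
    and "\<And>r. r \<in> carrier R \<Longrightarrow> f (I +> r) = g (I +> r)"
  shows "f = g"
  by (rule extensionalityI[OF assms(1,2)]) (use RI(1) assms(3) in auto)

lemma phi_ext: "phi n x \<in> extensional (carrier RI)"
  by (simp add: phi_def)

lemma phi_mem:
  assumes x: "x \<in> tors I n"
  shows "phi n x \<in> carrier (hom_module R RI (\<E> n))"
proof -
  have xc: "x \<in> carrier (\<E> n)" using tors_carrier[OF x] .
  have "phi n x \<in> module_hom R RI (\<E> n)"
    unfolding module_hom_def RI(1)
    using xc by (auto simp: phi_apply x RI(3,4) M.smult_l_distr M.smult_assoc1)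
  then show ?thesis using phi_ext by (simp add: hom_module_simps)
qed

lemma phi_inj:
  assumes "x \<in> tors I n" "y \<in> tors I n" "phi n x = phi n y"
  shows "x = y"
proof -
  have "phi n z (I +> \<one>) = z" if "z \<in> tors I n" for z
    using phi_apply[OF one_closed that] tors_carrier[OF that] by simp
  from this[OF assms(1)] this[OF assms(2)] show ?thesis unfolding assms(3) by (rule trans[OF sym])
qed

text \<open>A homomorphism on \<open>R/I\<close> is determined by its value at the class of 1; that
  value is \<open>I\<close>-torsion because the classes of elements of \<open>I\<close> are
  zero.\<close>

lemma phi_surj:
  assumes h: "h \<in> carrier (hom_module R RI (\<E> n))"
  shows "\<exists>x\<in>tors I n. h = phi n x"
proof -
  have hh: "h \<in> module_hom R RI (\<E> n)" and he: "h \<in> extensional (carrier RI)"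
    using h by (auto simp: hom_module_simps)
  define x where "x = h (I +> \<one>)"
  have xc: "x \<in> carrier (\<E> n)" unfolding x_def by (rule module_homD(1)[OF hh coset_in_RI[OF one_closed]])
  have hr: "h (I +> r) = r \<odot>\<^bsub>\<E> n\<^esub> x" if "r \<in> carrier R" for r
    using module_homD(3)[OF hh that coset_in_RI[OF one_closed]] RI(4)[OF that one_closed] that
    by (simp add: x_def)
  have "a \<odot>\<^bsub>\<E> n\<^esub> x = \<zero>\<^bsub>\<E> n\<^esub>" if a: "a \<in> I" for a
  proof -
    have ac: "a \<in> carrier R" using a Isub by blast
    have "I +> a = \<zero>\<^bsub>RI\<^esub>" using rcoset_eq_self_iff[OF I ac] a RI(2) by simp
    then show ?thesis using hr[OF ac] module_hom_zero[OF RI_module M.module_axioms hh] by simp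
  qed
  then have x: "x \<in> tors I n" using xc by (simp add: tors_def)
  have "h = phi n x"
    by (rule ext_eqI[OF he phi_ext]) (use hr phi_apply x in simp)
  then show ?thesis using x by blast
qed

lemma phi_add:
  assumes "x \<in> tors I n" "y \<in> tors I n"
  shows "phi n (x \<oplus>\<^bsub>\<E> n\<^esub> y) = phi n x \<oplus>\<^bsub>hom_module R RI (\<E> n)\<^esub> phi n y"
  unfolding hom_module_simps(3)
  by (rule ext_eqI)
    (use assms tors_carrier M.submoduleE(5)[OF tors_submodule[OF Isub] assms] in
      \<open>auto simp: phi_ext phi_apply coset_in_RI M.smult_r_distr[OF _ tors_carrier[OF assms(1)] tors_carrier[OF assms(2)]]\<close>)

lemma phi_smult:
  assumes a: "a \<in> carrier R" and x: "x \<in> tors I n"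
  shows "phi n (a \<odot>\<^bsub>\<E> n\<^esub> x) = a \<odot>\<^bsub>hom_module R RI (\<E> n)\<^esub> phi n x"
  unfolding hom_module_simps(4)
proof (rule ext_eqI)
  fix r assume r: "r \<in> carrier R"
  have "r \<odot>\<^bsub>\<E> n\<^esub> (a \<odot>\<^bsub>\<E> n\<^esub> x) = a \<odot>\<^bsub>\<E> n\<^esub> (r \<odot>\<^bsub>\<E> n\<^esub> x)"
    using a r tors_carrier[OF x] by (metis M.smult_assoc1 m_comm)
  then show "phi n (a \<odot>\<^bsub>\<E> n\<^esub> x) (I +> r) = (\<lambda>A\<in>carrier RI. a \<odot>\<^bsub>\<E> n\<^esub> phi n x A) (I +> r)"
    using r x M.submoduleE(4)[OF tors_submodule[OF Isub] a x] by (simp add: phi_apply coset_in_RI)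
qed (auto simp: phi_ext)

lemma phi_zero: "phi n \<zero>\<^bsub>\<E> n\<^esub> = \<zero>\<^bsub>hom_module R RI (\<E> n)\<^esub>"
  unfolding hom_module_simps(2)
  by (rule ext_eqI)
    (auto simp: phi_ext phi_apply coset_in_RI M.submodule_zero[OF tors_submodule[OF Isub]])

text \<open>With injectivity and surjectivity this makes \<open>phi\<close> an isomorphism from the
  \<open>I\<close>-torsion subcomplex of \<open>E\<close> onto \<open>Hom(R/I, E)\<close>.\<close>

lemma phi_diff:
  assumes x: "x \<in> tors I n"
  shows "diff K n (phi n x) = phi (n + 1) (\<delta> n x)"
  unfolding RHom_simps
  by (rule ext_eqI)
    (auto simp: phi_ext phi_apply coset_in_RI x diff_tors[OF Isub x] diff_smult tors_carrier[OF x])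

text \<open>Every homomorphism has the form \<open>phi n x\<close>, so each axiom reduces to the
  corresponding fact about torsion elements of \<open>E\<close>.\<close>

lemma RHom_cochain: "cochain_complex R K"
  unfolding cochain_complex_def
proof (intro allI conjI ballI)
  fix n
  show mod: "module R (obj K n)" for n
    unfolding RHom_simps by (rule hom_module_module[OF RI_module M.module_axioms])
  have T: "submodule (tors I n) R (\<E> n)" by (rule tors_submodule[OF Isub])
  show "diff K n \<in> module_hom R (obj K n) (obj K (n + 1))"
    unfolding module_hom_def
  proof (intro CollectI conjI ballI)
    show "diff K n \<in> carrier (obj K n) \<rightarrow> carrier (obj K (n + 1))"
    proof
      fix f assume "f \<in> carrier (obj K n)"
      then obtain x where x: "x \<in> tors I n" "f = phi n x" using phi_surj unfolding RHom_simps(1) by blast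
      show "diff K n f \<in> carrier (obj K (n + 1))"
        unfolding x(2) phi_diff[OF x(1)] RHom_simps(1) by (rule phi_mem[OF diff_tors[OF Isub x(1)]])
    qed
    fix f assume "f \<in> carrier (obj K n)"
    then obtain x where x: "x \<in> tors I n" "f = phi n x" using phi_surj unfolding RHom_simps(1) by blast
    show "diff K n (r \<odot>\<^bsub>obj K n\<^esub> f) = r \<odot>\<^bsub>obj K (n + 1)\<^esub> diff K n f" if r: "r \<in> carrier R" for r
      using phi_smult[OF r x(1)] phi_diff[OF M.submoduleE(4)[OF T r x(1)]] phi_diff[OF x(1)]
        phi_smult[OF r diff_tors[OF Isub x(1)]] diff_smult[OF r tors_carrier[OF x(1)]] x(2)
      by (simp add: RHom_simps(1))
    fix g assume "g \<in> carrier (obj K n)"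
    then obtain y where y: "y \<in> tors I n" "g = phi n y" using phi_surj unfolding RHom_simps(1) by blast
    show "diff K n (f \<oplus>\<^bsub>obj K n\<^esub> g) = diff K n f \<oplus>\<^bsub>obj K (n + 1)\<^esub> diff K n g"
      using phi_add[OF x(1) y(1)] phi_diff[OF M.submoduleE(5)[OF T x(1) y(1)]] phi_diff[OF x(1)]
        phi_diff[OF y(1)] phi_add[OF diff_tors[OF Isub x(1)] diff_tors[OF Isub y(1)]]
        diff_add[OF tors_carrier[OF x(1)] tors_carrier[OF y(1)]] x(2) y(2)
      by (simp add: RHom_simps(1))
  qed
  fix f assume "f \<in> carrier (obj K n)"
  then obtain x where x: "x \<in> tors I n" "f = phi n x" using phi_surj unfolding RHom_simps(1) by blast
  have "diff K (n + 1) (diff K n f) = \<zero>\<^bsub>obj K (n + 1 + 1)\<^esub>"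
    unfolding x(2) phi_diff[OF x(1)] phi_diff[OF diff_tors[OF Isub x(1)]]
      diff_diff[OF tors_carrier[OF x(1)]] phi_zero RHom_simps(1) ..
  moreover have "n + 1 + 1 = n + 2" by simp
  ultimately show "diff K (n + 1) (diff K n f) = \<zero>\<^bsub>obj K (n + 2)\<^esub>" by (simp only:)
qed

lemma RHom_cocycles: "cocycles K n = phi n ` tcyc I n"
proof
  show "cocycles K n \<subseteq> phi n ` tcyc I n"
  proof
    fix f assume f: "f \<in> cocycles K n"
    then obtain x where x: "x \<in> tors I n" "f = phi n x"
      using phi_surj by (auto simp: cocycles_def RHom_simps(1))
    have "phi (n + 1) (\<delta> n x) = phi (n + 1) \<zero>\<^bsub>\<E> (n + 1)\<^esub>"
      using f phi_diff[OF x(1)] phi_zero x(2) by (simp add: cocycles_def RHom_simps(1))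
    then have "\<delta> n x = \<zero>\<^bsub>\<E> (n + 1)\<^esub>"
      by (rule phi_inj[OF diff_tors[OF Isub x(1)] M.submodule_zero[OF tors_submodule[OF Isub]]])
    then show "f \<in> phi n ` tcyc I n" using x by (auto simp: tcyc_def)
  qed
  show "phi n ` tcyc I n \<subseteq> cocycles K n"
    using phi_mem phi_diff phi_zero by (auto simp: cocycles_def RHom_simps(1) tcyc_def)
qed

lemma RHom_coboundaries: "coboundaries K n = phi n ` tbd I n"
proof -
  have "carrier (obj K (n - 1)) = phi (n - 1) ` tors I (n - 1)"
    unfolding RHom_simps(1) using phi_mem phi_surj by blast
  then have "coboundaries K n = (\<lambda>x. diff K (n - 1) (phi (n - 1) x)) ` tors I (n - 1)"
    unfolding coboundaries_def by (simp add: image_image)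
  also have "\<dots> = (\<lambda>x. phi n (\<delta> (n - 1) x)) ` tors I (n - 1)"
    using phi_diff[of _ "n - 1"] by (intro image_cong) auto
  finally show ?thesis by (simp add: tbd_def image_image)
qed

lemmas B' = cobasisD[OF B]

lemma P_simps:
  "carrier (P n) = ({..<u n} \<rightarrow>\<^sub>E carrier RI)"
  "\<zero>\<^bsub>P n\<^esub> = (\<lambda>k\<in>{..<u n}. I)"
  "p \<oplus>\<^bsub>P n\<^esub> q = (\<lambda>k\<in>{..<u n}. p k \<oplus>\<^bsub>RI\<^esub> q k)"
  "r \<odot>\<^bsub>P n\<^esub> p = (\<lambda>k\<in>{..<u n}. r \<odot>\<^bsub>RI\<^esub> p k)"
  by (auto simp: power_module_def dsum_module_simps RI(2))

lemma P_module: "module R (P n)"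
  unfolding power_module_def by (rule dsum_module_module[OF RI_module])

text \<open>Linear although \<open>coset_rep\<close> is not: another choice of representatives
  changes the coefficients by elements of \<open>I\<close>, which kill the vectors
  \<open>b n k\<close>.\<close>

definition lin :: "int \<Rightarrow> (nat \<Rightarrow> 'a set) \<Rightarrow> 'e" where
  "lin n p = M.mlin n {..<u n} (\<lambda>k. coset_rep I (p k)) (b n)"

lemma b_tors: "k < u n \<Longrightarrow> b n k \<in> tors I n"
  using B'(2)[of n] tcyc_tors by auto

lemma lin_eq:
  assumes p: "p \<in> carrier (P n)" and r: "r \<in> {..<u n} \<rightarrow> carrier R"
    and pr: "\<And>k. k < u n \<Longrightarrow> p k = I +> r k"
  shows "lin n p = M.mlin n {..<u n} r (b n)"
  unfolding lin_def
proof (rule M.mlin_cong[OF _ r B'(3)])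
  fix k assume "k \<in> {..<u n}"
  then show "coset_rep I (p k) \<odot>\<^bsub>\<E> n\<^esub> b n k = r k \<odot>\<^bsub>\<E> n\<^esub> b n k"
    using coset_rep_smult[OF Pi_mem[OF r] b_tors] pr by simp
qed

lemma P_repE:
  assumes p: "p \<in> carrier (P n)"
  obtains r where "r \<in> {..<u n} \<rightarrow> carrier R" "\<And>k. k < u n \<Longrightarrow> p k = I +> r k"
proof (rule that)
  have pk: "p k \<in> carrier RI" if "k < u n" for k using p that by (auto simp: P_simps(1))
  show "(\<lambda>k. coset_rep I (p k)) \<in> {..<u n} \<rightarrow> carrier R" using coset_rep(1)[OF I pk] by auto
  show "p k = I +> coset_rep I (p k)" if "k < u n" for k by (rule coset_rep(2)[OF I pk[OF that]])
qed

lemma lin_tcyc: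
  assumes "p \<in> carrier (P n)"
  shows "lin n p \<in> tcyc I n"
proof -
  obtain r where r: "r \<in> {..<u n} \<rightarrow> carrier R" "\<And>k. k < u n \<Longrightarrow> p k = I +> r k"
    using P_repE[OF assms] by blast
  have "lin n p = M.mlin n {..<u n} r (b n)" by (rule lin_eq[OF assms r(1)]) (rule r(2))
  moreover have "M.mlin n {..<u n} r (b n) \<in> tcyc I n"
    by (rule M.mlin_mem[OF tcyc_submodule[OF Isub]])
      (use r B'(2)[of n] M.submoduleE(4)[OF tcyc_submodule[OF Isub]] in \<open>auto simp: Pi_iff\<close>)
  ultimately show ?thesis by simp
qed

lemma lin_add:
  assumes p: "p \<in> carrier (P n)" and q: "q \<in> carrier (P n)"
  shows "lin n (p \<oplus>\<^bsub>P n\<^esub> q) = lin n p \<oplus>\<^bsub>\<E> n\<^esub> lin n q"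
proof -
  interpret P: module R "P n" by (rule P_module)
  obtain r where r: "r \<in> {..<u n} \<rightarrow> carrier R" "\<And>k. k < u n \<Longrightarrow> p k = I +> r k"
    using P_repE[OF p] by blast
  obtain s where s: "s \<in> {..<u n} \<rightarrow> carrier R" "\<And>k. k < u n \<Longrightarrow> q k = I +> s k"
    using P_repE[OF q] by blast
  have rs: "(\<lambda>k. r k \<oplus> s k) \<in> {..<u n} \<rightarrow> carrier R" using r s by (auto simp: Pi_iff)
  have "(p \<oplus>\<^bsub>P n\<^esub> q) k = I +> (r k \<oplus> s k)" if "k < u n" for k
    using that r s RI(3)[of "r k" "s k"] by (auto simp: P_simps Pi_iff)
  then show ?thesis
    using lin_eq[OF P.a_closed[OF p q] rs] lin_eq[OF p r] lin_eq[OF q s]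
      M.mlin_add[OF r(1) s(1) B'(3)] by simp
qed

lemma lin_smult:
  assumes a: "a \<in> carrier R" and p: "p \<in> carrier (P n)"
  shows "lin n (a \<odot>\<^bsub>P n\<^esub> p) = a \<odot>\<^bsub>\<E> n\<^esub> lin n p"
proof -
  interpret P: module R "P n" by (rule P_module)
  obtain r where r: "r \<in> {..<u n} \<rightarrow> carrier R" "\<And>k. k < u n \<Longrightarrow> p k = I +> r k"
    using P_repE[OF p] by blast
  have ar: "(\<lambda>k. a \<otimes> r k) \<in> {..<u n} \<rightarrow> carrier R" using r a by (auto simp: Pi_iff)
  have "(a \<odot>\<^bsub>P n\<^esub> p) k = I +> (a \<otimes> r k)" if "k < u n" for k
    using that r RI(4)[OF a, of "r k"] by (auto simp: P_simps Pi_iff)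
  then show ?thesis
    using lin_eq[OF P.smult_closed[OF a p] ar] lin_eq[OF p r] M.mlin_scale[OF _ a r(1) B'(3)] by simp
qed

text \<open>Independence of the basis puts representatives of all coordinates into \<open>I\<close>,
  so every coordinate is the zero coset.\<close>

lemma lin_boundary:
  assumes p: "p \<in> carrier (P n)" and bd: "lin n p \<in> tbd I n"
  shows "p = \<zero>\<^bsub>P n\<^esub>"
proof -
  obtain r where r: "r \<in> {..<u n} \<rightarrow> carrier R" "\<And>k. k < u n \<Longrightarrow> p k = I +> r k"
    using P_repE[OF p] by blast
  have "r k \<in> I" if "k < u n" for k
    using B'(5)[OF r(1), of k] bd that lin_eq[OF p r(1)] r(2) by simp
  then have "p k = I" if "k < u n" for k
    using r that rcoset_eq_self_iff[OF I, of "r k"] by (auto simp: Pi_iff)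
  then show ?thesis
    using p unfolding P_simps by (intro extensionalityI[of _ "{..<u n}"]) (auto simp: PiE_iff)
qed

lemma lin_surj:
  assumes "z \<in> tcyc I n"
  shows "\<exists>p\<in>carrier (P n). \<exists>c\<in>tbd I n. z = lin n p \<oplus>\<^bsub>\<E> n\<^esub> c"
proof -
  obtain r c where rc: "r \<in> {..<u n} \<rightarrow> carrier R" "c \<in> tbd I n"
    "z = M.mlin n {..<u n} r (b n) \<oplus>\<^bsub>\<E> n\<^esub> c" using B'(4)[OF assms] by blast
  define p where "p = (\<lambda>k\<in>{..<u n}. I +> r k)"
  have p: "p \<in> carrier (P n)" using rc(1) coset_in_RI by (auto simp: P_simps p_def)
  have "lin n p = M.mlin n {..<u n} r (b n)" by (rule lin_eq[OF p rc(1)]) (simp add: p_def)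
  then show ?thesis using rc p by metis
qed

definition psi :: "int \<Rightarrow> (nat \<Rightarrow> 'a set) \<Rightarrow> 'a set \<Rightarrow> 'e" where
  "psi n p = phi n (lin n p)"

lemma psi_cocycle: "p \<in> carrier (P n) \<Longrightarrow> psi n p \<in> cocycles K n"
  using lin_tcyc by (auto simp: RHom_cocycles psi_def)

lemma psi_hom: "psi n \<in> module_hom R (P n) (obj K n)"
  unfolding module_hom_def
proof (intro CollectI conjI ballI)
  show "psi n \<in> carrier (P n) \<rightarrow> carrier (obj K n)"
    using psi_cocycle by (auto simp: cocycles_def)
  fix p assume p: "p \<in> carrier (P n)"
  note tp = tcyc_tors[OF lin_tcyc[OF p]]
  show "psi n (r \<odot>\<^bsub>P n\<^esub> p) = r \<odot>\<^bsub>obj K n\<^esub> psi n p" if "r \<in> carrier R" for r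
    using lin_smult[OF that p] phi_smult[OF that tp] by (simp add: psi_def RHom_simps(1))
  fix q assume q: "q \<in> carrier (P n)"
  show "psi n (p \<oplus>\<^bsub>P n\<^esub> q) = psi n p \<oplus>\<^bsub>obj K n\<^esub> psi n q"
    using lin_add[OF p q] phi_add[OF tp tcyc_tors[OF lin_tcyc[OF q]]]
    by (simp add: psi_def RHom_simps(1))
qed

lemma psi_coboundary:
  assumes p: "p \<in> carrier (P n)" and bd: "psi n p \<in> coboundaries K n"
  shows "p = \<zero>\<^bsub>P n\<^esub>"
proof -
  obtain c where c: "c \<in> tbd I n" "phi n (lin n p) = phi n c"
    using bd by (auto simp: RHom_coboundaries psi_def)
  have "c \<in> tors I n" using c(1) tbd_tcyc[OF Isub] tcyc_tors by blast
  then have "lin n p = c" using phi_inj[OF tcyc_tors[OF lin_tcyc[OF p]]] c(2) by blast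
  then show ?thesis using lin_boundary[OF p] c(1) by simp
qed

lemma psi_surj:
  assumes w: "w \<in> cocycles K n"
  shows "\<exists>p\<in>carrier (P n). \<exists>c\<in>coboundaries K n. w = psi n p \<oplus>\<^bsub>obj K n\<^esub> c"
proof -
  obtain z where z: "z \<in> tcyc I n" "w = phi n z" using w by (auto simp: RHom_cocycles)
  obtain p c where pc: "p \<in> carrier (P n)" "c \<in> tbd I n" "z = lin n p \<oplus>\<^bsub>\<E> n\<^esub> c"
    using lin_surj[OF z(1)] by blast
  have "c \<in> tors I n" using pc(2) tbd_tcyc[OF Isub] tcyc_tors by blast
  then have "w = psi n p \<oplus>\<^bsub>obj K n\<^esub> phi n c"
    using phi_add[OF tcyc_tors[OF lin_tcyc[OF pc(1)]]] z(2) pc(3) by (simp add: psi_def RHom_simps(1))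
  then show ?thesis using pc(1,2) by (auto simp: RHom_coboundaries)
qed

text \<open>\<open>psi\<close> followed by passage to classes: \<open>psi_coboundary\<close> gives
  injectivity and \<open>psi_surj\<close> surjectivity.\<close>

lemma Ext_module_iso: "module_iso R (Ext R RI E n) (P n)"
  unfolding Ext_def
proof (rule module_isoI_inverse[OF P_module cohomology_module[OF RHom_cochain]])
  let ?N = "coboundaries K n"
  let ?f = "\<lambda>p. ?N +>\<^bsub>obj K n\<^esub> psi n p"
  interpret P: module R "P n" by (rule P_module)
  interpret Kn: module R "obj K n" by (rule obj_module[OF RHom_cochain])
  note psih = module_homD[OF psi_hom[of n]]
  note C = RHom_cochain
  show "?f \<in> module_hom R (P n) (cohomology K n)"
    unfolding module_hom_def cohomology_carrier[OF C]
    using psi_cocycle by (auto simp: psih cohomology_add[OF C] cohomology_smult[OF C])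
  show "bij_betw ?f (carrier (P n)) (carrier (cohomology K n))"
    unfolding bij_betw_def
  proof
    show "inj_on ?f (carrier (P n))"
    proof (rule inj_onI)
      fix p q assume p: "p \<in> carrier (P n)" and q: "q \<in> carrier (P n)" and eq: "?f p = ?f q"
      have "psi n p \<ominus>\<^bsub>obj K n\<^esub> psi n q \<in> ?N"
        using eq cohomology_coset_eq_iff[OF C psih(1)[OF p] psih(1)[OF q]] by simp
      then have "psi n (p \<ominus>\<^bsub>P n\<^esub> q) \<in> ?N"
        using module_hom_diff[OF P.module_axioms Kn.module_axioms psi_hom p q] by simp
      then have "p \<ominus>\<^bsub>P n\<^esub> q = \<zero>\<^bsub>P n\<^esub>" by (rule psi_coboundary[OF P.minus_closed[OF p q]])
      then show "p = q" using P.diff_add_cancel_M[OF p q] q by simp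
    qed
    show "?f ` carrier (P n) = carrier (cohomology K n)"
    proof
      show "?f ` carrier (P n) \<subseteq> carrier (cohomology K n)"
        using psi_cocycle by (auto simp: cohomology_carrier[OF C])
      show "carrier (cohomology K n) \<subseteq> ?f ` carrier (P n)"
      proof
        fix A assume "A \<in> carrier (cohomology K n)"
        then obtain w where w: "w \<in> cocycles K n" "A = ?N +>\<^bsub>obj K n\<^esub> w"
          by (auto simp: cohomology_carrier[OF C])
        obtain p c where pc: "p \<in> carrier (P n)" "c \<in> ?N" "w = psi n p \<oplus>\<^bsub>obj K n\<^esub> c"
          using psi_surj[OF w(1)] by blast
        have cc: "c \<in> carrier (obj K n)" by (rule Kn.submodule_carrier[OF coboundaries_submodule[OF C] pc(2)])
        have "w \<ominus>\<^bsub>obj K n\<^esub> psi n p \<in> ?N"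
          unfolding pc(3) using Kn.add_diff_cancel_left_M[OF psih(1)[OF pc(1)] cc] pc(2) by simp
        then have "A = ?f p"
          unfolding w(2) using cohomology_coset_eq_iff[OF C cocycles_carrier[OF C w(1)] psih(1)[OF pc(1)]]
          by simp
        then show "A \<in> ?f ` carrier (P n)" using pc(1) by blast
      qed
    qed
  qed
qed

text \<open>The shift by \<open>- j\<close> reads the stalk complex of \<open>P j\<close> in degree
  \<open>n - j\<close>, so only the summand with \<open>j = n\<close> contributes in degree
  \<open>n\<close>.\<close>

lemma L_obj: "obj L n = dsum_module UNIV (\<lambda>j. obj (stalk_complex (P j)) (n - j))"
  by (simp add: dsum_complex_def shift_complex_def)

lemma L_obj_module: "module R (obj L n)"
  unfolding L_obj by (rule dsum_module_module[OF stalk_complex_obj_module[OF P_module]])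

lemma L_zero: "\<zero>\<^bsub>obj L n\<^esub> = (\<lambda>j. \<zero>\<^bsub>P j\<^esub>)"
  by (simp add: L_obj dsum_module_simps stalk_complex_simps restrict_def)

lemma L_diff: "diff L n f = (\<lambda>j. \<zero>\<^bsub>P j\<^esub>)"
proof -
  have "\<ominus>\<^bsub>obj (stalk_complex (P j)) i\<^esub> \<zero>\<^bsub>P j\<^esub> = \<zero>\<^bsub>P j\<^esub>" for i j
  proof -
    interpret S: module R "obj (stalk_complex (P j)) i"
      by (rule stalk_complex_obj_module[OF P_module])
    have "\<ominus>\<^bsub>obj (stalk_complex (P j)) i\<^esub> \<zero>\<^bsub>obj (stalk_complex (P j)) i\<^esub> = \<zero>\<^bsub>obj (stalk_complex (P j)) i\<^esub>"
      by (rule S.M.minus_equality) auto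
    then show ?thesis by (simp add: stalk_complex_simps)
  qed
  then show ?thesis
    by (auto simp: dsum_complex_def shift_complex_def stalk_complex_simps fun_eq_iff)
qed

lemma L_memD:
  assumes "f \<in> carrier (obj L n)"
  shows "f n \<in> carrier (P n)" "j \<noteq> n \<Longrightarrow> f j = \<zero>\<^bsub>P j\<^esub>"
proof -
  have *: "f j \<in> carrier (obj (stalk_complex (P j)) (n - j))" for j
    using assms by (auto simp: L_obj dsum_module_simps)
  show "f n \<in> carrier (P n)" using *[of n] by (simp add: stalk_complex_simps)
  show "f j = \<zero>\<^bsub>P j\<^esub>" if "j \<noteq> n" using *[of j] that by (simp add: stalk_complex_simps)
qed

lemma L_memI:
  assumes p: "p \<in> carrier (P n)"
  shows "(\<lambda>j. if j = n then p else \<zero>\<^bsub>P j\<^esub>) \<in> carrier (obj L n)"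
proof -
  have "{j. (if j = n then p else \<zero>\<^bsub>P j\<^esub>) \<noteq> \<zero>\<^bsub>P j\<^esub>} \<subseteq> {n}" by auto
  then have "finite {j. (if j = n then p else \<zero>\<^bsub>P j\<^esub>) \<noteq> \<zero>\<^bsub>P j\<^esub>}" using finite_subset by blast
  then show ?thesis using p by (auto simp: L_obj dsum_module_simps stalk_complex_simps)
qed

lemma L_ops:
  "(f \<oplus>\<^bsub>obj L n\<^esub> g) j = f j \<oplus>\<^bsub>P j\<^esub> g j" "(r \<odot>\<^bsub>obj L n\<^esub> f) j = r \<odot>\<^bsub>P j\<^esub> f j"
  by (simp_all add: L_obj dsum_module_simps stalk_complex_simps)

lemma L_cochain: "cochain_complex R L"
  unfolding cochain_complex_def
proof (intro allI conjI ballI)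
  fix n
  show "module R (obj L n)" by (rule L_obj_module)
  interpret N: module R "obj L (n + 1)" by (rule L_obj_module)
  have d: "diff L n f = \<zero>\<^bsub>obj L (n + 1)\<^esub>" for f by (simp only: L_diff L_zero)
  show "diff L n \<in> module_hom R (obj L n) (obj L (n + 1))"
    unfolding module_hom_def d by simp
  show "diff L (n + 1) (diff L n f) = \<zero>\<^bsub>obj L (n + 2)\<^esub>" for f by (simp only: L_diff L_zero)
qed

lemma L_cocycles: "cocycles L n = carrier (obj L n)"
  unfolding cocycles_def L_diff L_zero by simp

lemma L_coboundaries: "coboundaries L n = {\<zero>\<^bsub>obj L n\<^esub>}"
proof -
  interpret N: module R "obj L (n - 1)" by (rule L_obj_module)
  show ?thesis unfolding coboundaries_def L_diff L_zero using N.zero_closed by blast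
qed

text \<open>\<open>L\<close> has zero differential, so its cohomology in degree \<open>n\<close> is
  \<open>P n\<close>. The map reads off component \<open>n\<close> and applies \<open>psi n\<close>;
  it commutes with differentials because \<open>psi n\<close> takes values in cocycles.\<close>

lemma L_quasi_iso: "quasi_iso R L K (\<lambda>n f. psi n (f n))"
proof -
  interpret Lm: module R "obj L n" for n by (rule L_obj_module)
  interpret Pm: module R "P n" for n by (rule P_module)
  interpret Km: module R "obj K n" for n by (rule obj_module[OF RHom_cochain])
  have psi0: "psi n \<zero>\<^bsub>P n\<^esub> = \<zero>\<^bsub>obj K n\<^esub>" for n
    by (rule module_hom_zero[OF Pm.module_axioms Km.module_axioms psi_hom])
  have cm: "chain_map R L K (\<lambda>n f. psi n (f n))"
    unfolding chain_map_def
  proof (intro allI conjI ballI)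
    fix n
    show "(\<lambda>f. psi n (f n)) \<in> module_hom R (obj L n) (obj K n)"
      using module_homD[OF psi_hom[of n]] L_memD(1) by (auto simp: module_hom_def L_ops)
    fix f assume "f \<in> carrier (obj L n)"
    then have "psi n (f n) \<in> cocycles K n" using psi_cocycle L_memD(1) by blast
    then show "psi (n + 1) (diff L n f (n + 1)) = diff K n (psi n (f n))"
      by (simp add: L_diff psi0 cocycles_def)
  qed
  show ?thesis
    unfolding quasi_iso_iff[OF L_cochain RHom_cochain cm] L_cocycles L_coboundaries
  proof (intro conjI allI ballI impI)
    fix n f assume f: "f \<in> carrier (obj L n)" "psi n (f n) \<in> coboundaries K n"
    have "f n = \<zero>\<^bsub>P n\<^esub>" using psi_coboundary L_memD(1) f by blast
    then have "f j = \<zero>\<^bsub>P j\<^esub>" for j using L_memD(2)[OF f(1), of j] by (cases "j = n") auto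
    then show "f \<in> {\<zero>\<^bsub>obj L n\<^esub>}" unfolding L_zero by auto
  next
    fix n w assume "w \<in> cocycles K n"
    then obtain p c where pc: "p \<in> carrier (P n)" "c \<in> coboundaries K n" "w = psi n p \<oplus>\<^bsub>obj K n\<^esub> c"
      using psi_surj by blast
    show "\<exists>f\<in>carrier (obj L n). \<exists>c\<in>coboundaries K n. w = psi n (f n) \<oplus>\<^bsub>obj K n\<^esub> c"
      by (rule bexI[OF _ L_memI[OF pc(1)]]) (use pc in auto)
  qed
qed

text \<open>The roof has apex \<open>L\<close> with the identity as its second leg, which meets the
  requirement that the apex be carried by the element type of \<open>L\<close>.\<close>

lemma RHom_derived_iso: "derived_iso R K L"
  unfolding derived_iso_def using RHom_cochain L_cochain L_quasi_iso quasi_iso_id[OF L_cochain] by blast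

end

end

theorem theorem1p1:
  fixes R :: "('a, 'r) ring_scheme" and m I :: "'a set" and d t :: nat
    and E :: "('a, 'e) cochain"
  assumes "cohen_macaulay_local_ring R m"
    and "krull_dim R = enat d"
    and "ulrich_ideal R m I"
    and "\<not> parameter_ideal R m I"
    and "\<exists>Q. parameter_ideal R m Q \<and> reduction_of R Q I"
    and "t = num_gens R I - d"
    and "injective_resolution R (regular_module R) E"
  shows "derived_iso R (RHom R (residue_module R I) E)
           (dsum_complex UNIV
              (\<lambda>i. shift_complex
                     (stalk_complex (power_module (residue_module R I) (ulrich_mult d t i))) (- i))) \<and>
         (\<forall>i. module_iso R (Ext R (residue_module R I) E i)
                (power_module (residue_module R I) (ulrich_mult d t i)))"
proof -
  interpret R: cring R
    using assms(1) by (simp add: cohen_macaulay_local_ring_def noetherian_local_ring_def)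
  obtain Q vs and S :: "'a set set" and y where vs: "R.regseq {\<zero>\<^bsub>R\<^esub>} vs"
    and Q: "Q = R.adjoins {\<zero>\<^bsub>R\<^esub>} vs" and len: "length vs = d"
    and I: "ideal I R" "Q \<subseteq> I" and mult: "\<forall>a\<in>I. \<forall>b\<in>I. a \<otimes>\<^bsub>R\<^esub> b \<in> Q"
    and basis: "R.quot_basis I Q S y" and card: "card S = num_gens R I - d" and ne: "S \<noteq> {}"
    using ulrich_ideal_structure[OF assms(1-4)] by blast
  have res: "cochain_complex R E" "\<And>i. i < 0 \<Longrightarrow> carrier (obj E i) = {\<zero>\<^bsub>obj E i\<^esub>}"
    "\<And>i. injective_module R (obj E i)"
    using assms(7) by (auto simp: injective_resolution_def)
  interpret injective_complex R E
    by unfold_locales (use res in auto)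
  obtain \<epsilon> where "quasi_iso R (stalk_complex (regular_module R)) E \<epsilon>"
    using assms(7) by (auto simp: injective_resolution_def)
  \<comment> \<open>Starting from degree 0 and the zero ideal, each of the \<open>d\<close> entries
    of \<open>vs\<close> raises the degree by one, ending in degree \<open>d\<close> with the ideal
    \<open>Q\<close>.\<close>
  then obtain e where e: "concentrated (int d) Q e"
    using concentrated_regseq[OF R.zeroideal vs concentrated_of_quasi_iso] Q len by auto
  have Qid: "ideal Q R" unfolding Q by (rule R.adjoins_ideal[OF R.zeroideal R.regseq_carrier[OF vs]])
  have Ic: "I \<subseteq> carrier R" by (rule R.ideal_subset_carrier[OF I(1)])
  have yI: "y \<in> S \<rightarrow> I" using basis by (simp add: R.quot_basis_def)
  \<comment> \<open>The basis \<open>y\<close> of \<open>I/Q\<close> over \<open>R/I\<close> enters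
    as the generators of the torsion sequence; that \<open>I\<close> kills \<open>I/Q\<close> is the
    inclusion of \<open>I I\<close> in \<open>Q\<close>.\<close>
  have "ulrich_complex R E Q I S y (int d) e"
  proof (rule ulrich_complex.intro[OF torsion_sequence.intro[OF injective_complex_axioms]],
      rule torsion_sequence_axioms.intro)
    show "ideal Q R" "ideal I R" "ideal I R" "Q \<subseteq> I" "y \<in> S \<rightarrow> I" by fact+
    show "finite S" using basis by (simp add: R.quot_basis_def)
    show "r k \<in> I" if "r \<in> S \<rightarrow> carrier R" "R.lincomb S r y \<in> Q" "k \<in> S" for r k
      using basis that by (simp add: R.quot_basis_def)
    show "a \<otimes>\<^bsub>R\<^esub> y k \<in> Q" if "a \<in> I" "k \<in> S" for a k using mult yI that by auto
    show "\<exists>q\<in>Q. \<exists>r\<in>S \<rightarrow> carrier R. a = q \<oplus>\<^bsub>R\<^esub> R.lincomb S r y" if a: "a \<in> I" for a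
    proof -
      obtain r where r: "r \<in> S \<rightarrow> carrier R" "a \<ominus>\<^bsub>R\<^esub> R.lincomb S r y \<in> Q"
        using basis a by (auto simp: R.quot_basis_def)
      have "y \<in> S \<rightarrow> carrier R" using yI Ic by auto
      then have "R.lincomb S r y \<in> carrier R" using R.lincomb_closed r(1) by blast
      moreover have "a \<in> carrier R" using a Ic by blast
      ultimately have "a = (a \<ominus>\<^bsub>R\<^esub> R.lincomb S r y) \<oplus>\<^bsub>R\<^esub> R.lincomb S r y" by algebra
      then show ?thesis using r by blast
    qed
    show "ulrich_complex_axioms R E Q S (int d) e"
      by (rule ulrich_complex_axioms.intro) (use e res ne in auto)
  qed
  then interpret U: ulrich_complex R E Q I S y "int d" e .
  have "\<forall>i. \<exists>b. cobasis i I {..<ulrich_mult d t i} b"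
    using U.cobasis_ulrich_mult[OF refl] card assms(6) by simp
  then obtain b where "\<And>i. cobasis i I {..<ulrich_mult d t i} (b i)" by metis
  then show ?thesis using RHom_derived_iso[OF I(1)] Ext_module_iso[OF I(1)] by blast
qed

end
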